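(* Consider the setting described in the context (independent design, non-differentiable sample paths), with $N\to\infty$, and let $t\in J\subset I=(0,1]$. Let $h_N\in\mathcal H_N$, $N\ge1$, be such that $$(N\lambda)^{1/(2H_t+1)}h_N\to0.$$ Assume moreover that $$\frac{\sigma^2(t)}{P_N(t;h_N)}\sum_{n=1}^N\pi_n(t;h_N)\Big\{\sum_{i=1}^{M_n}W_{n,i}^2(t;h_N)\Big\}\overset{\mathbb P}{\longrightarrow}\Sigma(t)\in[0,\infty)$$ and $$\operatorname{Var}_{M,T}\Big(\frac1{\sqrt{P_N(t;h_N)}}\sum_{n=1}^N\pi_n(t;h_N)\{X_n(t)-\mu(t)\}\Big)\overset{\mathbb P}{\longrightarrow}\mathbb S_\mu(t)\in(0,\infty).$$ Then $$\sqrt{P_N(t;h_N)}\,\{\widehat\mu_N(t;h_N)-\mu(t)\}\overset{d}{\longrightarrow}\mathcal N\big(0,\mathbb S_\mu(t)+\Sigma(t)\big).$$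
   Context: Process and data. $I=(0,1]$. $\{X_n\}_{n\in\mathbb Z}$ is a strictly stationary sequence of random functions on $I$ with almost surely continuous paths; $X$ has the stationary law; $\mu(t)=\mathbb E[X(t)]$. Observed: $Y_{n,i}=X_n(T_{n,i})+\sigma(T_{n,i})\varepsilon_{n,i}$, $1\le n\le N$, $1\le i\le M_n$. The $M_n$ are random draws of an integer variable $M\ge2$ with mean $\lambda=\lambda_N$ (the law may depend on $N$), and there are constants $\underline c,\overline c>0$ with $\underline c\le M/\lambda\le\overline c$ for all $N$. The $T_{n,i}$ are independent copies of $T\in I$ with Hölder continuous density $g$ satisfying $0<\underline c_g\le g\le\overline c_g$ on $I$. The $\varepsilon_{n,i}$ are independent copies of a centered unit-variance variable $\varepsilon$; $\sigma^2(\cdot)$ is Lipschitz. $\{X_n\}$ and the copies of $M,T,\varepsilon$ are mutually independent. $\operatorname{Var}_{M,T}$ denotes the conditional variance given all $M_n$ and $T_{n,i}$, $1\le i\le M_n$, $1\le n\le N$. Local regularity. $J\subset I$ is an open interval; there are Lipschitz functions $H:J\to(0,1)$, $L:J\to(0,\infty)$ with $0<\inf_JH\le\sup_JH<1$, $0<\inf_JL\le\sup_JL<\infty$, and constants $\beta_0,S_0,\Delta_{0,0}>0$ such that $0<\inf_{u\in J}\mathbb E[X(u)^2]\le\sup_{u\in J}\mathbb E[X(u)^2]<\infty$ and $|\mathbb E[\{X(u)-X(v)\}^2]-L_t^2|u-v|^{2H_t}|\le S_0^2|u-v|^{2H_t+2\beta_0}$ for all $t,u,v\in J$ with $t-\Delta_{0,0}/2\le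 u\le t\le v\le t+\Delta_{0,0}/2$. Weak dependence. With $\nu_p(Z)=(\mathbb E|Z|^p)^{1/p}$, for some $p\ge4$: $\nu_p(\|X_n\|_\infty)<\infty$; $X_n=f(\xi_n,\xi_{n-1},\dots)$ with $\{\xi_n\}$ i.i.d. copies of $\xi$ in a measurable space $S$, $f:S^\infty\to\mathcal C(I)$ measurable; with $\{\xi_k^{(n)}\}_k$ (for each $n$) independent copies of $\xi$ on the same probability space and $X_n^{(m)}=f(\xi_n,\dots,\xi_{n-m+1},\xi^{(n)}_{n-m},\xi^{(n)}_{n-m-1},\dots)$, there are $c>0,\alpha>3/2$ with $\nu_p(\|X_m-X_m^{(m)}\|_\infty)\le cm^{-\alpha}$, $m\ge1$. Moreover $\mathbb E|\varepsilon|^p<\infty$. Smoothing. $\widehat X_n(t;h)=\sum_{i=1}^{M_n}W_{n,i}(t;h)Y_{n,i}$, $W_{n,i}(t;h)=K((T_{n,i}-t)/h)/\sum_kK((T_{n,k}-t)/h)$ (convention $0/0=0$), $K$ a non-negative, symmetric, bounded kernel supported in $[-1,1]$ with $\inf_{|u|\le1}K(u)>0$. $\pi_n(t;h)=1$ if some $T_{n,i}\in[t-h,t+h]$, and $0$ otherwise; $P_N(t;h)=\sum_{n=1}^N\pi_n(t;h)$; $\widehat\mu_N(t;h)=P_N(t;h)^{-1}\sum_{n=1}^N\pi_n(t;h)\widehat X_n(t;h)$. Bandwidth grid. $\mathcal H_N$ is a finite set with at most $(N\lambda)^{c}$ points for some $c>0$, $\max\mathcal H_N\to0$, $N\lambda\min\mathcal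 H_N/\log(N\lambda)\to\infty$; moreover $\log(N)/\log^2(\lambda)\to0$. Regularity estimators (a listed assumption of the paper; they do not appear in the conclusion). There are estimators $\widehat H_t,\widehat L_t^2$ of $(H_t,L_t^2)\in(0,1)\times(0,\infty)$ such that, with $\varphi=(\log\lambda)^{-2}$, $\psi=(\log\lambda)^{-1}$, a spacing $\Delta=\Delta_\lambda\in(0,1)$ and positive constants $\mathfrak b,\mathfrak c_0,\mathfrak f_0,\mathfrak g_0,\mathfrak l_0$, $\mathbb P(|\widehat H_t-H_t|>\varphi)\le\frac{\mathfrak f_0}{N\varphi^2\Delta^{4H_t}}+\mathfrak be^{-\mathfrak g_0N\varphi^2\Delta^{4H_t}}$ and $\mathbb P(|\widehat L_t^2-L_t^2|>\psi)\le\frac{\mathfrak c_0}{N\psi^2\Delta^{4H_t+4\varphi}}+\frac{\mathfrak f_0}{N\varphi^2\Delta^{4H_t}}+\mathfrak be^{-\mathfrak l_0N\psi^2\Delta^{4H_t+4\varphi}}+4\mathfrak be^{-\mathfrak g_0N\varphi^2\Delta^{4H_t}}$. *)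

theory Defs
  imports "HOL-Probability.Probability"
begin

abbreviation time_domain :: "real set" where
  "time_domain \<equiv> {0<..1}"


section \<open>Modes of convergence and moments\<close>

definition tendsto_in_prob :: "'a measure \<Rightarrow> (nat \<Rightarrow> 'a \<Rightarrow> real) \<Rightarrow> real \<Rightarrow> bool" where
  "tendsto_in_prob Pr Z c \<longleftrightarrow>
     (\<forall>e>0. (\<lambda>N. measure Pr {\<omega> \<in> space Pr. \<bar>Z N \<omega> - c\<bar> > e}) \<longlonglongrightarrow> 0)"

text \<open>The supremum norm takes values in the extended nonnegative reals, since a continuous
  function on the half-open domain may be unbounded.\<close>

definition supnorm :: "(real \<Rightarrow> real) \<Rightarrow> ennreal" where
  "supnorm x = (SUP u\<in>time_domain. ennreal \<bar>x u\<bar>)"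

text \<open>Only used with exponents \<open>a > 0\<close>.\<close>

definition ennpowr :: "ennreal \<Rightarrow> real \<Rightarrow> ennreal" where
  "ennpowr x a = (if x = \<top> then \<top> else ennreal (enn2real x powr a))"

definition nu :: "'a measure \<Rightarrow> real \<Rightarrow> ('a \<Rightarrow> ennreal) \<Rightarrow> ennreal" where
  "nu Pr p Z = ennpowr (\<integral>\<^sup>+\<omega>. ennpowr (Z \<omega>) p \<partial>Pr) (1 / p)"

definition cond_var :: "'a measure \<Rightarrow> 'a measure \<Rightarrow> ('a \<Rightarrow> real) \<Rightarrow> 'a \<Rightarrow> real" where
  "cond_var Pr G Z = real_cond_exp Pr G (\<lambda>\<omega>. (Z \<omega> - real_cond_exp Pr G Z \<omega>)\<^sup>2)"


section \<open>Smoothing and the mean estimator\<close>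

text \<open>
  Here \<open>m\<close>, \<open>s\<close>, \<open>y\<close> are realised values. For a single curve they are the number of
  observation points, the points and the observed values (indexed from 1); for the sample
  they carry the index \<open>n\<close> of the curve as an additional first argument. The convention
  \<open>0 / 0 = 0\<close> is that of HOL.
\<close>

definition nw_weight ::
  "(real \<Rightarrow> real) \<Rightarrow> nat \<Rightarrow> (nat \<Rightarrow> real) \<Rightarrow> real \<Rightarrow> real \<Rightarrow> nat \<Rightarrow> real" where
  "nw_weight K m s t h i = K ((s i - t) / h) / (\<Sum>k=1..m. K ((s k - t) / h))"

definition curve_hat ::
  "(real \<Rightarrow> real) \<Rightarrow> nat \<Rightarrow> (nat \<Rightarrow> real) \<Rightarrow> (nat \<Rightarrow> real) \<Rightarrow> real \<Rightarrow> real \<Rightarrow> real" where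
  "curve_hat K m s y t h = (\<Sum>i=1..m. nw_weight K m s t h i * y i)"

definition sel :: "nat \<Rightarrow> (nat \<Rightarrow> real) \<Rightarrow> real \<Rightarrow> real \<Rightarrow> real" where
  "sel m s t h = (if \<exists>i\<in>{1..m}. s i \<in> {t - h..t + h} then 1 else 0)"

definition sel_count ::
  "nat \<Rightarrow> (nat \<Rightarrow> nat) \<Rightarrow> (nat \<Rightarrow> nat \<Rightarrow> real) \<Rightarrow> real \<Rightarrow> real \<Rightarrow> real" where
  "sel_count N m s t h = (\<Sum>n=1..N. sel (m n) (s n) t h)"

definition mean_hat ::
  "(real \<Rightarrow> real) \<Rightarrow> nat \<Rightarrow> (nat \<Rightarrow> nat) \<Rightarrow> (nat \<Rightarrow> nat \<Rightarrow> real) \<Rightarrow> (nat \<Rightarrow> nat \<Rightarrow> real)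
    \<Rightarrow> real \<Rightarrow> real \<Rightarrow> real" where
  "mean_hat K N m s y t h =
     (\<Sum>n=1..N. sel (m n) (s n) t h * curve_hat K (m n) (s n) (y n) t h) / sel_count N m s t h"

definition smoothing_kernel :: "(real \<Rightarrow> real) \<Rightarrow> bool" where
  "smoothing_kernel K \<longleftrightarrow>
     K \<in> borel_measurable borel \<and> (\<forall>u. 0 \<le> K u) \<and> (\<forall>u. K (- u) = K u) \<and> bounded (range K) \<and>
     (\<forall>u. \<bar>u\<bar> > 1 \<longrightarrow> K u = 0) \<and> 0 < (INF u\<in>{-1..1}. K u)"


section \<open>Process and data\<close>

definition path_family ::
  "(int \<Rightarrow> 'a \<Rightarrow> real \<Rightarrow> real) \<Rightarrow> 'a \<Rightarrow> int \<times> real \<Rightarrow> real" where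
  "path_family X \<omega> = (\<lambda>(n, u)\<in>UNIV \<times> time_domain. X n \<omega> u)"

abbreviation path_family_space :: "(int \<times> real \<Rightarrow> real) measure" where
  "path_family_space \<equiv> Pi\<^sub>M (UNIV \<times> time_domain) (\<lambda>_. borel)"

definition strictly_stationary :: "'a measure \<Rightarrow> (int \<Rightarrow> 'a \<Rightarrow> real \<Rightarrow> real) \<Rightarrow> bool" where
  "strictly_stationary Pr X \<longleftrightarrow>
     (\<forall>n. \<forall>u\<in>time_domain. (\<lambda>\<omega>. X n \<omega> u) \<in> borel_measurable Pr) \<and>
     (\<forall>k. distr Pr path_family_space (path_family (\<lambda>n. X (n + k))) =
          distr Pr path_family_space (path_family X))"

text \<open>\<open>X 0\<close> serves as a variable with the stationary law.\<close>

definition mean_fun :: "'a measure \<Rightarrow> (int \<Rightarrow> 'a \<Rightarrow> real \<Rightarrow> real) \<Rightarrow> real \<Rightarrow> real" where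
  "mean_fun Pr X u = (\<integral>\<omega>. X 0 \<omega> u \<partial>Pr)"

definition obs ::
  "(int \<Rightarrow> 'a \<Rightarrow> real \<Rightarrow> real) \<Rightarrow> (nat \<Rightarrow> nat \<Rightarrow> 'a \<Rightarrow> real) \<Rightarrow> (real \<Rightarrow> real)
    \<Rightarrow> (nat \<Rightarrow> nat \<Rightarrow> 'a \<Rightarrow> real) \<Rightarrow> nat \<Rightarrow> nat \<Rightarrow> 'a \<Rightarrow> real" where
  "obs X T \<sigma> \<epsilon> n i \<omega> = X (int n) \<omega> (T n i \<omega>) + \<sigma> (T n i \<omega>) * \<epsilon> n i \<omega>"

definition holder_on :: "real set \<Rightarrow> (real \<Rightarrow> real) \<Rightarrow> bool" where
  "holder_on A g \<longleftrightarrow>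
     (\<exists>C a. 0 < a \<and> a \<le> 1 \<and> (\<forall>u\<in>A. \<forall>v\<in>A. \<bar>g u - g v\<bar> \<le> C * \<bar>u - v\<bar> powr a))"

text \<open>The mutually independent sources of randomness in a sample of \<open>N\<close> curves: the whole
  process, and every single count, observation point and error.\<close>

datatype source = Process | Count nat | Point nat nat | Noise nat nat

definition sources :: "nat \<Rightarrow> source set" where
  "sources N = {Process} \<union> Count ` {1..N} \<union>
     {Point n i | n i. 1 \<le> n \<and> 1 \<le> i} \<union> {Noise n i | n i. 1 \<le> n \<and> 1 \<le> i}"

fun source_events ::
  "'a measure \<Rightarrow> (int \<Rightarrow> 'a \<Rightarrow> real \<Rightarrow> real) \<Rightarrow> (nat \<Rightarrow> 'a \<Rightarrow> nat) \<Rightarrow> (nat \<Rightarrow> nat \<Rightarrow> 'a \<Rightarrow> real)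
    \<Rightarrow> (nat \<Rightarrow> nat \<Rightarrow> 'a \<Rightarrow> real) \<Rightarrow> source \<Rightarrow> 'a set set" where
  "source_events Pr X Mc T \<epsilon> Process =
     sets (vimage_algebra (space Pr) (path_family X) path_family_space)"
| "source_events Pr X Mc T \<epsilon> (Count n) =
     sets (vimage_algebra (space Pr) (Mc n) (count_space UNIV))"
| "source_events Pr X Mc T \<epsilon> (Point n i) = sets (vimage_algebra (space Pr) (T n i) borel)"
| "source_events Pr X Mc T \<epsilon> (Noise n i) = sets (vimage_algebra (space Pr) (\<epsilon> n i) borel)"

text \<open>
  The law \<open>Mlaw N\<close> of the number of points per curve may change with \<open>N\<close>, so the counts form
  a triangular array: \<open>Mc N n\<close> is the number of points on curve \<open>n\<close> in the sample of size
  \<open>N\<close>. Nothing is assumed about the joint law of the counts for different \<open>N\<close>.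
  Measurability of \<open>\<sigma>\<close> and of the observations is explicit because the paths need to
  be continuous only almost surely.
\<close>

locale sampling_model = prob_space Pr
  for Pr :: "'a measure" +
  fixes X :: "int \<Rightarrow> 'a \<Rightarrow> real \<Rightarrow> real"
    and lam :: "nat \<Rightarrow> real"
    and Mlaw :: "nat \<Rightarrow> nat pmf"
    and Mc :: "nat \<Rightarrow> nat \<Rightarrow> 'a \<Rightarrow> nat"
    and g :: "real \<Rightarrow> real"
    and T :: "nat \<Rightarrow> nat \<Rightarrow> 'a \<Rightarrow> real"
    and \<sigma> :: "real \<Rightarrow> real"
    and noise_law :: "real measure"
    and \<epsilon> :: "nat \<Rightarrow> nat \<Rightarrow> 'a \<Rightarrow> real"
  assumes stationary: "strictly_stationary Pr X"
    and continuous_paths: "\<And>n. AE \<omega> in Pr. continuous_on time_domain (X n \<omega>)"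
    and count_law_ge_2: "\<And>N m. N \<ge> 1 \<Longrightarrow> m \<in> set_pmf (Mlaw N) \<Longrightarrow> m \<ge> 2"
    and count_law_mean: "\<And>N. N \<ge> 1 \<Longrightarrow> lam N = measure_pmf.expectation (Mlaw N) real"
    and count_law_ratio: "\<exists>c C. 0 < c \<and> 0 < C \<and>
          (\<forall>N\<ge>1. \<forall>m\<in>set_pmf (Mlaw N). c \<le> real m / lam N \<and> real m / lam N \<le> C)"
    and count_measurable:
          "\<And>N n. 1 \<le> n \<Longrightarrow> n \<le> N \<Longrightarrow> Mc N n \<in> measurable Pr (count_space UNIV)"
    and count_distr:
          "\<And>N n. 1 \<le> n \<Longrightarrow> n \<le> N \<Longrightarrow> distr Pr (count_space UNIV) (Mc N n) = measure_pmf (Mlaw N)"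
    and density_holder: "holder_on time_domain g"
    and density_bounds: "\<exists>c C. 0 < c \<and> (\<forall>u\<in>time_domain. c \<le> g u \<and> g u \<le> C)"
    and points_distr: "\<And>n i. 1 \<le> n \<Longrightarrow> 1 \<le> i \<Longrightarrow>
          distributed Pr lborel (T n i) (\<lambda>u. ennreal (g u) * indicator time_domain u)"
    and variance_lipschitz: "\<exists>C. C-lipschitz_on time_domain (\<lambda>u. (\<sigma> u)\<^sup>2)"
    and sigma_measurable: "set_borel_measurable borel time_domain \<sigma>"
    and noise_law: "real_distribution noise_law"
    and noise_centered: "integrable noise_law (\<lambda>x. x)" "(\<integral>x. x \<partial>noise_law) = 0"
    and noise_unit_variance: "integrable noise_law (\<lambda>x. x\<^sup>2)" "(\<integral>x. x\<^sup>2 \<partial>noise_law) = 1"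
    and noise_measurable: "\<And>n i. 1 \<le> n \<Longrightarrow> 1 \<le> i \<Longrightarrow> \<epsilon> n i \<in> borel_measurable Pr"
    and noise_distr: "\<And>n i. 1 \<le> n \<Longrightarrow> 1 \<le> i \<Longrightarrow> distr Pr borel (\<epsilon> n i) = noise_law"
    and obs_measurable: "\<And>n i. 1 \<le> n \<Longrightarrow> 1 \<le> i \<Longrightarrow> obs X T \<sigma> \<epsilon> n i \<in> borel_measurable Pr"
    and sources_indep: "\<And>N. N \<ge> 1 \<Longrightarrow> indep_sets (source_events Pr X (Mc N) T \<epsilon>) (sources N)"

text \<open>
  The information carried by \<open>M\<^sub>n\<close>, \<open>T\<^sub>n\<^sub>,\<^sub>i\<close> with \<open>1 \<le> i \<le> M\<^sub>n\<close>, \<open>1 \<le> n \<le> N\<close>: the random range of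
  \<open>i\<close> is encoded by replacing the entries with \<open>i > M\<^sub>n\<close> by 0, which loses nothing as \<open>M\<^sub>n\<close>
  itself is recorded. The algebra of the data also contains the observed values.
\<close>

definition count_record :: "nat \<Rightarrow> (nat \<Rightarrow> 'a \<Rightarrow> nat) \<Rightarrow> 'a \<Rightarrow> nat \<Rightarrow> nat" where
  "count_record N m \<omega> = (\<lambda>n\<in>{1..N}. m n \<omega>)"

definition array_record ::
  "nat \<Rightarrow> (nat \<Rightarrow> 'a \<Rightarrow> nat) \<Rightarrow> (nat \<Rightarrow> nat \<Rightarrow> 'a \<Rightarrow> real) \<Rightarrow> 'a \<Rightarrow> nat \<times> nat \<Rightarrow> real" where
  "array_record N m Z \<omega> = (\<lambda>(n, i)\<in>{1..N} \<times> {1..}. if i \<le> m n \<omega> then Z n i \<omega> else 0)"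

abbreviation count_record_space :: "nat \<Rightarrow> (nat \<Rightarrow> nat) measure" where
  "count_record_space N \<equiv> Pi\<^sub>M {1..N} (\<lambda>_. count_space UNIV)"

abbreviation array_record_space :: "nat \<Rightarrow> (nat \<times> nat \<Rightarrow> real) measure" where
  "array_record_space N \<equiv> Pi\<^sub>M ({1..N} \<times> {1..}) (\<lambda>_. borel)"

definition design_algebra ::
  "'a measure \<Rightarrow> nat \<Rightarrow> (nat \<Rightarrow> 'a \<Rightarrow> nat) \<Rightarrow> (nat \<Rightarrow> nat \<Rightarrow> 'a \<Rightarrow> real) \<Rightarrow> 'a measure" where
  "design_algebra Pr N m T =
     vimage_algebra (space Pr) (\<lambda>\<omega>. (count_record N m \<omega>, array_record N m T \<omega>))
       (count_record_space N \<Otimes>\<^sub>M array_record_space N)"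

definition data_algebra ::
  "'a measure \<Rightarrow> nat \<Rightarrow> (nat \<Rightarrow> 'a \<Rightarrow> nat) \<Rightarrow> (nat \<Rightarrow> nat \<Rightarrow> 'a \<Rightarrow> real)
    \<Rightarrow> (nat \<Rightarrow> nat \<Rightarrow> 'a \<Rightarrow> real) \<Rightarrow> 'a measure" where
  "data_algebra Pr N m T Y =
     vimage_algebra (space Pr)
       (\<lambda>\<omega>. (count_record N m \<omega>, array_record N m T \<omega>, array_record N m Y \<omega>))
       (count_record_space N \<Otimes>\<^sub>M array_record_space N \<Otimes>\<^sub>M array_record_space N)"


section \<open>Assumptions on the process, the bandwidths and the regularity estimators\<close>

definition local_regularity ::
  "'a measure \<Rightarrow> (int \<Rightarrow> 'a \<Rightarrow> real \<Rightarrow> real) \<Rightarrow> real set \<Rightarrow> (real \<Rightarrow> real) \<Rightarrow> (real \<Rightarrow> real) \<Rightarrow> bool"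
  where
  "local_regularity Pr X J H L \<longleftrightarrow>
     open J \<and> is_interval J \<and> J \<subseteq> time_domain \<and>
     (\<forall>u\<in>J. 0 < H u \<and> H u < 1) \<and> (\<exists>C. C-lipschitz_on J H) \<and>
     0 < (INF u\<in>J. H u) \<and> (SUP u\<in>J. H u) < 1 \<and>
     (\<forall>u\<in>J. 0 < L u) \<and> (\<exists>C. C-lipschitz_on J L) \<and>
     0 < (INF u\<in>J. L u) \<and> bdd_above (L ` J) \<and>
     (\<forall>u\<in>J. integrable Pr (\<lambda>\<omega>. (X 0 \<omega> u)\<^sup>2)) \<and>
     0 < (INF u\<in>J. \<integral>\<omega>. (X 0 \<omega> u)\<^sup>2 \<partial>Pr) \<and>
     bdd_above ((\<lambda>u. \<integral>\<omega>. (X 0 \<omega> u)\<^sup>2 \<partial>Pr) ` J) \<and>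
     (\<exists>\<beta>\<^sub>0 S\<^sub>0 \<Delta>\<^sub>0. 0 < \<beta>\<^sub>0 \<and> 0 < S\<^sub>0 \<and> 0 < \<Delta>\<^sub>0 \<and>
       (\<forall>t\<in>J. \<forall>u\<in>J. \<forall>v\<in>J. t - \<Delta>\<^sub>0 / 2 \<le> u \<and> u \<le> t \<and> t \<le> v \<and> v \<le> t + \<Delta>\<^sub>0 / 2 \<longrightarrow>
         \<bar>(\<integral>\<omega>. (X 0 \<omega> u - X 0 \<omega> v)\<^sup>2 \<partial>Pr) - (L t)\<^sup>2 * \<bar>u - v\<bar> powr (2 * H t)\<bar>
           \<le> S\<^sub>0\<^sup>2 * \<bar>u - v\<bar> powr (2 * H t + 2 * \<beta>\<^sub>0)))"

text \<open>
  \<open>\<xi>' n k\<close> is the \<open>k\<close>-th element of the copy of the innovations attached to index \<open>n\<close>. A sequence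
  \<open>s\<close> of inputs of \<open>f\<close> lists the innovations from the present to the past. Measurability
  of \<open>f\<close> is with respect to the evaluation maps, which generate the Borel sets of the continuous
  functions for locally uniform convergence.
\<close>

definition coupled_version ::
  "((nat \<Rightarrow> 's) \<Rightarrow> real \<Rightarrow> real) \<Rightarrow> (int \<Rightarrow> 'a \<Rightarrow> 's) \<Rightarrow> (int \<Rightarrow> int \<Rightarrow> 'a \<Rightarrow> 's)
    \<Rightarrow> int \<Rightarrow> nat \<Rightarrow> 'a \<Rightarrow> real \<Rightarrow> real" where
  "coupled_version f \<xi> \<xi>' n m \<omega> =
     f (\<lambda>k. if k < m then \<xi> (n - int k) \<omega> else \<xi>' n (n - int k) \<omega>)"

definition weakly_dependent ::
  "'a measure \<Rightarrow> (int \<Rightarrow> 'a \<Rightarrow> real \<Rightarrow> real) \<Rightarrow> real \<Rightarrow> 's measure \<Rightarrow> ((nat \<Rightarrow> 's) \<Rightarrow> real \<Rightarrow> real)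
    \<Rightarrow> (int \<Rightarrow> 'a \<Rightarrow> 's) \<Rightarrow> (int \<Rightarrow> int \<Rightarrow> 'a \<Rightarrow> 's) \<Rightarrow> bool" where
  "weakly_dependent Pr X p S f \<xi> \<xi>' \<longleftrightarrow>
     p \<ge> 4 \<and>
     (\<forall>n. nu Pr p (\<lambda>\<omega>. supnorm (X n \<omega>)) < \<top>) \<and>
     (\<forall>s\<in>space (Pi\<^sub>M UNIV (\<lambda>_. S)). continuous_on time_domain (f s)) \<and>
     (\<forall>u\<in>time_domain. (\<lambda>s. f s u) \<in> borel_measurable (Pi\<^sub>M UNIV (\<lambda>_. S))) \<and>
     prob_space.indep_vars Pr (\<lambda>_. S)
       (\<lambda>j. case j of Inl k \<Rightarrow> \<xi> k | Inr (n, k) \<Rightarrow> \<xi>' n k) (UNIV :: (int + int \<times> int) set) \<and>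
     (\<forall>k. distr Pr S (\<xi> k) = distr Pr S (\<xi> 0)) \<and>
     (\<forall>n k. distr Pr S (\<xi>' n k) = distr Pr S (\<xi> 0)) \<and>
     (\<forall>n. AE \<omega> in Pr. \<forall>u\<in>time_domain. X n \<omega> u = f (\<lambda>k. \<xi> (n - int k) \<omega>) u) \<and>
     (\<exists>c \<alpha>. 0 < c \<and> 3 / 2 < \<alpha> \<and>
       (\<forall>m\<ge>1. nu Pr p (\<lambda>\<omega>. supnorm (\<lambda>u. X (int m) \<omega> u - coupled_version f \<xi> \<xi>' (int m) m \<omega> u))
                 \<le> ennreal (c * real m powr (- \<alpha>))))"

definition bandwidth_grid :: "(nat \<Rightarrow> real) \<Rightarrow> (nat \<Rightarrow> real set) \<Rightarrow> bool" where
  "bandwidth_grid lam \<H> \<longleftrightarrow>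
     (\<forall>N\<ge>1. finite (\<H> N)) \<and>
     (\<exists>c>0. \<forall>N\<ge>1. real (card (\<H> N)) \<le> (real N * lam N) powr c) \<and>
     (\<lambda>N. Max (\<H> N)) \<longlonglongrightarrow> 0 \<and>
     filterlim (\<lambda>N. real N * lam N * Min (\<H> N) / ln (real N * lam N)) at_top sequentially \<and>
     (\<lambda>N. ln (real N) / (ln (lam N))\<^sup>2) \<longlonglongrightarrow> 0"

text \<open>\<open>Hhat N\<close> and \<open>L2hat N\<close> estimate \<open>Ht\<close> and \<open>Lt\<^sup>2\<close> from the data with algebra \<open>\<D> N\<close>.\<close>

definition regularity_estimators ::
  "'a measure \<Rightarrow> (nat \<Rightarrow> 'a measure) \<Rightarrow> (nat \<Rightarrow> real) \<Rightarrow> real \<Rightarrow> real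
    \<Rightarrow> (nat \<Rightarrow> 'a \<Rightarrow> real) \<Rightarrow> (nat \<Rightarrow> 'a \<Rightarrow> real) \<Rightarrow> bool" where
  "regularity_estimators Pr \<D> lam Ht Lt Hhat L2hat \<longleftrightarrow>
     (\<forall>N\<ge>1. Hhat N \<in> borel_measurable (\<D> N) \<and> L2hat N \<in> borel_measurable (\<D> N)) \<and>
     (\<exists>(\<Delta> :: real \<Rightarrow> real) b c\<^sub>0 f\<^sub>0 g\<^sub>0 l\<^sub>0.
       0 < b \<and> 0 < c\<^sub>0 \<and> 0 < f\<^sub>0 \<and> 0 < g\<^sub>0 \<and> 0 < l\<^sub>0 \<and>
       (\<forall>N\<ge>1.
         let D = \<Delta> (lam N); \<phi> = 1 / (ln (lam N))\<^sup>2; \<psi> = 1 / ln (lam N) in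
         0 < D \<and> D < 1 \<and>
         measure Pr {\<omega> \<in> space Pr. \<bar>Hhat N \<omega> - Ht\<bar> > \<phi>}
           \<le> f\<^sub>0 / (real N * \<phi>\<^sup>2 * D powr (4 * Ht))
             + b * exp (- g\<^sub>0 * real N * \<phi>\<^sup>2 * D powr (4 * Ht)) \<and>
         measure Pr {\<omega> \<in> space Pr. \<bar>L2hat N \<omega> - Lt\<^sup>2\<bar> > \<psi>}
           \<le> c\<^sub>0 / (real N * \<psi>\<^sup>2 * D powr (4 * Ht + 4 * \<phi>))
             + f\<^sub>0 / (real N * \<phi>\<^sup>2 * D powr (4 * Ht))
             + b * exp (- l\<^sub>0 * real N * \<psi>\<^sup>2 * D powr (4 * Ht + 4 * \<phi>))
             + 4 * b * exp (- g\<^sub>0 * real N * \<phi>\<^sup>2 * D powr (4 * Ht))))"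

end

theory Submission
  imports Defs
begin

text \<open>
  The scaled error splits into a signal (the normalised sum of \<open>X n t - \<mu> t\<close> over the selected
  curves), a noise term, and a smoothing bias. The second moment of the bias is at most a constant
  times \<open>N \<lambda> h\<close> times \<open>h\<close> to the power \<open>2 H\<close>, which vanishes by the choice of the bandwidth. The design is independent of the
  curves and the errors, so the characteristic function of signal plus noise is the expectation,
  over the design, of the product of the characteristic function of a sum of the process over a
  deterministic set of indices and of those of the weighted errors.

  For the first factor one needs a central limit theorem that is uniform over all index sets of large
  cardinality. The process is replaced by its coupled, m-dependent version: the differences have
  summable covariances, so the error is small uniformly in the index set. For m-dependent
  sums the characteristic function \<open>\<psi>\<close> satisfies \<open>\<psi>' x = - x V \<psi> x\<close> up to an explicit error
  (the method of Tikhomirov), where \<open>V\<close> is the variance. Given the design, this variance is the conditional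
  variance that converges by assumption. The second factor is handled by a second-order
  expansion, and the number of selected curves tends to infinity by a Chernoff bound.
\<close>

section \<open>Characteristic functions of m-dependent sums\<close>

text \<open>The obstacle is that the curves are dependent while the selected indices are random and
  may have gaps of any size, so that the selected subsequence is neither stationary nor fit for
  blocking. Tikhomirov's expansion survives this because it only looks at indices within distance 2
  m of a given one, and any index set has at most 4 m of these. The normalised variance need not
  converge along arbitrary index sets, so the limit theorem compares with the Gaussian law of the
  set's own variance; uniformity then only asks for an upper bound on that variance, and the assumed
  convergence in probability enters after the design has been frozen. The exponent in the bandwidth
  condition comes from N \<lambda> h h^(2 H) being the power 2 H + 1 of (N \<lambda>)^(1 / (2 H +
  1)) h. The bias involves the path at a random point; as the paths are continuous only almost
  surely, it is reached through values at deterministic points and Fatou's lemma.\<close>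

lemma cmod_iexp_diff_le: "cmod (iexp x - iexp y) \<le> \<bar>x - y\<bar>"
proof -
  have "iexp x - iexp y = iexp y * (iexp (x - y) - 1)"
    by (simp add: algebra_simps flip: exp_add)
  then have "cmod (iexp x - iexp y) = cmod (iexp (x - y) - 1)"
    by (simp add: norm_mult)
  also have "\<dots> \<le> \<bar>x - y\<bar>"
    using iexp_approx1[of "x - y" 0] by simp
  finally show ?thesis .
qed

lemma cmod_iexp_taylor_le: "cmod (iexp (x + y) - iexp y - \<i> * x * iexp y) \<le> x\<^sup>2 / 2"
proof -
  have "iexp (x + y) - iexp y - \<i> * x * iexp y = iexp y * (iexp x - (1 + \<i> * x))"
    by (simp add: algebra_simps flip: exp_add)
  then have "cmod (iexp (x + y) - iexp y - \<i> * x * iexp y) = cmod (iexp x - (1 + \<i> * x))"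
    by (simp add: norm_mult)
  also have "\<dots> \<le> x\<^sup>2 / 2"
    using iexp_approx1[of x 1] by (simp add: power2_eq_square)
  finally show ?thesis .
qed

lemma exp_neg_lipschitz:
  fixes a b :: real
  assumes "0 \<le> a" "0 \<le> b"
  shows "cmod (of_real (exp (- a)) - of_real (exp (- b))) \<le> \<bar>a - b\<bar>"
proof -
  have *: "\<bar>exp (- a) - exp (- b)\<bar> \<le> \<bar>a - b\<bar>" if "0 \<le> a" "a \<le> b" for a b :: real
  proof -
    have le: "1 - exp (- (b - a)) \<le> b - a" using exp_ge_add_one_self[of "- (b - a)"] by linarith
    have "exp (- a) - exp (- b) = exp (- a) * (1 - exp (- (b - a)))"
      by (simp add: algebra_simps flip: exp_add)
    also have "\<dots> \<le> 1 * (b - a)"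
      using that le by (intro mult_mono) auto
    finally have "exp (- a) - exp (- b) \<le> b - a" by simp
    moreover have "exp (- b) \<le> exp (- a)" using that by simp
    ultimately show ?thesis using that by simp
  qed
  have "\<bar>exp (- a) - exp (- b)\<bar> \<le> \<bar>a - b\<bar>"
    using *[of a b] *[of b a] assms by (cases "a \<le> b") (simp_all add: abs_minus_commute)
  then show ?thesis by (simp flip: of_real_diff)
qed

lemma integrable_nonneg_le:
  fixes f g :: "'a \<Rightarrow> real"
  assumes "integrable M g" "f \<in> borel_measurable M" "\<And>x. 0 \<le> f x" "\<And>x. f x \<le> g x"
  shows "integrable M f"
  by (rule Bochner_Integration.integrable_bound[OF assms(1,2)])
    (use assms(3,4) in \<open>auto intro: order_trans[OF _ abs_ge_self]\<close>)

text \<open>If \<open>f\<close> is not integrable, its integral is 0 by convention and the bound is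
  trivial, because \<open>g\<close> is nonnegative on the space.\<close>

lemma norm_integral_le_integral:
  fixes f :: "'a \<Rightarrow> 'b::{banach, second_countable_topology}"
  assumes "integrable M g" "\<And>x. x \<in> space M \<Longrightarrow> norm (f x) \<le> g x"
  shows "norm (\<integral>x. f x \<partial>M) \<le> (\<integral>x. g x \<partial>M)"
proof -
  have "0 \<le> g x" if "x \<in> space M" for x
    using assms(2)[OF that] norm_ge_zero order_trans by blast
  then have "(\<integral>x. norm (f x) \<partial>M) \<le> (\<integral>x. g x \<partial>M)"
    using assms by (intro integral_mono') auto
  then show ?thesis
    using integral_norm_bound[of M f] by linarith
qed

lemma (in prob_space) integrable_times_iexp:
  fixes Y Z :: "'a \<Rightarrow> real"
  assumes "integrable M Y" "Z \<in> borel_measurable M"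
  shows "integrable M (\<lambda>\<omega>. complex_of_real (Y \<omega>) * iexp (Z \<omega>))"
proof (rule Bochner_Integration.integrable_bound[OF assms(1)])
  show "(\<lambda>\<omega>. complex_of_real (Y \<omega>) * iexp (Z \<omega>)) \<in> borel_measurable M"
    using assms by simp
qed (simp add: norm_mult)

text \<open>One summand \<open>Y\<close> of Tikhomirov's expansion: \<open>R\<close> stands for the
  terms near \<open>Y\<close>, \<open>Q\<close> for a surrounding ring, \<open>F\<close> for the
  rest. Independence of \<open>Y\<close> from \<open>Q + F\<close> kills the term of order zero. The
  product \<open>Y * R\<close> is independent of \<open>F\<close> only, so the ring must be dropped
  before the first order term factorises; afterwards the full sum is restored in the remaining
  exponential. Each of these three exchanges gives one error term.\<close>

lemma (in prob_space) char_step: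
  fixes Y R Q F :: "'a \<Rightarrow> real"
  assumes [measurable]: "random_variable borel Y" "random_variable borel R"
      "random_variable borel Q" "random_variable borel F"
    and int: "integrable M Y" "integrable M (\<lambda>\<omega>. Y \<omega> * R \<omega>)"
      "integrable M (\<lambda>\<omega>. \<bar>Y \<omega>\<bar> * (R \<omega>)\<^sup>2)"
      "integrable M (\<lambda>\<omega>. \<bar>Y \<omega> * R \<omega> * Q \<omega>\<bar>)" "integrable M (\<lambda>\<omega>. \<bar>R \<omega> + Q \<omega>\<bar>)"
    and fac1: "(\<integral>\<omega>. of_real (Y \<omega>) * iexp (x * (Q \<omega> + F \<omega>)) \<partial>M) = 0"
    and fac2: "(\<integral>\<omega>. of_real (Y \<omega> * R \<omega>) * iexp (x * F \<omega>) \<partial>M)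
      = of_real (\<integral>\<omega>. Y \<omega> * R \<omega> \<partial>M) * (\<integral>\<omega>. iexp (x * F \<omega>) \<partial>M)"
  shows "cmod ((\<integral>\<omega>. of_real (Y \<omega>) * iexp (x * (R \<omega> + Q \<omega> + F \<omega>)) \<partial>M)
      - \<i> * of_real x * of_real (\<integral>\<omega>. Y \<omega> * R \<omega> \<partial>M) * (\<integral>\<omega>. iexp (x * (R \<omega> + Q \<omega> + F \<omega>)) \<partial>M))
    \<le> x\<^sup>2 * ((\<integral>\<omega>. \<bar>Y \<omega>\<bar> * (R \<omega>)\<^sup>2 \<partial>M) / 2 + (\<integral>\<omega>. \<bar>Y \<omega> * R \<omega> * Q \<omega>\<bar> \<partial>M)
        + \<bar>\<integral>\<omega>. Y \<omega> * R \<omega> \<partial>M\<bar> * (\<integral>\<omega>. \<bar>R \<omega> + Q \<omega>\<bar> \<partial>M))"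
    (is "cmod ?L \<le> x\<^sup>2 * (?a / 2 + ?b + ?c * ?d)")
proof -
  let ?S = "\<lambda>\<omega>. x * (R \<omega> + Q \<omega> + F \<omega>)" and ?G = "\<lambda>\<omega>. x * (Q \<omega> + F \<omega>)" and ?F = "\<lambda>\<omega>. x * F \<omega>"
  define YR where "YR = (\<integral>\<omega>. Y \<omega> * R \<omega> \<partial>M)"
  \<comment> \<open>\<open>e1\<close> is the Taylor remainder in \<open>R\<close>, \<open>e2\<close>
    the removal of the ring \<open>Q\<close> from the first order term, \<open>e3\<close> the return
    from \<open>F\<close> to the full sum.\<close>
  define e1 where "e1 \<omega> = of_real (Y \<omega>) * (iexp (?S \<omega>) - iexp (?G \<omega>) - \<i> * (x * R \<omega>) * iexp (?G \<omega>))" for \<omega>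
  define e2 where "e2 \<omega> = of_real (Y \<omega> * R \<omega>) * (iexp (?G \<omega>) - iexp (?F \<omega>))" for \<omega>
  define e3 where "e3 \<omega> = iexp (?F \<omega>) - iexp (?S \<omega>)" for \<omega>
  note I = integrable_times_iexp[OF int(1)] integrable_times_iexp[OF int(2)]
    integrable_times_iexp[of "\<lambda>_. 1", simplified]
  have iG: "integrable M (\<lambda>\<omega>. of_real (Y \<omega>) * iexp (?G \<omega>))"
    and iS: "integrable M (\<lambda>\<omega>. of_real (Y \<omega>) * iexp (?S \<omega>))"
    and jG: "integrable M (\<lambda>\<omega>. of_real (Y \<omega> * R \<omega>) * iexp (?G \<omega>))"
    and jF: "integrable M (\<lambda>\<omega>. of_real (Y \<omega> * R \<omega>) * iexp (?F \<omega>))"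
    and kF: "integrable M (\<lambda>\<omega>. iexp (?F \<omega>))"
    and kS: "integrable M (\<lambda>\<omega>. iexp (?S \<omega>))"
    by (rule I, measurable)+
  have e1_eq: "e1 = (\<lambda>\<omega>. of_real (Y \<omega>) * iexp (?S \<omega>) - of_real (Y \<omega>) * iexp (?G \<omega>)
      - \<i> * x * (of_real (Y \<omega> * R \<omega>) * iexp (?G \<omega>)))"
    by (simp add: e1_def fun_eq_iff algebra_simps)
  have E1: "(\<integral>\<omega>. e1 \<omega> \<partial>M) = (\<integral>\<omega>. of_real (Y \<omega>) * iexp (?S \<omega>) \<partial>M)
      - \<i> * x * (\<integral>\<omega>. of_real (Y \<omega> * R \<omega>) * iexp (?G \<omega>) \<partial>M)"
    unfolding e1_eq using iS iG jG fac1
    by (subst Bochner_Integration.integral_diff Bochner_Integration.integrable_diff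
        integral_mult_right_zero; simp add: Bochner_Integration.integral_diff)+
  have i1: "integrable M e1"
    unfolding e1_eq by (intro Bochner_Integration.integrable_diff integrable_mult_right iS iG jG)
  have e2_eq: "e2 = (\<lambda>\<omega>. of_real (Y \<omega> * R \<omega>) * iexp (?G \<omega>) - of_real (Y \<omega> * R \<omega>) * iexp (?F \<omega>))"
    by (simp add: e2_def fun_eq_iff algebra_simps)
  have E2: "(\<integral>\<omega>. e2 \<omega> \<partial>M) = (\<integral>\<omega>. of_real (Y \<omega> * R \<omega>) * iexp (?G \<omega>) \<partial>M)
      - YR * (\<integral>\<omega>. iexp (?F \<omega>) \<partial>M)"
    unfolding e2_eq YR_def fac2[symmetric] by (rule Bochner_Integration.integral_diff[OF jG jF])
  have i2: "integrable M e2"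
    unfolding e2_eq by (intro Bochner_Integration.integrable_diff jG jF)
  have E3: "(\<integral>\<omega>. e3 \<omega> \<partial>M) = (\<integral>\<omega>. iexp (?F \<omega>) \<partial>M) - (\<integral>\<omega>. iexp (?S \<omega>) \<partial>M)"
    unfolding e3_def by (rule Bochner_Integration.integral_diff[OF kF kS])
  have i3: "integrable M e3"
    unfolding e3_def by (intro Bochner_Integration.integrable_diff kF kS)
  have L: "?L = (\<integral>\<omega>. e1 \<omega> \<partial>M) + \<i> * x * (\<integral>\<omega>. e2 \<omega> \<partial>M) + \<i> * x * YR * (\<integral>\<omega>. e3 \<omega> \<partial>M)"
    unfolding E1 E2 E3 YR_def[symmetric] by (simp add: algebra_simps)
  have b1: "cmod (\<integral>\<omega>. e1 \<omega> \<partial>M) \<le> x\<^sup>2 * ?a / 2"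
  proof -
    have "cmod (\<integral>\<omega>. e1 \<omega> \<partial>M) \<le> (\<integral>\<omega>. x\<^sup>2 / 2 * (\<bar>Y \<omega>\<bar> * (R \<omega>)\<^sup>2) \<partial>M)"
    proof (rule norm_integral_le_integral)
      fix \<omega>
      have "cmod (e1 \<omega>) \<le> \<bar>Y \<omega>\<bar> * ((x * R \<omega>)\<^sup>2 / 2)"
        using cmod_iexp_taylor_le[of "x * R \<omega>" "?G \<omega>"]
        unfolding e1_def norm_mult by (auto intro!: mult_left_mono simp: algebra_simps)
      then show "cmod (e1 \<omega>) \<le> x\<^sup>2 / 2 * (\<bar>Y \<omega>\<bar> * (R \<omega>)\<^sup>2)"
        by (simp add: power_mult_distrib algebra_simps)
    qed (use int in auto)
    then show ?thesis by simp
  qed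
  have b2: "cmod (\<integral>\<omega>. e2 \<omega> \<partial>M) \<le> \<bar>x\<bar> * ?b"
  proof -
    have "cmod (\<integral>\<omega>. e2 \<omega> \<partial>M) \<le> (\<integral>\<omega>. \<bar>x\<bar> * \<bar>Y \<omega> * R \<omega> * Q \<omega>\<bar> \<partial>M)"
    proof (rule norm_integral_le_integral)
      fix \<omega>
      have "cmod (e2 \<omega>) \<le> \<bar>Y \<omega> * R \<omega>\<bar> * \<bar>x * Q \<omega>\<bar>"
        using cmod_iexp_diff_le[of "?G \<omega>" "?F \<omega>"]
        unfolding e2_def norm_mult norm_of_real
        by (intro mult_left_mono) (simp_all add: right_diff_distrib[symmetric])
      then show "cmod (e2 \<omega>) \<le> \<bar>x\<bar> * \<bar>Y \<omega> * R \<omega> * Q \<omega>\<bar>"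
        by (simp add: abs_mult algebra_simps)
    qed (use int in auto)
    then show ?thesis by simp
  qed
  have b3: "cmod (\<integral>\<omega>. e3 \<omega> \<partial>M) \<le> \<bar>x\<bar> * ?d"
  proof -
    have "cmod (\<integral>\<omega>. e3 \<omega> \<partial>M) \<le> (\<integral>\<omega>. \<bar>x\<bar> * \<bar>R \<omega> + Q \<omega>\<bar> \<partial>M)"
    proof (rule norm_integral_le_integral)
      fix \<omega>
      have "\<bar>?F \<omega> - ?S \<omega>\<bar> = \<bar>x\<bar> * \<bar>R \<omega> + Q \<omega>\<bar>"
        by (simp add: algebra_simps flip: abs_mult)
      then show "cmod (e3 \<omega>) \<le> \<bar>x\<bar> * \<bar>R \<omega> + Q \<omega>\<bar>"
        using cmod_iexp_diff_le[of "?F \<omega>" "?S \<omega>"] by (simp add: e3_def)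
    qed (use int in auto)
    then show ?thesis by simp
  qed
  have "cmod ?L \<le> cmod (\<integral>\<omega>. e1 \<omega> \<partial>M) + \<bar>x\<bar> * cmod (\<integral>\<omega>. e2 \<omega> \<partial>M)
      + \<bar>x\<bar> * \<bar>YR\<bar> * cmod (\<integral>\<omega>. e3 \<omega> \<partial>M)"
    unfolding L by (intro norm_triangle_le add_mono) (auto simp: norm_mult)
  also have "\<dots> \<le> x\<^sup>2 * ?a / 2 + \<bar>x\<bar> * (\<bar>x\<bar> * ?b) + \<bar>x\<bar> * \<bar>YR\<bar> * (\<bar>x\<bar> * ?d)"
    by (intro add_mono mult_left_mono b1 b2 b3) auto
  also have "\<dots> = x\<^sup>2 * (?a / 2 + ?b + ?c * ?d)"
  proof -
    have "x\<^sup>2 = \<bar>x\<bar> * \<bar>x\<bar>" by (simp add: power2_eq_square)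
    then show ?thesis unfolding YR_def by (simp only:) (simp add: distrib_left mult_ac)
  qed
  finally show ?thesis .
qed

text \<open>Integrating the quadratic Taylor remainder against the second moment bounds the error of
  the linear approximation by (y - x)^2 E / 2, which gives the derivative directly.\<close>

lemma (in prob_space) char_has_vector_derivative:
  fixes Z :: "'a \<Rightarrow> real"
  assumes Z[measurable]: "random_variable borel Z" and int: "integrable M Z" "integrable M (\<lambda>\<omega>. (Z \<omega>)\<^sup>2)"
  shows "((\<lambda>x. \<integral>\<omega>. iexp (x * Z \<omega>) \<partial>M) has_vector_derivative
    (\<integral>\<omega>. \<i> * of_real (Z \<omega>) * iexp (x * Z \<omega>) \<partial>M)) (at x within A)"
proof -
  define f where "f = (\<lambda>x. \<integral>\<omega>. iexp (x * Z \<omega>) \<partial>M)"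
  define D where "D = (\<integral>\<omega>. \<i> * of_real (Z \<omega>) * iexp (x * Z \<omega>) \<partial>M)"
  define E where "E = (\<integral>\<omega>. (Z \<omega>)\<^sup>2 \<partial>M)"
  have iD: "integrable M (\<lambda>\<omega>. \<i> * of_real (Z \<omega>) * iexp (x * Z \<omega>))"
    using integrable_mult_right[OF integrable_times_iexp[OF int(1), of "\<lambda>\<omega>. x * Z \<omega>"], of \<i>]
    by (simp add: mult.assoc)
  have ii: "integrable M (\<lambda>\<omega>. iexp (y * Z \<omega>))" for y
    by (rule integrable_iexp) auto
  have bound: "norm (f y - f x - (y - x) *\<^sub>R D) \<le> (y - x)\<^sup>2 * (E / 2)" for y
  proof -
    have "f y - f x - (y - x) *\<^sub>R D
      = (\<integral>\<omega>. iexp (y * Z \<omega>) - iexp (x * Z \<omega>) - of_real (y - x) * (\<i> * of_real (Z \<omega>) * iexp (x * Z \<omega>)) \<partial>M)"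
      unfolding f_def D_def scaleR_conv_of_real using ii iD
      by (subst Bochner_Integration.integral_diff; (intro Bochner_Integration.integrable_diff integrable_mult_right)?;
          simp add: Bochner_Integration.integral_diff)
    also have "norm \<dots> \<le> (\<integral>\<omega>. (y - x)\<^sup>2 / 2 * (Z \<omega>)\<^sup>2 \<partial>M)"
    proof (rule norm_integral_le_integral)
      fix \<omega>
      show "norm (iexp (y * Z \<omega>) - iexp (x * Z \<omega>) - of_real (y - x) * (\<i> * of_real (Z \<omega>) * iexp (x * Z \<omega>)))
         \<le> (y - x)\<^sup>2 / 2 * (Z \<omega>)\<^sup>2"
        using cmod_iexp_taylor_le[of "(y - x) * Z \<omega>" "x * Z \<omega>"]
        by (simp add: algebra_simps power_mult_distrib power2_eq_square)
    qed (use int ii iD in \<open>auto intro!: Bochner_Integration.integrable_diff integrable_mult_right\<close>)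
    finally show ?thesis by (simp add: E_def algebra_simps)
  qed
  have E0: "0 \<le> E" by (simp add: E_def)
  have "((\<lambda>y. norm (f y - f x - (y - x) *\<^sub>R D) / norm (y - x)) \<longlongrightarrow> 0) (at x within A)"
  proof (rule tendsto_sandwich[of "\<lambda>_. 0" _ _ "\<lambda>y. \<bar>y - x\<bar> * (E / 2)"])
    have "norm (f y - f x - (y - x) *\<^sub>R D) / norm (y - x) \<le> \<bar>y - x\<bar> * (E / 2)" for y
      using bound[of y] E0 by (cases "y = x") (auto simp: field_simps power2_eq_square abs_mult_self_eq)
    then show "\<forall>\<^sub>F y in at x within A. norm (f y - f x - (y - x) *\<^sub>R D) / norm (y - x) \<le> \<bar>y - x\<bar> * (E / 2)"
      by simp
    show "((\<lambda>y. \<bar>y - x\<bar> * (E / 2)) \<longlongrightarrow> 0) (at x within A)"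
      by (auto intro!: tendsto_eq_intros)
  qed auto
  then show ?thesis
    unfolding f_def[symmetric] D_def[symmetric] has_vector_derivative_def has_derivative_iff_norm
    by (auto simp: bounded_linear_scaleR_left)
qed

text \<open>Multiplied by \<open>exp (V * x\<^sup>2 / 2)\<close>, the left-hand side of the hypothesis is the derivative
  of \<open>exp (V * x\<^sup>2 / 2) * \<psi> x\<close>.\<close>

lemma gaussian_ode_bound:
  fixes \<psi> \<psi>' :: "real \<Rightarrow> complex"
  assumes der: "\<And>x. (\<psi> has_vector_derivative \<psi>' x) (at x)" and init: "\<psi> 0 = 1" and V: "0 \<le> V"
    and bound: "\<And>x. cmod (\<psi>' x + of_real (x * V) * \<psi> x) \<le> C * x\<^sup>2" and C: "0 \<le> C"
  shows "cmod (\<psi> v - of_real (exp (- (v\<^sup>2 * V / 2)))) \<le> C * \<bar>v\<bar> ^ 3"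
proof -
  define w where "w x = exp (V * x\<^sup>2 / 2)" for x :: real
  have wpos: "0 < w x" for x by (simp add: w_def)
  have wd: "(w has_vector_derivative (x * V * w x)) (at x within S)" for x S
    unfolding w_def has_real_derivative_iff_has_vector_derivative[symmetric]
    by (auto intro!: derivative_eq_intros simp: algebra_simps)
  let ?S = "closed_segment 0 v"
  have mono: "w x \<le> w v" "x\<^sup>2 \<le> v\<^sup>2" if "x \<in> ?S" for x
  proof -
    have "\<bar>x\<bar> \<le> \<bar>v\<bar>" using that by (auto simp: closed_segment_eq_real_ivl split: if_splits)
    then show "x\<^sup>2 \<le> v\<^sup>2" by (simp add: abs_le_square_iff)
    then show "w x \<le> w v" using V by (auto simp: w_def intro!: mult_left_mono divide_right_mono)
  qed
  have hd: "((\<lambda>x. w x *\<^sub>R \<psi> x) has_derivative (\<lambda>y. y *\<^sub>R (w x *\<^sub>R (\<psi>' x + of_real (x * V) * \<psi> x))))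
     (at x within ?S)" for x
    unfolding has_vector_derivative_def[symmetric]
    by (rule has_vector_derivative_eq_rhs)
       (rule has_vector_derivative_scaleR has_vector_derivative_at_within[OF der] wd
         wd[folded has_real_derivative_iff_has_vector_derivative]
        | simp add: scaleR_conv_of_real algebra_simps)+
  \<comment> \<open>On the segment from 0 to \<open>v\<close> both \<open>w\<close> and the square
    are largest at \<open>v\<close>. The mean value inequality therefore costs the factor
    \<open>w v\<close>, which cancels in the end, and v^2 times the length of the segment is the
    cube.\<close>
  have "norm (w v *\<^sub>R \<psi> v - w 0 *\<^sub>R \<psi> 0) \<le> (w v * (C * v\<^sup>2)) * norm (v - 0)"
  proof (rule differentiable_bound[OF _ hd])
    fix x assume x: "x \<in> ?S"
    have "onorm (\<lambda>y. y *\<^sub>R (w x *\<^sub>R (\<psi>' x + of_real (x * V) * \<psi> x)))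
      \<le> norm (w x *\<^sub>R (\<psi>' x + of_real (x * V) * \<psi> x))"
      by (rule onorm_bound) (auto simp: mult.commute abs_mult)
    also have "\<dots> \<le> w x * (C * x\<^sup>2)"
      using bound[of x] wpos[of x] by (simp add: mult_left_mono)
    also have "\<dots> \<le> w v * (C * v\<^sup>2)"
      using mono[OF x] wpos[of v] C by (intro mult_mono) (auto intro: mult_left_mono)
    finally show "onorm (\<lambda>y. y *\<^sub>R (w x *\<^sub>R (\<psi>' x + of_real (x * V) * \<psi> x))) \<le> w v * (C * v\<^sup>2)" .
  qed auto
  then have "norm (w v *\<^sub>R \<psi> v - 1) \<le> w v * (C * \<bar>v\<bar> ^ 3)"
    by (simp add: init w_def power2_eq_square power3_eq_cube abs_mult_self_eq mult.assoc)
  moreover have "w v *\<^sub>R \<psi> v - 1 = w v *\<^sub>R (\<psi> v - of_real (exp (- (v\<^sup>2 * V / 2))))"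
    by (simp add: w_def scaleR_conv_of_real right_diff_distrib mult.commute flip: of_real_mult exp_add)
  ultimately have "w v * norm (\<psi> v - of_real (exp (- (v\<^sup>2 * V / 2)))) \<le> w v * (C * \<bar>v\<bar> ^ 3)"
    using wpos[of v] by simp
  then show ?thesis using wpos[of v] by simp
qed

lemma (in prob_space) indep_var_integral_iexp:
  fixes f :: "'b \<Rightarrow> real" and g :: "'b \<Rightarrow> real"
  assumes ind: "indep_var N1 U N2 V" and f: "f \<in> borel_measurable N1" and g: "g \<in> borel_measurable N2"
    and int: "integrable M (\<lambda>\<omega>. f (U \<omega>))"
  shows "(\<integral>\<omega>. of_real (f (U \<omega>)) * iexp (g (V \<omega>)) \<partial>M)
    = of_real (\<integral>\<omega>. f (U \<omega>) \<partial>M) * (\<integral>\<omega>. iexp (g (V \<omega>)) \<partial>M)"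
proof -
  have V: "V \<in> measurable M N2" using indep_var_rv2[OF ind] .
  have "indep_var borel ((\<lambda>x. complex_of_real (f x)) \<circ> U) borel ((\<lambda>x. iexp (g x)) \<circ> V)"
    by (rule indep_var_compose[OF ind]) (use f g in measurable)
  from indep_var_lebesgue_integral[OF this] show ?thesis
    using int integrable_iexp[of "\<lambda>\<omega>. of_real (g (V \<omega>))"] measurable_compose[OF V g]
    by (simp add: comp_def)
qed

lemma (in prob_space) indep_var_expectation_mult:
  fixes f :: "'b \<Rightarrow> real" and g :: "'b \<Rightarrow> real"
  assumes ind: "indep_var N1 U N2 V" and f: "f \<in> borel_measurable N1" and g: "g \<in> borel_measurable N2"
    and int: "integrable M (\<lambda>\<omega>. f (U \<omega>))" "integrable M (\<lambda>\<omega>. g (V \<omega>))"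
  shows "(\<integral>\<omega>. f (U \<omega>) * g (V \<omega>) \<partial>M) = (\<integral>\<omega>. f (U \<omega>) \<partial>M) * (\<integral>\<omega>. g (V \<omega>) \<partial>M)"
  using indep_var_lebesgue_integral[of "f \<circ> U" "g \<circ> V"] indep_var_compose[OF ind f g] int
  by (simp add: comp_def)

text \<open>A crude substitute for Hoelder's inequality: the product is at most the cube of the
  largest factor.\<close>

lemma abs_mult3_le:
  fixes a b c :: real
  shows "\<bar>a * b * c\<bar> \<le> \<bar>a\<bar> ^ 3 + \<bar>b\<bar> ^ 3 + \<bar>c\<bar> ^ 3"
proof -
  define m where "m = max \<bar>a\<bar> (max \<bar>b\<bar> \<bar>c\<bar>)"
  have "\<bar>a * b * c\<bar> \<le> m * m * m"
    unfolding abs_mult m_def by (intro mult_mono) auto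
  also have "\<dots> \<le> \<bar>a\<bar> ^ 3 + \<bar>b\<bar> ^ 3 + \<bar>c\<bar> ^ 3"
    by (auto simp: m_def max_def power3_eq_cube)
  finally show ?thesis .
qed

text \<open>A distance of exactly \<open>m\<close> is allowed: the coupled version of order m reads
  m consecutive common innovations, so indices m apart share none.\<close>

definition separated :: "nat \<Rightarrow> int set \<Rightarrow> int set \<Rightarrow> bool" where
  "separated m B C \<longleftrightarrow> (\<forall>b\<in>B. \<forall>c\<in>C. int m \<le> \<bar>b - c\<bar>)"

text \<open>Every neighbourhood has a number of indices of order m, whatever the gaps of
  \<open>A\<close>, so the bound sees \<open>A\<close> only through its cardinality. Summing
  \<open>char_step\<close> over \<open>A\<close> shows that the characteristic function nearly
  solves the Gaussian differential equation with the exact variance, and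
  \<open>gaussian_ode_bound\<close> integrates this.\<close>

lemma (in prob_space) m_dependent_char_bound:
  fixes Y :: "int \<Rightarrow> 'a \<Rightarrow> real"
  assumes fin: "finite A" and Ym[measurable]: "\<And>a. random_variable borel (Y a)"
    and i3: "\<And>a. integrable M (\<lambda>\<omega>. \<bar>Y a \<omega>\<bar> ^ 3)" and i2: "\<And>a. integrable M (\<lambda>\<omega>. (Y a \<omega>)\<^sup>2)"
    and i1: "\<And>a. integrable M (Y a)"
    and c: "1 \<le> c" "\<And>a. (\<integral>\<omega>. \<bar>Y a \<omega>\<bar> ^ 3 \<partial>M) \<le> c" "\<And>a. (\<integral>\<omega>. (Y a \<omega>)\<^sup>2 \<partial>M) \<le> c"
      "\<And>a. (\<integral>\<omega>. \<bar>Y a \<omega>\<bar> \<partial>M) \<le> c"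
    and centered: "\<And>a. (\<integral>\<omega>. Y a \<omega> \<partial>M) = 0" and m: "1 \<le> m"
    and indep: "\<And>B C. separated m B C \<Longrightarrow>
      indep_var (PiM B (\<lambda>_. borel)) (\<lambda>\<omega>. \<lambda>i\<in>B. Y i \<omega>) (PiM C (\<lambda>_. borel)) (\<lambda>\<omega>. \<lambda>i\<in>C. Y i \<omega>)"
  shows "cmod ((\<integral>\<omega>. iexp (v * (\<Sum>a\<in>A. Y a \<omega>)) \<partial>M)
      - of_real (exp (- (v\<^sup>2 * (\<integral>\<omega>. (\<Sum>a\<in>A. Y a \<omega>)\<^sup>2 \<partial>M) / 2))))
    \<le> 38 * c\<^sup>2 * (real m)\<^sup>2 * real (card A) * \<bar>v\<bar> ^ 3"
proof -
  define S where "S \<omega> = (\<Sum>a\<in>A. Y a \<omega>)" for \<omega>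
  define V where "V = (\<integral>\<omega>. (S \<omega>)\<^sup>2 \<partial>M)"
  have Sm[measurable]: "S \<in> borel_measurable M" by (simp add: S_def[abs_def])
  have iYY: "integrable M (\<lambda>\<omega>. Y a \<omega> * Y b \<omega>)" and bYY: "(\<integral>\<omega>. \<bar>Y a \<omega> * Y b \<omega>\<bar> \<partial>M) \<le> c" for a b
  proof -
    have le: "\<bar>Y a \<omega> * Y b \<omega>\<bar> \<le> ((Y a \<omega>)\<^sup>2 + (Y b \<omega>)\<^sup>2) / 2" for \<omega>
      using sum_squares_bound[of "\<bar>Y a \<omega>\<bar>" "\<bar>Y b \<omega>\<bar>"] by (simp add: abs_mult)
    have ib: "integrable M (\<lambda>\<omega>. ((Y a \<omega>)\<^sup>2 + (Y b \<omega>)\<^sup>2) / 2)" using i2 by simp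
    show i: "integrable M (\<lambda>\<omega>. Y a \<omega> * Y b \<omega>)"
      by (rule Bochner_Integration.integrable_bound[OF ib]) (use le in auto)
    have "(\<integral>\<omega>. \<bar>Y a \<omega> * Y b \<omega>\<bar> \<partial>M) \<le> (\<integral>\<omega>. ((Y a \<omega>)\<^sup>2 + (Y b \<omega>)\<^sup>2) / 2 \<partial>M)"
      by (rule integral_mono) (use i ib le in auto)
    also have "\<dots> = ((\<integral>\<omega>. (Y a \<omega>)\<^sup>2 \<partial>M) + (\<integral>\<omega>. (Y b \<omega>)\<^sup>2 \<partial>M)) / 2" using i2 by simp
    also have "\<dots> \<le> c" using c(3)[of a] c(3)[of b] by simp
    finally show "(\<integral>\<omega>. \<bar>Y a \<omega> * Y b \<omega>\<bar> \<partial>M) \<le> c" .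
  qed
  have iYYY: "integrable M (\<lambda>\<omega>. Y a \<omega> * Y b \<omega> * Y d \<omega>)"
    and bYYY: "(\<integral>\<omega>. \<bar>Y a \<omega> * Y b \<omega> * Y d \<omega>\<bar> \<partial>M) \<le> 3 * c" for a b d
  proof -
    have ib: "integrable M (\<lambda>\<omega>. \<bar>Y a \<omega>\<bar> ^ 3 + \<bar>Y b \<omega>\<bar> ^ 3 + \<bar>Y d \<omega>\<bar> ^ 3)" using i3 by simp
    show i: "integrable M (\<lambda>\<omega>. Y a \<omega> * Y b \<omega> * Y d \<omega>)"
      by (rule Bochner_Integration.integrable_bound[OF ib]) (use abs_mult3_le in auto)
    have "(\<integral>\<omega>. \<bar>Y a \<omega> * Y b \<omega> * Y d \<omega>\<bar> \<partial>M) \<le> (\<integral>\<omega>. \<bar>Y a \<omega>\<bar> ^ 3 + \<bar>Y b \<omega>\<bar> ^ 3 + \<bar>Y d \<omega>\<bar> ^ 3 \<partial>M)"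
      by (rule integral_mono) (use i ib abs_mult3_le in auto)
    also have "\<dots> \<le> 3 * c" using i3 c(2)[of a] c(2)[of b] c(2)[of d] by simp
    finally show "(\<integral>\<omega>. \<bar>Y a \<omega> * Y b \<omega> * Y d \<omega>\<bar> \<partial>M) \<le> 3 * c" .
  qed
  have ii: "integrable M (\<lambda>\<omega>. iexp (y * Z \<omega>))" if "Z \<in> borel_measurable M" for y and Z :: "'a \<Rightarrow> real"
    by (rule integrable_iexp) (use that in auto)
  \<comment> \<open>The ring \<open>N2\<close> between distances m and 2 m keeps \<open>F j\<close>
    at distance at least m from every element of \<open>N j\<close>, and not only from
    \<open>j\<close>.\<close>
  define N where "N j = {a\<in>A. \<bar>a - j\<bar> < int m}" for j
  define N2 where "N2 j = {a\<in>A. int m \<le> \<bar>a - j\<bar> \<and> \<bar>a - j\<bar> < 2 * int m}" for j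
  define F where "F j = {a\<in>A. 2 * int m \<le> \<bar>a - j\<bar>}" for j
  have finN[simp]: "finite (N j)" "finite (N2 j)" "finite (F j)" for j
    by (rule finite_subset[OF _ fin], auto simp: N_def N2_def F_def)+
  have cN: "real (card (N j)) \<le> 2 * real m" for j
  proof -
    have "card (N j) \<le> card {j - int m<..<j + int m}"
      by (rule card_mono) (auto simp: N_def)
    also have "\<dots> \<le> 2 * m" by simp
    finally show ?thesis by linarith
  qed
  have cN2: "real (card (N j \<union> N2 j)) \<le> 4 * real m" for j
  proof -
    have "card (N j \<union> N2 j) \<le> card {j - 2 * int m<..<j + 2 * int m}"
      by (rule card_mono) (auto simp: N_def N2_def)
    also have "\<dots> \<le> 4 * m" by simp
    finally show ?thesis by linarith
  qed
  have cN2': "real (card (N2 j)) \<le> 4 * real m" for j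
    using card_mono[OF finite_UnI[OF finN(1,2)] Un_upper2, of j j] cN2[of j] by linarith
  define R where "R j \<omega> = (\<Sum>a\<in>N j. Y a \<omega>)" for j \<omega>
  define Q where "Q j \<omega> = (\<Sum>a\<in>N2 j. Y a \<omega>)" for j \<omega>
  define G where "G j \<omega> = (\<Sum>a\<in>F j. Y a \<omega>)" for j \<omega>
  have [measurable]: "R j \<in> borel_measurable M" "Q j \<in> borel_measurable M" "G j \<in> borel_measurable M" for j
    by (simp_all add: R_def[abs_def] Q_def[abs_def] G_def[abs_def])
  have RQ: "R j \<omega> + Q j \<omega> = (\<Sum>a\<in>N j \<union> N2 j. Y a \<omega>)" for j \<omega>
    unfolding R_def Q_def by (rule sum.union_disjoint[symmetric, OF finN(1,2)]) (auto simp: N_def N2_def)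
  have QG: "Q j \<omega> + G j \<omega> = (\<Sum>a\<in>N2 j \<union> F j. Y a \<omega>)" for j \<omega>
    unfolding G_def Q_def by (rule sum.union_disjoint[symmetric, OF finN(2,3)]) (auto simp: F_def N2_def)
  have SR: "S \<omega> = R j \<omega> + Q j \<omega> + G j \<omega>" for j \<omega>
  proof -
    have "A = (N j \<union> N2 j) \<union> F j" by (auto simp: N_def N2_def F_def)
    then have "S \<omega> = (\<Sum>a\<in>(N j \<union> N2 j) \<union> F j. Y a \<omega>)" by (simp add: S_def)
    also have "\<dots> = (\<Sum>a\<in>N j \<union> N2 j. Y a \<omega>) + G j \<omega>"
      unfolding G_def by (rule sum.union_disjoint[OF finite_UnI[OF finN(1,2)] finN(3)]) (auto simp: F_def N2_def N_def)
    finally show ?thesis by (simp add: RQ)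
  qed
  have YR: "Y j \<omega> * R j \<omega> = (\<Sum>a\<in>N j. Y j \<omega> * Y a \<omega>)" for j \<omega>
    by (simp add: R_def sum_distrib_left)
  have iYR: "integrable M (\<lambda>\<omega>. Y j \<omega> * R j \<omega>)" for j
    unfolding YR using iYY by simp
  have YRR: "\<bar>Y j \<omega>\<bar> * (R j \<omega>)\<^sup>2 \<le> (\<Sum>a\<in>N j. \<Sum>b\<in>N j. \<bar>Y j \<omega> * Y a \<omega> * Y b \<omega>\<bar>)" for j \<omega>
  proof -
    have "\<bar>Y j \<omega>\<bar> * (R j \<omega>)\<^sup>2 = \<bar>Y j \<omega> * R j \<omega> * R j \<omega>\<bar>"
      by (simp add: abs_mult power2_eq_square mult.assoc)
    also have "\<dots> = \<bar>\<Sum>a\<in>N j. \<Sum>b\<in>N j. Y j \<omega> * Y a \<omega> * Y b \<omega>\<bar>"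
      unfolding R_def mult.assoc sum_product by (simp add: sum_distrib_left)
    also have "\<dots> \<le> (\<Sum>a\<in>N j. \<Sum>b\<in>N j. \<bar>Y j \<omega> * Y a \<omega> * Y b \<omega>\<bar>)"
      by (intro order_trans[OF sum_abs] sum_mono sum_abs)
    finally show ?thesis .
  qed
  have YRQ: "\<bar>Y j \<omega> * R j \<omega> * Q j \<omega>\<bar> \<le> (\<Sum>a\<in>N j. \<Sum>b\<in>N2 j. \<bar>Y j \<omega> * Y a \<omega> * Y b \<omega>\<bar>)" for j \<omega>
  proof -
    have "\<bar>Y j \<omega> * R j \<omega> * Q j \<omega>\<bar> = \<bar>\<Sum>a\<in>N j. \<Sum>b\<in>N2 j. Y j \<omega> * Y a \<omega> * Y b \<omega>\<bar>"
      unfolding R_def Q_def mult.assoc sum_product by (simp add: sum_distrib_left)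
    also have "\<dots> \<le> (\<Sum>a\<in>N j. \<Sum>b\<in>N2 j. \<bar>Y j \<omega> * Y a \<omega> * Y b \<omega>\<bar>)"
      by (intro order_trans[OF sum_abs] sum_mono sum_abs)
    finally show ?thesis .
  qed
  have dsum: "integrable M (\<lambda>\<omega>. \<Sum>a\<in>B. \<Sum>b\<in>D. \<bar>Y j \<omega> * Y a \<omega> * Y b \<omega>\<bar>)"
      "(\<integral>\<omega>. (\<Sum>a\<in>B. \<Sum>b\<in>D. \<bar>Y j \<omega> * Y a \<omega> * Y b \<omega>\<bar>) \<partial>M) \<le> real (card B) * (real (card D) * (3 * c))"
    for j and B D :: "int set"
  proof -
    show "integrable M (\<lambda>\<omega>. \<Sum>a\<in>B. \<Sum>b\<in>D. \<bar>Y j \<omega> * Y a \<omega> * Y b \<omega>\<bar>)"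
      using iYYY by (intro Bochner_Integration.integrable_sum) auto
    have "(\<integral>\<omega>. (\<Sum>a\<in>B. \<Sum>b\<in>D. \<bar>Y j \<omega> * Y a \<omega> * Y b \<omega>\<bar>) \<partial>M)
      = (\<Sum>a\<in>B. \<Sum>b\<in>D. \<integral>\<omega>. \<bar>Y j \<omega> * Y a \<omega> * Y b \<omega>\<bar> \<partial>M)"
      using iYYY by (simp add: Bochner_Integration.integral_sum)
    also have "\<dots> \<le> (\<Sum>a\<in>B. \<Sum>b\<in>D. 3 * c)" by (intro sum_mono bYYY)
    finally show "(\<integral>\<omega>. (\<Sum>a\<in>B. \<Sum>b\<in>D. \<bar>Y j \<omega> * Y a \<omega> * Y b \<omega>\<bar>) \<partial>M) \<le> real (card B) * (real (card D) * (3 * c))"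
      by simp
  qed
  have iYRR: "integrable M (\<lambda>\<omega>. \<bar>Y j \<omega>\<bar> * (R j \<omega>)\<^sup>2)" for j
    by (rule integrable_nonneg_le[OF dsum(1) _ _ YRR]) auto
  have iYRQ: "integrable M (\<lambda>\<omega>. \<bar>Y j \<omega> * R j \<omega> * Q j \<omega>\<bar>)" for j
    by (rule integrable_nonneg_le[OF dsum(1) _ _ YRQ]) auto
  have bYRR: "(\<integral>\<omega>. \<bar>Y j \<omega>\<bar> * (R j \<omega>)\<^sup>2 \<partial>M) \<le> 12 * (real m)\<^sup>2 * c" for j
  proof -
    have "(\<integral>\<omega>. \<bar>Y j \<omega>\<bar> * (R j \<omega>)\<^sup>2 \<partial>M) \<le> (\<integral>\<omega>. (\<Sum>a\<in>N j. \<Sum>b\<in>N j. \<bar>Y j \<omega> * Y a \<omega> * Y b \<omega>\<bar>) \<partial>M)"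
      by (rule integral_mono[OF iYRR dsum(1) YRR])
    also have "\<dots> \<le> real (card (N j)) * (real (card (N j)) * (3 * c))" by (rule dsum(2))
    also have "\<dots> \<le> (2 * real m) * ((2 * real m) * (3 * c))"
      using cN[of j] c(1) by (intro mult_mono) auto
    finally show ?thesis by (simp add: power2_eq_square algebra_simps)
  qed
  have bYRQ: "(\<integral>\<omega>. \<bar>Y j \<omega> * R j \<omega> * Q j \<omega>\<bar> \<partial>M) \<le> 24 * (real m)\<^sup>2 * c" for j
  proof -
    have "(\<integral>\<omega>. \<bar>Y j \<omega> * R j \<omega> * Q j \<omega>\<bar> \<partial>M) \<le> (\<integral>\<omega>. (\<Sum>a\<in>N j. \<Sum>b\<in>N2 j. \<bar>Y j \<omega> * Y a \<omega> * Y b \<omega>\<bar>) \<partial>M)"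
      by (rule integral_mono[OF iYRQ dsum(1) YRQ])
    also have "\<dots> \<le> real (card (N j)) * (real (card (N2 j)) * (3 * c))" by (rule dsum(2))
    also have "\<dots> \<le> (2 * real m) * ((4 * real m) * (3 * c))"
      using cN[of j] cN2'[of j] c(1) by (intro mult_mono) auto
    finally show ?thesis by (simp add: power2_eq_square algebra_simps)
  qed
  have bYR: "\<bar>\<integral>\<omega>. Y j \<omega> * R j \<omega> \<partial>M\<bar> \<le> 2 * real m * c" for j
  proof -
    have "(\<integral>\<omega>. Y j \<omega> * R j \<omega> \<partial>M) = (\<Sum>a\<in>N j. \<integral>\<omega>. Y j \<omega> * Y a \<omega> \<partial>M)"
      unfolding YR using iYY by (simp add: Bochner_Integration.integral_sum)
    also have "\<bar>\<dots>\<bar> \<le> (\<Sum>a\<in>N j. c)"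
      by (rule order_trans[OF sum_abs], rule sum_mono)
        (use bYY integral_abs_bound in \<open>blast intro: order_trans\<close>)
    also have "\<dots> \<le> 2 * real m * c" using cN[of j] c(1) by (simp add: mult_right_mono)
    finally show ?thesis .
  qed
  have iRQ: "integrable M (\<lambda>\<omega>. \<bar>R j \<omega> + Q j \<omega>\<bar>)" for j
    unfolding RQ using i1 by simp
  have bRQ: "(\<integral>\<omega>. \<bar>R j \<omega> + Q j \<omega>\<bar> \<partial>M) \<le> 4 * real m * c" for j
  proof -
    have "(\<integral>\<omega>. \<bar>R j \<omega> + Q j \<omega>\<bar> \<partial>M) \<le> (\<integral>\<omega>. (\<Sum>a\<in>N j \<union> N2 j. \<bar>Y a \<omega>\<bar>) \<partial>M)"
      by (rule integral_mono[OF iRQ]) (use i1 in \<open>auto simp: RQ\<close>)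
    also have "\<dots> = (\<Sum>a\<in>N j \<union> N2 j. \<integral>\<omega>. \<bar>Y a \<omega>\<bar> \<partial>M)"
      using i1 by (simp add: Bochner_Integration.integral_sum)
    also have "\<dots> \<le> (\<Sum>a\<in>N j \<union> N2 j. c)" by (intro sum_mono c(4))
    also have "\<dots> \<le> 4 * real m * c" using cN2[of j] c(1) by (simp add: mult_right_mono)
    finally show ?thesis .
  qed
  have fac1: "(\<integral>\<omega>. of_real (Y j \<omega>) * iexp (x * (Q j \<omega> + G j \<omega>)) \<partial>M) = 0" for j x
  proof -
    have sep: "separated m {j} (N2 j \<union> F j)"
      by (auto simp: separated_def N2_def F_def)
    have "(\<integral>\<omega>. of_real ((\<lambda>y. y j) ((\<lambda>\<omega>. \<lambda>i\<in>{j}. Y i \<omega>) \<omega>)) *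
        iexp ((\<lambda>y. x * (\<Sum>a\<in>N2 j \<union> F j. y a)) ((\<lambda>\<omega>. \<lambda>i\<in>N2 j \<union> F j. Y i \<omega>) \<omega>)) \<partial>M)
      = of_real (\<integral>\<omega>. (\<lambda>y. y j) ((\<lambda>\<omega>. \<lambda>i\<in>{j}. Y i \<omega>) \<omega>) \<partial>M) *
        (\<integral>\<omega>. iexp ((\<lambda>y. x * (\<Sum>a\<in>N2 j \<union> F j. y a)) ((\<lambda>\<omega>. \<lambda>i\<in>N2 j \<union> F j. Y i \<omega>) \<omega>)) \<partial>M)"
      by (rule indep_var_integral_iexp[OF indep[OF sep]]) (use i1 in auto)
    then show ?thesis by (simp add: centered QG)
  qed
  have fac2: "(\<integral>\<omega>. of_real (Y j \<omega> * R j \<omega>) * iexp (x * G j \<omega>) \<partial>M)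
      = of_real (\<integral>\<omega>. Y j \<omega> * R j \<omega> \<partial>M) * (\<integral>\<omega>. iexp (x * G j \<omega>) \<partial>M)" for j x
  proof -
    \<comment> \<open>\<open>j\<close> is inserted because it ranges over all integers here and need
      not belong to \<open>A\<close>, hence not to \<open>N j\<close>.\<close>
    have sep: "separated m (insert j (N j)) (F j)"
      by (auto simp: separated_def N_def F_def)
    have "(\<integral>\<omega>. of_real ((\<lambda>y. y j * (\<Sum>a\<in>N j. y a)) ((\<lambda>\<omega>. \<lambda>i\<in>insert j (N j). Y i \<omega>) \<omega>)) *
        iexp ((\<lambda>y. x * (\<Sum>a\<in>F j. y a)) ((\<lambda>\<omega>. \<lambda>i\<in>F j. Y i \<omega>) \<omega>)) \<partial>M)
      = of_real (\<integral>\<omega>. (\<lambda>y. y j * (\<Sum>a\<in>N j. y a)) ((\<lambda>\<omega>. \<lambda>i\<in>insert j (N j). Y i \<omega>) \<omega>) \<partial>M) *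
        (\<integral>\<omega>. iexp ((\<lambda>y. x * (\<Sum>a\<in>F j. y a)) ((\<lambda>\<omega>. \<lambda>i\<in>F j. Y i \<omega>) \<omega>)) \<partial>M)"
      by (rule indep_var_integral_iexp[OF indep[OF sep]]) (use iYR in \<open>auto simp: R_def\<close>)
    then show ?thesis by (simp add: R_def G_def)
  qed
  \<comment> \<open>Covariances at distance m or more vanish, so the near neighbours account for the
    whole variance and the differential equation carries \<open>V\<close> without error.\<close>
  have V_eq: "V = (\<Sum>j\<in>A. \<integral>\<omega>. Y j \<omega> * R j \<omega> \<partial>M)"
  proof -
    have zero: "(\<integral>\<omega>. Y j \<omega> * Y a \<omega> \<partial>M) = 0" if "int m \<le> \<bar>a - j\<bar>" for a j
    proof -
      have sep: "separated m {j} {a}" using that by (auto simp: separated_def)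
      show ?thesis
        using indep_var_expectation_mult[OF indep[OF sep], of "\<lambda>y. y j" "\<lambda>y. y a"] i1
        by (simp add: centered)
    qed
    have "V = (\<integral>\<omega>. (\<Sum>j\<in>A. \<Sum>a\<in>A. Y j \<omega> * Y a \<omega>) \<partial>M)"
      by (simp add: V_def S_def power2_eq_square sum_product)
    also have "\<dots> = (\<Sum>j\<in>A. \<Sum>a\<in>A. \<integral>\<omega>. Y j \<omega> * Y a \<omega> \<partial>M)"
      using iYY by (simp add: Bochner_Integration.integral_sum)
    also have "\<dots> = (\<Sum>j\<in>A. \<Sum>a\<in>N j. \<integral>\<omega>. Y j \<omega> * Y a \<omega> \<partial>M)"
      by (intro sum.cong refl sum.mono_neutral_right) (auto simp: fin N_def intro!: zero)
    also have "\<dots> = (\<Sum>j\<in>A. \<integral>\<omega>. Y j \<omega> * R j \<omega> \<partial>M)"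
      unfolding YR using iYY by (simp add: Bochner_Integration.integral_sum)
    finally show ?thesis .
  qed
  define \<psi> where "\<psi> x = (\<integral>\<omega>. iexp (x * S \<omega>) \<partial>M)" for x
  define \<psi>' where "\<psi>' x = (\<integral>\<omega>. \<i> * of_real (S \<omega>) * iexp (x * S \<omega>) \<partial>M)" for x
  have iS: "integrable M S" unfolding S_def[abs_def] using i1 by simp
  have iSS: "integrable M (\<lambda>\<omega>. (S \<omega>)\<^sup>2)"
    unfolding S_def power2_eq_square sum_product using iYY by simp
  have der: "(\<psi> has_vector_derivative \<psi>' x) (at x)" for x
    unfolding \<psi>_def[abs_def] \<psi>'_def by (rule char_has_vector_derivative[OF Sm iS iSS])
  have psi'_eq: "\<psi>' x + of_real (x * V) * \<psi> x = \<i> * (\<Sum>j\<in>A. (\<integral>\<omega>. of_real (Y j \<omega>) * iexp (x * S \<omega>) \<partial>M)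
      - \<i> * of_real x * of_real (\<integral>\<omega>. Y j \<omega> * R j \<omega> \<partial>M) * \<psi> x)" for x
  proof -
    have iY: "integrable M (\<lambda>\<omega>. complex_of_real (Y j \<omega>) * iexp (x * S \<omega>))" for j
      by (rule integrable_times_iexp[OF i1]) simp
    have "\<psi>' x = (\<integral>\<omega>. \<i> * (\<Sum>j\<in>A. of_real (Y j \<omega>) * iexp (x * S \<omega>)) \<partial>M)"
      unfolding \<psi>'_def by (simp add: S_def sum_distrib_right mult.assoc)
    also have "\<dots> = \<i> * (\<Sum>j\<in>A. \<integral>\<omega>. of_real (Y j \<omega>) * iexp (x * S \<omega>) \<partial>M)"
      using iY by (simp add: Bochner_Integration.integral_sum)
    finally show ?thesis
      by (simp add: V_eq sum_negf sum_subtractf right_diff_distrib sum_distrib_left sum_distrib_right mult.assoc[symmetric])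
  qed
  have m1: "1 \<le> (real m)\<^sup>2" using m by simp
  have main: "cmod (\<psi>' x + of_real (x * V) * \<psi> x) \<le> (38 * c\<^sup>2 * (real m)\<^sup>2 * real (card A)) * x\<^sup>2" for x
  proof -
    have step: "cmod ((\<integral>\<omega>. of_real (Y j \<omega>) * iexp (x * S \<omega>) \<partial>M)
      - \<i> * of_real x * of_real (\<integral>\<omega>. Y j \<omega> * R j \<omega> \<partial>M) * \<psi> x) \<le> x\<^sup>2 * (38 * c\<^sup>2 * (real m)\<^sup>2)" for j
    proof -
      have "cmod ((\<integral>\<omega>. of_real (Y j \<omega>) * iexp (x * (R j \<omega> + Q j \<omega> + G j \<omega>)) \<partial>M)
          - \<i> * of_real x * of_real (\<integral>\<omega>. Y j \<omega> * R j \<omega> \<partial>M) * (\<integral>\<omega>. iexp (x * (R j \<omega> + Q j \<omega> + G j \<omega>)) \<partial>M))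
        \<le> x\<^sup>2 * ((\<integral>\<omega>. \<bar>Y j \<omega>\<bar> * (R j \<omega>)\<^sup>2 \<partial>M) / 2 + (\<integral>\<omega>. \<bar>Y j \<omega> * R j \<omega> * Q j \<omega>\<bar> \<partial>M)
            + \<bar>\<integral>\<omega>. Y j \<omega> * R j \<omega> \<partial>M\<bar> * (\<integral>\<omega>. \<bar>R j \<omega> + Q j \<omega>\<bar> \<partial>M))"
        by (rule char_step[OF _ _ _ _ i1 iYR iYRR iYRQ iRQ fac1 fac2]) measurable
      \<comment> \<open>The factors in m come from the cardinalities 2 m and 4 m, the factors 3 c
        from the products of three terms. As c is at least 1, the terms linear in c are absorbed
        into the square: 12 / 2 + 24 + 8 = 38.\<close>
      also have "\<dots> \<le> x\<^sup>2 * (12 * (real m)\<^sup>2 * c / 2 + 24 * (real m)\<^sup>2 * c + (2 * real m * c) * (4 * real m * c))"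
        using bYRR[of j] bYRQ[of j] bYR[of j] bRQ[of j] c(1)
        by (intro mult_left_mono add_mono mult_mono divide_right_mono) auto
      also have "\<dots> = x\<^sup>2 * (30 * (real m)\<^sup>2 * c + 8 * (real m)\<^sup>2 * c\<^sup>2)"
        by (simp add: power2_eq_square algebra_simps)
      also have "\<dots> \<le> x\<^sup>2 * (30 * (real m)\<^sup>2 * c\<^sup>2 + 8 * (real m)\<^sup>2 * c\<^sup>2)"
        using c(1) by (intro mult_left_mono add_mono) (auto simp: power2_eq_square)
      also have "\<dots> = x\<^sup>2 * (38 * c\<^sup>2 * (real m)\<^sup>2)" by simp
      finally show ?thesis unfolding \<psi>_def SR[of _ j] .
    qed
    have "cmod (\<psi>' x + of_real (x * V) * \<psi> x) \<le> (\<Sum>j\<in>A. x\<^sup>2 * (38 * c\<^sup>2 * (real m)\<^sup>2))"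
      unfolding psi'_eq norm_mult norm_ii mult_1 by (intro sum_norm_le step)
    then show ?thesis by (simp add: algebra_simps)
  qed
  have "cmod (\<psi> v - of_real (exp (- (v\<^sup>2 * V / 2)))) \<le> (38 * c\<^sup>2 * (real m)\<^sup>2 * real (card A)) * \<bar>v\<bar> ^ 3"
    by (rule gaussian_ode_bound[OF der _ _ main]) (auto simp: \<psi>_def V_def prob_space)
  then show ?thesis by (simp add: \<psi>_def V_def S_def)
qed

section \<open>Causal functionals of independent innovations\<close>

text \<open>Cauchy-Schwarz with upper bounds in place of the exact second moments, by integrating
  Young's inequality with an optimal weight.\<close>

lemma (in prob_space) expectation_abs_mult_le:
  fixes f g :: "'a \<Rightarrow> real"
  assumes [measurable]: "random_variable borel f" "random_variable borel g"
    and int: "integrable M (\<lambda>\<omega>. (f \<omega>)\<^sup>2)" "integrable M (\<lambda>\<omega>. (g \<omega>)\<^sup>2)"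
    and bd: "(\<integral>\<omega>. (f \<omega>)\<^sup>2 \<partial>M) \<le> a\<^sup>2" "(\<integral>\<omega>. (g \<omega>)\<^sup>2 \<partial>M) \<le> b\<^sup>2" and ab: "0 \<le> a" "0 \<le> b"
  shows "integrable M (\<lambda>\<omega>. f \<omega> * g \<omega>)" "(\<integral>\<omega>. \<bar>f \<omega> * g \<omega>\<bar> \<partial>M) \<le> a * b"
proof -
  have young: "\<bar>x * y\<bar> \<le> (s * x\<^sup>2 + y\<^sup>2 / s) / 2" if "0 < s" for s x y :: real
  proof -
    have "0 \<le> (s * \<bar>x\<bar> - \<bar>y\<bar>)\<^sup>2 / s" using that by simp
    also have "\<dots> = s * x\<^sup>2 + y\<^sup>2 / s - 2 * \<bar>x * y\<bar>"
      using that by (simp add: field_simps power2_eq_square abs_mult)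
    finally show ?thesis by simp
  qed
  have dom: "integrable M (\<lambda>\<omega>. (s * (f \<omega>)\<^sup>2 + (g \<omega>)\<^sup>2 / s) / 2)" for s
    using int by simp
  have "integrable M (\<lambda>\<omega>. \<bar>f \<omega> * g \<omega>\<bar>)"
    by (rule integrable_nonneg_le[OF dom[of 1]]) (use young[of 1] in auto)
  then show fg: "integrable M (\<lambda>\<omega>. f \<omega> * g \<omega>)"
    by (subst integrable_abs_iff[symmetric]) auto
  have "(\<integral>\<omega>. \<bar>f \<omega> * g \<omega>\<bar> \<partial>M) \<le> (a + e) * (b + e)" if e: "0 < e" for e
  proof -
    \<comment> \<open>The weight that balances the two terms of Young's inequality. Adding e > 0
      keeps it positive and finite when a bound is 0; e tends to 0 at the end.\<close>
    define s where "s = (b + e) / (a + e)"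
    have s: "0 < s" using ab e by (simp add: s_def)
    have "(\<integral>\<omega>. \<bar>f \<omega> * g \<omega>\<bar> \<partial>M) \<le> (\<integral>\<omega>. (s * (f \<omega>)\<^sup>2 + (g \<omega>)\<^sup>2 / s) / 2 \<partial>M)"
      by (rule integral_mono[OF _ dom]) (use fg young[OF s] in auto)
    also have "\<dots> = (s * (\<integral>\<omega>. (f \<omega>)\<^sup>2 \<partial>M) + (\<integral>\<omega>. (g \<omega>)\<^sup>2 \<partial>M) / s) / 2"
      using int by simp
    also have "\<dots> \<le> (s * (a + e)\<^sup>2 + (b + e)\<^sup>2 / s) / 2"
    proof -
      have "a\<^sup>2 \<le> (a + e)\<^sup>2" "b\<^sup>2 \<le> (b + e)\<^sup>2" using ab e by (auto intro!: power_mono)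
      then show ?thesis using bd s by (intro divide_right_mono add_mono mult_left_mono) auto
    qed
    also have "\<dots> = (a + e) * (b + e)"
    proof -
      have "(q / p * p\<^sup>2 + q\<^sup>2 / (q / p)) / 2 = p * q" if "0 < p" "0 < q" for p q :: real
        using that by (simp add: power2_eq_square)
      then show ?thesis using ab e by (simp add: s_def)
    qed
    finally show ?thesis .
  qed
  then have "\<forall>\<^sub>F e in at_right 0. (\<integral>\<omega>. \<bar>f \<omega> * g \<omega>\<bar> \<partial>M) \<le> (a + e) * (b + e)"
    by (auto simp: eventually_at_right_field intro: exI[of _ 1])
  moreover have "((\<lambda>e. (a + e) * (b + e)) \<longlongrightarrow> (a + 0) * (b + 0)) (at_right 0)"
    by (intro tendsto_intros)
  ultimately show "(\<integral>\<omega>. \<bar>f \<omega> * g \<omega>\<bar> \<partial>M) \<le> a * b"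
    using tendsto_lowerbound[of "\<lambda>e. (a + e) * (b + e)" "a * b" "at_right 0"] by simp
qed

definition innovation :: "(int \<Rightarrow> 'a \<Rightarrow> 's) \<Rightarrow> (int \<Rightarrow> int \<Rightarrow> 'a \<Rightarrow> 's) \<Rightarrow> int + int \<times> int \<Rightarrow> 'a \<Rightarrow> 's" where
  "innovation \<xi> \<xi>' = (\<lambda>j. case j of Inl k \<Rightarrow> \<xi> k | Inr (n, k) \<Rightarrow> \<xi>' n k)"

text \<open>The limit theorem only sees a scalar functional: \<open>G\<close> will be the centred
  value of a curve at one point. The innovations and all their copies form one i.i.d. family, so
  that independence becomes disjointness of index sets and equality in law becomes injective
  relabelling.\<close>

locale causal_functional = prob_space M for M :: "'a measure" +
  fixes S :: "'s measure" and \<xi> :: "int \<Rightarrow> 'a \<Rightarrow> 's" and \<xi>' :: "int \<Rightarrow> int \<Rightarrow> 'a \<Rightarrow> 's"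
    and G :: "(nat \<Rightarrow> 's) \<Rightarrow> real"
  assumes innovation_indep: "indep_vars (\<lambda>_. S) (innovation \<xi> \<xi>') UNIV"
    and innovation_distr: "\<And>j. distr M S (innovation \<xi> \<xi>' j) = distr M S (\<xi> 0)"
    and G_measurable: "G \<in> borel_measurable (PiM UNIV (\<lambda>_. S))"
begin

definition Z :: "int \<Rightarrow> 'a \<Rightarrow> real" where
  "Z n \<omega> = G (\<lambda>k. \<xi> (n - int k) \<omega>)"

definition Zc :: "nat \<Rightarrow> int \<Rightarrow> 'a \<Rightarrow> real" where
  "Zc m n \<omega> = G (\<lambda>k. if k < m then \<xi> (n - int k) \<omega> else \<xi>' n (n - int k) \<omega>)"

text \<open>Addresses in the joint family of what \<open>Zc m n\<close> reads: a block of the common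
  sequence, followed by the private copy attached to \<open>n\<close>.\<close>

definition idx :: "nat \<Rightarrow> int \<Rightarrow> nat \<Rightarrow> int + int \<times> int" where
  "idx m n k = (if k < m then Inl (n - int k) else Inr (n, n - int k))"

text \<open>Reads the common past and the private copy of \<open>n\<close> side by side, because the
  law of \<open>Z n - Zc m n\<close> involves both at once.\<close>

definition idx2 :: "int \<Rightarrow> nat + nat \<Rightarrow> int + int \<times> int" where
  "idx2 n j = (case j of Inl k \<Rightarrow> Inl (n - int k) | Inr k \<Rightarrow> Inr (n, n - int k))"

lemma innovation_rv[measurable]: "innovation \<xi> \<xi>' j \<in> measurable M S"
  using innovation_indep by (auto simp: indep_vars_def)

lemma Zc_idx: "Zc m n \<omega> = G (\<lambda>k. innovation \<xi> \<xi>' (idx m n k) \<omega>)"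
  unfolding Zc_def by (rule arg_cong[of _ _ G]) (auto simp: innovation_def idx_def)

lemma Z_idx: "Z n \<omega> = G (\<lambda>k. innovation \<xi> \<xi>' (Inl (n - int k)) \<omega>)"
  by (simp add: Z_def innovation_def)

lemma innovation_family_measurable:
  "(\<lambda>\<omega> k. innovation \<xi> \<xi>' (r k) \<omega>) \<in> measurable M (PiM UNIV (\<lambda>_. S))"
  by (rule measurable_PiM_single') (auto simp: measurable_space[OF innovation_rv])

lemma Z_measurable[measurable]: "Z n \<in> borel_measurable M"
  unfolding Z_idx[abs_def] by (rule measurable_compose[OF innovation_family_measurable G_measurable])

lemma Zc_measurable[measurable]: "Zc m n \<in> borel_measurable M"
  unfolding Zc_idx[abs_def] by (rule measurable_compose[OF innovation_family_measurable G_measurable])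

text \<open>An i.i.d. family keeps its product law under every injective relabelling; all equalities
  in law below go back to this.\<close>

lemma innovation_family_distr:
  fixes r :: "'k \<Rightarrow> int + int \<times> int"
  assumes "inj r"
  shows "distr M (PiM UNIV (\<lambda>_. S)) (\<lambda>\<omega> k. innovation \<xi> \<xi>' (r k) \<omega>) = PiM UNIV (\<lambda>_. distr M S (\<xi> 0))"
proof -
  let ?\<nu> = "distr M S (\<xi> 0)"
  have xi0: "\<xi> 0 \<in> measurable M S"
    using innovation_rv[of "Inl 0"] by (simp add: innovation_def)
  then have nu: "prob_space ?\<nu>" by (rule prob_space_distr)
  have all: "distr M (PiM UNIV (\<lambda>_. S)) (\<lambda>\<omega> j. innovation \<xi> \<xi>' j \<omega>) = PiM UNIV (\<lambda>_. ?\<nu>)"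
    using innovation_indep
    by (subst (asm) indep_vars_iff_distr_eq_PiM) (auto simp: restrict_UNIV innovation_distr)
  have cong: "sets (PiM UNIV (\<lambda>_. ?\<nu>)) = sets (PiM UNIV (\<lambda>_. S))"
    by (intro sets_PiM_cong) auto
  have sel: "(\<lambda>x k. x (r k)) \<in> measurable (PiM UNIV (\<lambda>_. S)) (PiM UNIV (\<lambda>_. S))"
    by (rule measurable_PiM_single') (auto simp: space_PiM PiE_iff)
  have "distr M (PiM UNIV (\<lambda>_. S)) (\<lambda>\<omega> k. innovation \<xi> \<xi>' (r k) \<omega>)
    = distr (distr M (PiM UNIV (\<lambda>_. S)) (\<lambda>\<omega> j. innovation \<xi> \<xi>' j \<omega>)) (PiM UNIV (\<lambda>_. S)) (\<lambda>x k. x (r k))"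
    by (subst distr_distr[OF sel innovation_family_measurable]) (simp add: comp_def)
  also have "\<dots> = distr (PiM UNIV (\<lambda>_. ?\<nu>)) (PiM UNIV (\<lambda>_. ?\<nu>)) (\<lambda>x. \<lambda>k\<in>UNIV. x (r k))"
    unfolding all by (rule distr_cong) (auto simp: cong restrict_UNIV)
  also have "\<dots> = PiM UNIV (\<lambda>_. ?\<nu>)"
    using distr_PiM_reindex[of UNIV "\<lambda>_. ?\<nu>" r UNIV] nu assms by simp
  finally show ?thesis .
qed

lemma innovation_functional_distr:
  fixes r r' :: "'k \<Rightarrow> int + int \<times> int"
  assumes "inj r" "inj r'" and \<Phi>: "\<Phi> \<in> borel_measurable (PiM UNIV (\<lambda>_. S))"
  shows "distr M borel (\<lambda>\<omega>. \<Phi> (\<lambda>k. innovation \<xi> \<xi>' (r k) \<omega>)) = distr M borel (\<lambda>\<omega>. \<Phi> (\<lambda>k. innovation \<xi> \<xi>' (r' k) \<omega>))"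
proof -
  have "distr M borel (\<lambda>\<omega>. \<Phi> (\<lambda>k. innovation \<xi> \<xi>' (r k) \<omega>))
    = distr (PiM UNIV (\<lambda>_. distr M S (\<xi> 0))) borel \<Phi>" if "inj r" for r :: "'k \<Rightarrow> int + int \<times> int"
    unfolding innovation_family_distr[OF that, symmetric]
    by (subst distr_distr[OF \<Phi> innovation_family_measurable]) (simp add: comp_def)
  with assms show ?thesis by metis
qed

lemma inj_idx: "inj (idx m n)" "inj (\<lambda>k. Inl (n - int k) :: int + int \<times> int)" "inj (idx2 n)"
  by (auto simp: inj_def idx_def idx2_def split: if_splits sum.splits)

lemma Zc_distr: "distr M borel (Zc m n) = distr M borel (Z n')"
  unfolding Zc_idx[abs_def] Z_idx[abs_def]
  by (rule innovation_functional_distr[OF inj_idx(1) inj_idx(2) G_measurable])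

lemma Z_distr: "distr M borel (Z n) = distr M borel (Z n')"
  unfolding Z_idx[abs_def]
  by (rule innovation_functional_distr[OF inj_idx(2) inj_idx(2) G_measurable])

text \<open>The coupling assumption controls the difference of order m only at index m; equality in
  law carries it to every index. The common past and the private copy are relabelled together, so
  that the joint law is preserved.\<close>

lemma Z_diff_distr: "distr M borel (\<lambda>\<omega>. Z n \<omega> - Zc m n \<omega>) = distr M borel (\<lambda>\<omega>. Z n' \<omega> - Zc m n' \<omega>)"
proof -
  define \<Phi> where "\<Phi> x = G (\<lambda>k. x (Inl k)) - G (\<lambda>k. if k < m then x (Inl k) else x (Inr k))" for x :: "nat + nat \<Rightarrow> 's"
  have 1: "(\<lambda>x k. x (Inl k)) \<in> measurable (PiM (UNIV :: (nat + nat) set) (\<lambda>_. S)) (PiM UNIV (\<lambda>_. S))"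
    and 2: "(\<lambda>x k. if k < m then x (Inl k) else x (Inr k))
      \<in> measurable (PiM (UNIV :: (nat + nat) set) (\<lambda>_. S)) (PiM UNIV (\<lambda>_. S))"
    by (rule measurable_PiM_single'; auto simp: space_PiM PiE_iff)+
  have \<Phi>: "\<Phi> \<in> borel_measurable (PiM UNIV (\<lambda>_. S))"
    unfolding \<Phi>_def[abs_def]
    by (intro borel_measurable_diff measurable_compose[OF 1 G_measurable] measurable_compose[OF 2 G_measurable])
  have "Z n \<omega> - Zc m n \<omega> = \<Phi> (\<lambda>k. innovation \<xi> \<xi>' (idx2 n k) \<omega>)" for n \<omega>
    unfolding \<Phi>_def Z_def Zc_def
    by (intro arg_cong2[of _ _ _ _ "(-)"] arg_cong[of _ _ G]) (auto simp: innovation_def idx2_def)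
  then show ?thesis
    using innovation_functional_distr[OF inj_idx(3) inj_idx(3) \<Phi>, of n n'] by simp
qed

lemma expectation_distr_eq:
  fixes f :: "real \<Rightarrow> real"
  assumes "distr M borel U = distr M borel V" "U \<in> borel_measurable M" "V \<in> borel_measurable M" "f \<in> borel_measurable borel"
  shows "(\<integral>\<omega>. f (U \<omega>) \<partial>M) = (\<integral>\<omega>. f (V \<omega>) \<partial>M)" "integrable M (\<lambda>\<omega>. f (U \<omega>)) \<longleftrightarrow> integrable M (\<lambda>\<omega>. f (V \<omega>))"
  using integral_distr[OF assms(2,4)] integral_distr[OF assms(3,4)]
    integrable_distr_eq[OF assms(2,4)] integrable_distr_eq[OF assms(3,4)] assms(1) by auto

text \<open>Indices at distance m or more use disjoint blocks of the common sequence, and each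
  private copy carries its own index, so elements of \<open>B\<close> and \<open>C\<close> never
  share an address.\<close>

lemma Zc_indep:
  assumes "separated m B C"  "1 \<le> m"
  shows "indep_var (PiM B (\<lambda>_. borel)) (\<lambda>\<omega>. \<lambda>i\<in>B. Zc m i \<omega>) (PiM C (\<lambda>_. borel)) (\<lambda>\<omega>. \<lambda>i\<in>C. Zc m i \<omega>)"
proof -
  let ?K = "\<lambda>B. \<Union>b\<in>B. range (idx m b)"
  define H where "H B x = (\<lambda>b\<in>B. G (\<lambda>k. x (idx m b k)))" for B :: "int set" and x
  have disj: "?K B \<inter> ?K C = {}"
  proof -
    have "idx m b k \<noteq> idx m c l" if "b \<in> B" "c \<in> C" for b c k l
    proof -
      have "int m \<le> \<bar>b - c\<bar>" using assms that by (auto simp: separated_def)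
      then show ?thesis using \<open>1 \<le> m\<close> by (auto simp: idx_def)
    qed
    then show ?thesis by blast
  qed
  have H: "H B \<in> measurable (PiM (?K B) (\<lambda>_. S)) (PiM B (\<lambda>_. borel))" for B
  proof -
    have "(\<lambda>x k. x (idx m b k)) \<in> measurable (PiM (?K B) (\<lambda>_. S)) (PiM UNIV (\<lambda>_. S))" if "b \<in> B" for b
      by (rule measurable_PiM_single') (use that in \<open>auto simp: space_PiM PiE_iff intro!: measurable_component_singleton\<close>)
    then show ?thesis
      unfolding H_def[abs_def] by (intro measurable_restrict measurable_compose[OF _ G_measurable])
  qed
  have "indep_var (PiM B (\<lambda>_. borel)) (H B \<circ> (\<lambda>\<omega>. \<lambda>i\<in>?K B. innovation \<xi> \<xi>' i \<omega>))
      (PiM C (\<lambda>_. borel)) (H C \<circ> (\<lambda>\<omega>. \<lambda>i\<in>?K C. innovation \<xi> \<xi>' i \<omega>))"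
    by (rule indep_var_compose[OF indep_var_restrict[OF innovation_indep disj] H H]) auto
  moreover have "H B \<circ> (\<lambda>\<omega>. \<lambda>i\<in>?K B. innovation \<xi> \<xi>' i \<omega>) = (\<lambda>\<omega>. \<lambda>i\<in>B. Zc m i \<omega>)" for B
  proof (intro ext)
    fix \<omega> i
    have "(\<lambda>k. (\<lambda>i\<in>?K B. innovation \<xi> \<xi>' i \<omega>) (idx m i k)) = (\<lambda>k. innovation \<xi> \<xi>' (idx m i k) \<omega>)" if "i \<in> B"
      using that by (auto simp: fun_eq_iff)
    then show "(H B \<circ> (\<lambda>\<omega>. \<lambda>i\<in>?K B. innovation \<xi> \<xi>' i \<omega>)) \<omega> i = (\<lambda>i\<in>B. Zc m i \<omega>) i"
      by (simp add: H_def Zc_idx)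
  qed
  ultimately show ?thesis by simp
qed

text \<open>Replacing \<open>Z n'\<close> by its coupled version of order \<open>n' - n\<close> makes the later difference independent of
  the earlier one. This is what bounds the covariances of the differences.\<close>

lemma diff_indep:
  assumes "n < n'" "int m \<le> n' - n"
  shows "indep_var borel (\<lambda>\<omega>. Z n \<omega> - Zc m n \<omega>) borel (\<lambda>\<omega>. Zc (nat (n' - n)) n' \<omega> - Zc m n' \<omega>)"
proof -
  let ?k = "nat (n' - n)"
  define A where "A = range (idx m n) \<union> range (\<lambda>k. Inl (n - int k) :: int + int \<times> int)"
  define B where "B = range (idx m n') \<union> range (idx ?k n')"
  define U where "U x = G (\<lambda>k. x (Inl (n - int k))) - G (\<lambda>k. x (idx m n k))" for x
  define V where "V x = G (\<lambda>k. x (idx ?k n' k)) - G (\<lambda>k. x (idx m n' k))" for x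
  \<comment> \<open>At order n' - n the coupled value at \<open>n'\<close> reads the common
    innovations n + 1 to n' only, while everything built at \<open>n\<close> stops at
    \<open>n\<close>. The private copies differ because n < n'.\<close>
  have disj: "A \<inter> B = {}"
    using assms by (auto simp: A_def B_def idx_def split: if_splits)
  have sel: "(\<lambda>x. G (\<lambda>k. x (r k))) \<in> borel_measurable (PiM D (\<lambda>_. S))"
    if "range r \<subseteq> D" for r :: "nat \<Rightarrow> int + int \<times> int" and D
  proof -
    have "(\<lambda>x k. x (r k)) \<in> measurable (PiM D (\<lambda>_. S)) (PiM UNIV (\<lambda>_. S))"
      by (rule measurable_PiM_single') (use that in \<open>auto simp: space_PiM PiE_iff intro!: measurable_component_singleton\<close>)
    then show ?thesis by (rule measurable_compose[OF _ G_measurable])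
  qed
  have U: "U \<in> borel_measurable (PiM A (\<lambda>_. S))" and V: "V \<in> borel_measurable (PiM B (\<lambda>_. S))"
    unfolding U_def[abs_def] V_def[abs_def] by (intro borel_measurable_diff sel; auto simp: A_def B_def)+
  have "indep_var borel (U \<circ> (\<lambda>\<omega>. \<lambda>i\<in>A. innovation \<xi> \<xi>' i \<omega>)) borel (V \<circ> (\<lambda>\<omega>. \<lambda>i\<in>B. innovation \<xi> \<xi>' i \<omega>))"
    by (rule indep_var_compose[OF indep_var_restrict[OF innovation_indep disj] U V]) auto
  moreover have "U \<circ> (\<lambda>\<omega>. \<lambda>i\<in>A. innovation \<xi> \<xi>' i \<omega>) = (\<lambda>\<omega>. Z n \<omega> - Zc m n \<omega>)"
    unfolding Z_idx Zc_idx U_def by (auto simp: fun_eq_iff A_def)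
  moreover have "V \<circ> (\<lambda>\<omega>. \<lambda>i\<in>B. innovation \<xi> \<xi>' i \<omega>) = (\<lambda>\<omega>. Zc ?k n' \<omega> - Zc m n' \<omega>)"
    unfolding Zc_idx V_def by (auto simp: fun_eq_iff B_def)
  ultimately show ?thesis by simp
qed

section \<open>Moments of the coupling errors\<close>

lemma diff_second_moment:
  assumes int2: "integrable M (\<lambda>\<omega>. (Z 0 \<omega>)\<^sup>2)"
  shows "integrable M (\<lambda>\<omega>. (Z n \<omega>)\<^sup>2)" "integrable M (\<lambda>\<omega>. (Zc m n \<omega>)\<^sup>2)"
    "integrable M (\<lambda>\<omega>. (Z n \<omega> - Zc m n \<omega>)\<^sup>2)" "integrable M (\<lambda>\<omega>. (Zc k n \<omega> - Zc m n \<omega>)\<^sup>2)"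
    "(\<integral>\<omega>. (Z n \<omega> - Zc m n \<omega>)\<^sup>2 \<partial>M) = (\<integral>\<omega>. (Z n' \<omega> - Zc m n' \<omega>)\<^sup>2 \<partial>M)"
proof -
  show 1: "integrable M (\<lambda>\<omega>. (Z n \<omega>)\<^sup>2)"
    using expectation_distr_eq(2)[OF Z_distr[of n 0], of "\<lambda>x. x\<^sup>2"] int2 by simp
  have 2: "integrable M (\<lambda>\<omega>. (Zc k n \<omega>)\<^sup>2)" for k
    using expectation_distr_eq(2)[OF Zc_distr[of k n 0], of "\<lambda>x. x\<^sup>2"] int2 by simp
  then show "integrable M (\<lambda>\<omega>. (Zc m n \<omega>)\<^sup>2)" .
  have diff: "integrable M (\<lambda>\<omega>. (f \<omega> - g \<omega>)\<^sup>2)"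
    if [measurable]: "f \<in> borel_measurable M" "g \<in> borel_measurable M"
      and "integrable M (\<lambda>\<omega>. (f \<omega>)\<^sup>2)" "integrable M (\<lambda>\<omega>. (g \<omega>)\<^sup>2)" for f g :: "'a \<Rightarrow> real"
  proof (rule integrable_nonneg_le)
    show "integrable M (\<lambda>\<omega>. 2 * (f \<omega>)\<^sup>2 + 2 * (g \<omega>)\<^sup>2)" using that by simp
    show "(f \<omega> - g \<omega>)\<^sup>2 \<le> 2 * (f \<omega>)\<^sup>2 + 2 * (g \<omega>)\<^sup>2" for \<omega>
      using zero_le_power2[of "f \<omega> + g \<omega>"] by (simp add: power2_eq_square algebra_simps)
  qed auto
  show "integrable M (\<lambda>\<omega>. (Z n \<omega> - Zc m n \<omega>)\<^sup>2)" "integrable M (\<lambda>\<omega>. (Zc k n \<omega> - Zc m n \<omega>)\<^sup>2)"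
    by (rule diff; use 1 2 in simp)+
  show "(\<integral>\<omega>. (Z n \<omega> - Zc m n \<omega>)\<^sup>2 \<partial>M) = (\<integral>\<omega>. (Z n' \<omega> - Zc m n' \<omega>)\<^sup>2 \<partial>M)"
    using expectation_distr_eq(1)[OF Z_diff_distr[of n m n'], of "\<lambda>x. x\<^sup>2"] by simp
qed

lemma Zc_zero_mean_diff:
  assumes "integrable M (Z 0)"
  shows "integrable M (Z n)" "integrable M (Zc m n)" "(\<integral>\<omega>. Z n \<omega> - Zc m n \<omega> \<partial>M) = 0"
    "(\<integral>\<omega>. Zc m n \<omega> \<partial>M) = (\<integral>\<omega>. Z 0 \<omega> \<partial>M)" "(\<integral>\<omega>. Z n \<omega> \<partial>M) = (\<integral>\<omega>. Z 0 \<omega> \<partial>M)"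
proof -
  have id: "(\<lambda>x. x) \<in> borel_measurable (borel :: real measure)" by simp
  note Z = expectation_distr_eq[OF Z_distr[of n 0] Z_measurable Z_measurable id]
    and Zc = expectation_distr_eq[OF Zc_distr[of m n 0] Zc_measurable Z_measurable id]
  show 1: "integrable M (Z n)" "integrable M (Zc m n)"
    using Z(2) Zc(2) assms by blast+
  show 2: "(\<integral>\<omega>. Zc m n \<omega> \<partial>M) = (\<integral>\<omega>. Z 0 \<omega> \<partial>M)" "(\<integral>\<omega>. Z n \<omega> \<partial>M) = (\<integral>\<omega>. Z 0 \<omega> \<partial>M)"
    by (rule Zc(1), rule Z(1))
  show "(\<integral>\<omega>. Z n \<omega> - Zc m n \<omega> \<partial>M) = 0"
    by (subst Bochner_Integration.integral_diff[OF 1], subst 2(1), subst 2(2)) (rule diff_self)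
qed

text \<open>Each row of the covariance matrix of the differences is bounded regardless of
  \<open>A\<close>: there are fewer than 2 m near indices, and a far covariance is governed by the
  coupling rate at its lag. The resulting factor of the cardinality tends to 0 with growing m as
  soon as m times \<open>(\<delta> m)\<^sup>2\<close> does.\<close>

lemma diff_sum_second_moment:
  assumes int2: "integrable M (\<lambda>\<omega>. (Z 0 \<omega>)\<^sup>2)"
    and \<delta>: "\<And>k. 1 \<le> k \<Longrightarrow> (\<integral>\<omega>. (Z (int k) \<omega> - Zc k (int k) \<omega>)\<^sup>2 \<partial>M) \<le> (\<delta> k)\<^sup>2" "\<And>k. 0 \<le> \<delta> k"
      "summable \<delta>"
    and m: "1 \<le> m" and fin: "finite A"
  shows "(\<integral>\<omega>. (\<Sum>n\<in>A. Z n \<omega> - Zc m n \<omega>)\<^sup>2 \<partial>M)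
    \<le> real (card A) * (2 * real m * (\<delta> m)\<^sup>2 + 2 * \<delta> m * (\<Sum>k. \<delta> k))"
proof -
  define D where "D n \<omega> = Z n \<omega> - Zc m n \<omega>" for n \<omega>
  have [measurable]: "D n \<in> borel_measurable M" for n by (simp add: D_def[abs_def])
  have iZ: "integrable M (Z 0)"
    using square_integrable_imp_integrable[OF _ int2] by simp
  note Zi = Zc_zero_mean_diff(1,2)[OF iZ]
  have D2: "integrable M (\<lambda>\<omega>. (D n \<omega>)\<^sup>2)" "(\<integral>\<omega>. (D n \<omega>)\<^sup>2 \<partial>M) \<le> (\<delta> m)\<^sup>2" for n
    unfolding D_def using diff_second_moment[OF int2] \<delta>(1)[OF m] by (auto simp: diff_second_moment(5)[OF int2, of n m "int m"])
  have DD: "integrable M (\<lambda>\<omega>. D n \<omega> * D n' \<omega>)" "(\<integral>\<omega>. \<bar>D n \<omega> * D n' \<omega>\<bar> \<partial>M) \<le> \<delta> m * \<delta> m" for n n'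
    by (rule expectation_abs_mult_le[where a = "\<delta> m" and b = "\<delta> m"]; use D2 \<delta>(2) in simp)+
  \<comment> \<open>The later difference splits as \<open>E + F\<close>. \<open>F\<close> is
    independent of the centred \<open>D n\<close> and drops out, and \<open>E\<close> is a coupling
    error of order n' - n.\<close>
  have far: "\<bar>\<integral>\<omega>. D n \<omega> * D n' \<omega> \<partial>M\<bar> \<le> \<delta> m * \<delta> (nat (n' - n))" if "int m \<le> n' - n" for n n'
  proof -
    define k where "k = nat (n' - n)"
    have k: "1 \<le> k" "n < n'" using that m by (auto simp: k_def)
    define E where "E \<omega> = Z n' \<omega> - Zc k n' \<omega>" for \<omega>
    define F where "F \<omega> = Zc k n' \<omega> - Zc m n' \<omega>" for \<omega>
    have [measurable]: "E \<in> borel_measurable M" "F \<in> borel_measurable M" by (simp_all add: E_def[abs_def] F_def[abs_def])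
    have E2: "integrable M (\<lambda>\<omega>. (E \<omega>)\<^sup>2)" "(\<integral>\<omega>. (E \<omega>)\<^sup>2 \<partial>M) \<le> (\<delta> k)\<^sup>2"
      unfolding E_def using diff_second_moment[OF int2] \<delta>(1)[OF k(1)] by (auto simp: diff_second_moment(5)[OF int2, of n' k "int k"])
    have DE: "integrable M (\<lambda>\<omega>. D n \<omega> * E \<omega>)" "(\<integral>\<omega>. \<bar>D n \<omega> * E \<omega>\<bar> \<partial>M) \<le> \<delta> m * \<delta> k"
      by (rule expectation_abs_mult_le[where a = "\<delta> m" and b = "\<delta> k"]; use D2 E2 \<delta>(2) in simp)+
    have ind: "indep_var borel (D n) borel F"
      unfolding D_def[abs_def] F_def[abs_def] k_def by (rule diff_indep) (use that k in auto)
    have iF: "integrable M F" "integrable M (D n)"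
      unfolding F_def[abs_def] D_def[abs_def] using Zi by auto
    have iDF: "integrable M (\<lambda>\<omega>. D n \<omega> * F \<omega>)"
      by (rule indep_var_integrable[OF ind iF(2,1)])
    have "(\<integral>\<omega>. D n \<omega> * F \<omega> \<partial>M) = (\<integral>\<omega>. D n \<omega> \<partial>M) * (\<integral>\<omega>. F \<omega> \<partial>M)"
      by (rule indep_var_lebesgue_integral[OF ind iF(2,1)])
    then have DF: "(\<integral>\<omega>. D n \<omega> * F \<omega> \<partial>M) = 0"
      using Zc_zero_mean_diff(3)[OF iZ, of n m] by (simp add: D_def)
    have "D n' \<omega> = E \<omega> + F \<omega>" for \<omega> by (simp add: D_def E_def F_def)
    then have "(\<integral>\<omega>. D n \<omega> * D n' \<omega> \<partial>M) = (\<integral>\<omega>. D n \<omega> * E \<omega> \<partial>M)"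
      using DE(1) iDF DF by (simp add: distrib_left)
    then show ?thesis
      using order_trans[OF integral_abs_bound DE(2)] unfolding k_def by simp
  qed
  \<comment> \<open>The lag terms are included for near pairs as well. They are nonnegative, and on
    either side of \<open>n\<close> they then form a part of the series of
    \<open>\<delta>\<close>.\<close>
  define b where "b n n' = (if \<bar>n - n'\<bar> < int m then \<delta> m * \<delta> m else 0)
      + (if n < n' then \<delta> m * \<delta> (nat (n' - n)) else 0) + (if n' < n then \<delta> m * \<delta> (nat (n - n')) else 0)" for n n'
  have bound: "\<bar>\<integral>\<omega>. D n \<omega> * D n' \<omega> \<partial>M\<bar> \<le> b n n'" for n n'
  proof (cases "\<bar>n - n'\<bar> < int m")
    case True
    have "\<bar>\<integral>\<omega>. D n \<omega> * D n' \<omega> \<partial>M\<bar> \<le> \<delta> m * \<delta> m"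
      using DD(2)[of n n'] integral_abs_bound[of M "\<lambda>\<omega>. D n \<omega> * D n' \<omega>"] by linarith
    then show ?thesis using True \<delta>(2) by (auto simp: b_def add_increasing2)
  next
    case False
    then consider "int m \<le> n' - n" | "int m \<le> n - n'" by linarith
    then show ?thesis
    proof cases
      case 1
      then show ?thesis using far[OF 1] m by (auto simp: b_def)
    next
      case 2
      then show ?thesis using far[OF 2] m by (auto simp: b_def mult.commute)
    qed
  qed
  have tail: "(\<Sum>n'\<in>A. if P n' then \<delta> m * \<delta> (r n') else 0) \<le> \<delta> m * (\<Sum>k. \<delta> k)"
    if inj: "inj_on r {n'\<in>A. P n'}" for P and r :: "int \<Rightarrow> nat"
  proof -
    have "(\<Sum>n'\<in>A. if P n' then \<delta> m * \<delta> (r n') else 0) = (\<Sum>n'\<in>{n'\<in>A. P n'}. \<delta> m * \<delta> (r n'))"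
      using fin by (simp add: sum.inter_filter)
    also have "\<dots> = \<delta> m * (\<Sum>k\<in>r ` {n'\<in>A. P n'}. \<delta> k)"
      by (simp add: sum.reindex[OF inj] sum_distrib_left)
    also have "\<dots> \<le> \<delta> m * (\<Sum>k. \<delta> k)"
      using \<delta> fin by (intro mult_left_mono sum_le_suminf) auto
    finally show ?thesis .
  qed
  have row: "(\<Sum>n'\<in>A. b n n') \<le> 2 * real m * (\<delta> m)\<^sup>2 + 2 * \<delta> m * (\<Sum>k. \<delta> k)" for n
  proof -
    have "card {n'\<in>A. \<bar>n - n'\<bar> < int m} \<le> card {n - int m<..<n + int m}"
      by (rule card_mono) auto
    then have c: "real (card {n'\<in>A. \<bar>n - n'\<bar> < int m}) \<le> 2 * real m" by simp
    have "(\<Sum>n'\<in>A. if \<bar>n - n'\<bar> < int m then \<delta> m * \<delta> m else 0) = real (card {n'\<in>A. \<bar>n - n'\<bar> < int m}) * (\<delta> m)\<^sup>2"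
      using fin by (simp add: sum.inter_filter[symmetric] power2_eq_square)
    also have "\<dots> \<le> 2 * real m * (\<delta> m)\<^sup>2" using c by (intro mult_right_mono) auto
    finally have "(\<Sum>n'\<in>A. if \<bar>n - n'\<bar> < int m then \<delta> m * \<delta> m else 0) \<le> 2 * real m * (\<delta> m)\<^sup>2" .
    moreover have "(\<Sum>n'\<in>A. if n < n' then \<delta> m * \<delta> (nat (n' - n)) else 0) \<le> \<delta> m * (\<Sum>k. \<delta> k)"
      by (rule tail) (auto simp: inj_on_def)
    moreover have "(\<Sum>n'\<in>A. if n' < n then \<delta> m * \<delta> (nat (n - n')) else 0) \<le> \<delta> m * (\<Sum>k. \<delta> k)"
      by (rule tail) (auto simp: inj_on_def)
    ultimately show ?thesis by (simp add: b_def sum.distrib)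
  qed
  have "(\<integral>\<omega>. (\<Sum>n\<in>A. Z n \<omega> - Zc m n \<omega>)\<^sup>2 \<partial>M) = (\<integral>\<omega>. (\<Sum>n\<in>A. \<Sum>n'\<in>A. D n \<omega> * D n' \<omega>) \<partial>M)"
    by (simp add: D_def power2_eq_square sum_product)
  also have "\<dots> = (\<Sum>n\<in>A. \<Sum>n'\<in>A. \<integral>\<omega>. D n \<omega> * D n' \<omega> \<partial>M)"
    using DD(1) by (simp add: Bochner_Integration.integral_sum)
  also have "\<dots> \<le> (\<Sum>n\<in>A. \<Sum>n'\<in>A. b n n')"
    using bound by (intro sum_mono) (auto intro: order_trans[OF abs_ge_self])
  also have "\<dots> \<le> (\<Sum>n\<in>A. 2 * real m * (\<delta> m)\<^sup>2 + 2 * \<delta> m * (\<Sum>k. \<delta> k))"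
    by (intro sum_mono row)
  finally show ?thesis by simp
qed

text \<open>The parameters are fixed in this order: m such that passing to the coupled version is
  harmless for every \<open>A\<close>, then the cardinality large for that m. The Gaussian law
  carries the variance of \<open>A\<close> itself, which need not have a limit. The cap
  \<open>v0\<close> enters because the change of variance involves the square root of
  \<open>V\<close> times that of the coupling error.\<close>

theorem uniform_clt:
  assumes int3: "integrable M (\<lambda>\<omega>. \<bar>Z 0 \<omega>\<bar> ^ 3)" and centered: "(\<integral>\<omega>. Z 0 \<omega> \<partial>M) = 0"
    and \<delta>: "\<And>k. 1 \<le> k \<Longrightarrow> (\<integral>\<omega>. (Z (int k) \<omega> - Zc k (int k) \<omega>)\<^sup>2 \<partial>M) \<le> (\<delta> k)\<^sup>2" "\<And>k. 0 \<le> \<delta> k"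
      "summable \<delta>" "(\<lambda>k. real k * (\<delta> k)\<^sup>2) \<longlonglongrightarrow> 0"
    and \<eta>: "0 < \<eta>"
  shows "\<exists>P0. \<forall>A V. finite A \<longrightarrow> P0 \<le> card A \<longrightarrow> V = (\<integral>\<omega>. (\<Sum>n\<in>A. Z n \<omega>)\<^sup>2 \<partial>M) / real (card A) \<longrightarrow> V \<le> v0 \<longrightarrow>
    cmod ((\<integral>\<omega>. iexp (u * ((\<Sum>n\<in>A. Z n \<omega>) / sqrt (real (card A)))) \<partial>M) - of_real (exp (- (u\<^sup>2 * V / 2)))) \<le> \<eta>"
proof -
  have i3: "integrable M (\<lambda>\<omega>. \<bar>Zc m n \<omega>\<bar> ^ 3)"
    and e3: "(\<integral>\<omega>. \<bar>Zc m n \<omega>\<bar> ^ 3 \<partial>M) = (\<integral>\<omega>. \<bar>Z 0 \<omega>\<bar> ^ 3 \<partial>M)" for m n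
    using expectation_distr_eq[OF Zc_distr[of m n 0], of "\<lambda>x. \<bar>x\<bar> ^ 3"] int3 by simp_all
  have int2: "integrable M (\<lambda>\<omega>. (Z 0 \<omega>)\<^sup>2)"
  proof (rule integrable_nonneg_le)
    show "integrable M (\<lambda>\<omega>. 1 + \<bar>Z 0 \<omega>\<bar> ^ 3)" using int3 by simp
    show "(Z 0 \<omega>)\<^sup>2 \<le> 1 + \<bar>Z 0 \<omega>\<bar> ^ 3" for \<omega>
    proof (cases "\<bar>Z 0 \<omega>\<bar> \<le> 1")
      case True
      then have "\<bar>Z 0 \<omega>\<bar>\<^sup>2 \<le> 1" by (simp add: abs_square_le_1)
      moreover have "0 \<le> \<bar>Z 0 \<omega>\<bar> ^ 3" by simp
      ultimately show ?thesis unfolding power2_abs by linarith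
    next
      case False
      then have "\<bar>Z 0 \<omega>\<bar>\<^sup>2 \<le> \<bar>Z 0 \<omega>\<bar> ^ 3" by (intro power_increasing) auto
      then show ?thesis by simp
    qed
  qed simp_all
  have int1: "integrable M (Z 0)"
    using square_integrable_imp_integrable[OF _ int2] by simp
  note m2 = diff_second_moment[OF int2] and m1 = Zc_zero_mean_diff[OF int1]
  have e2: "(\<integral>\<omega>. (Zc m n \<omega>)\<^sup>2 \<partial>M) = (\<integral>\<omega>. (Z 0 \<omega>)\<^sup>2 \<partial>M)"
    and e1: "(\<integral>\<omega>. \<bar>Zc m n \<omega>\<bar> \<partial>M) = (\<integral>\<omega>. \<bar>Z 0 \<omega>\<bar> \<partial>M)" for m n
    using expectation_distr_eq[OF Zc_distr[of m n 0], of "\<lambda>x. x\<^sup>2"]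
      expectation_distr_eq[OF Zc_distr[of m n 0], of "\<lambda>x. \<bar>x\<bar>"] by simp_all
  define c where "c = 1 + (\<integral>\<omega>. \<bar>Z 0 \<omega>\<bar> ^ 3 \<partial>M) + (\<integral>\<omega>. (Z 0 \<omega>)\<^sup>2 \<partial>M) + (\<integral>\<omega>. \<bar>Z 0 \<omega>\<bar> \<partial>M)"
  have c: "1 \<le> c" "(\<integral>\<omega>. \<bar>Zc m n \<omega>\<bar> ^ 3 \<partial>M) \<le> c" "(\<integral>\<omega>. (Zc m n \<omega>)\<^sup>2 \<partial>M) \<le> c"
    "(\<integral>\<omega>. \<bar>Zc m n \<omega>\<bar> \<partial>M) \<le> c" for m n
    unfolding e1 e2 e3 by (auto simp: c_def)
  define \<rho> where "\<rho> m = 2 * real m * (\<delta> m)\<^sup>2 + 2 * \<delta> m * (\<Sum>k. \<delta> k)" for m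
  have \<rho>0: "0 \<le> \<rho> m" for m
    using \<delta>(2) suminf_nonneg[OF \<delta>(3)] by (auto simp: \<rho>_def)
  have "(\<lambda>m. 2 * (real m * (\<delta> m)\<^sup>2) + 2 * \<delta> m * (\<Sum>k. \<delta> k)) \<longlonglongrightarrow> 2 * 0 + 2 * 0 * (\<Sum>k. \<delta> k)"
    by (intro tendsto_intros \<delta>(4) summable_LIMSEQ_zero[OF \<delta>(3)])
  then have \<rho>lim: "\<rho> \<longlonglongrightarrow> 0"
    by (simp add: \<rho>_def[abs_def] mult.assoc)
  define w where "w = \<bar>v0\<bar>"
  \<comment> \<open>The first term is the exchange of the two sums inside the exponential. The
    second is the change of variance, which is 2 E(T D) - E(D^2) and is bounded by
    Cauchy-Schwarz.\<close>
  define err where "err x = \<bar>u\<bar> * sqrt x + u\<^sup>2 / 2 * (2 * sqrt w * sqrt x + x)" for x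
  have "(\<lambda>m. err (\<rho> m)) \<longlonglongrightarrow> err 0"
    unfolding err_def by (intro tendsto_intros \<rho>lim)
  then have "\<forall>\<^sub>F m in sequentially. err (\<rho> m) < \<eta> / 2"
    by (rule order_tendstoD(2)) (use \<eta> in \<open>simp add: err_def\<close>)
  then have "\<forall>\<^sub>F m in sequentially. 1 \<le> m \<and> err (\<rho> m) < \<eta> / 2"
    by (intro eventually_conj eventually_ge_at_top)
  then obtain m where m: "1 \<le> m" and errm: "err (\<rho> m) < \<eta> / 2"
    using eventually_happens'[OF sequentially_bot] by blast
  \<comment> \<open>The m-dependent bound at u / sqrt P is P times the cube of |u| / sqrt P up to
    constants, hence of order 1 / sqrt P.\<close>
  define K where "K = 38 * c\<^sup>2 * (real m)\<^sup>2 * \<bar>u\<bar> ^ 3"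
  have "(\<lambda>P. K / sqrt (real P)) \<longlonglongrightarrow> 0"
    by (intro real_tendsto_divide_at_top[OF tendsto_const] filterlim_compose[OF sqrt_at_top] filterlim_real_sequentially)
  then have "\<forall>\<^sub>F P in sequentially. K / sqrt (real P) < \<eta> / 2"
    by (rule order_tendstoD(2)) (use \<eta> in simp)
  then have "\<forall>\<^sub>F P in sequentially. 1 \<le> P \<and> K / sqrt (real P) < \<eta> / 2"
    by (intro eventually_conj eventually_ge_at_top)
  then obtain P0 where P0: "\<And>P. P0 \<le> P \<Longrightarrow> 1 \<le> P \<and> K / sqrt (real P) < \<eta> / 2"
    by (auto simp: eventually_sequentially)
  show ?thesis
  proof (intro exI[of _ P0] allI impI)
    fix A :: "int set" and V
    assume fin: "finite A" and cA: "P0 \<le> card A" and V: "V = (\<integral>\<omega>. (\<Sum>n\<in>A. Z n \<omega>)\<^sup>2 \<partial>M) / real (card A)"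
      and Vv0: "V \<le> v0"
    define P where "P = real (card A)"
    have P: "0 < P" "K / sqrt P < \<eta> / 2" using P0[OF cA] by (auto simp: P_def)
    define T where "T \<omega> = (\<Sum>n\<in>A. Z n \<omega>) / sqrt P" for \<omega>
    define T' where "T' \<omega> = (\<Sum>n\<in>A. Zc m n \<omega>) / sqrt P" for \<omega>
    define D where "D \<omega> = T \<omega> - T' \<omega>" for \<omega>
    have [measurable]: "T \<in> borel_measurable M" "T' \<in> borel_measurable M" "D \<in> borel_measurable M"
      by (simp_all add: T_def[abs_def] T'_def[abs_def] D_def[abs_def])
    have sq: "integrable M (\<lambda>\<omega>. (\<Sum>n\<in>A. f n \<omega>)\<^sup>2)"
      if "\<And>n. f n \<in> borel_measurable M" "\<And>n. integrable M (\<lambda>\<omega>. (f n \<omega>)\<^sup>2)" for f :: "int \<Rightarrow> 'a \<Rightarrow> real"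
    proof -
      have "integrable M (\<lambda>\<omega>. f n \<omega> * f n' \<omega>)" for n n'
        by (rule expectation_abs_mult_le(1)[where a = "sqrt (\<integral>\<omega>. (f n \<omega>)\<^sup>2 \<partial>M)" and b = "sqrt (\<integral>\<omega>. (f n' \<omega>)\<^sup>2 \<partial>M)"])
          (use that in auto)
      then show ?thesis by (simp add: power2_eq_square sum_product)
    qed
    have T2: "integrable M (\<lambda>\<omega>. (T \<omega>)\<^sup>2)" "(\<integral>\<omega>. (T \<omega>)\<^sup>2 \<partial>M) = V"
      using sq[of Z] m2 P(1) by (simp_all add: T_def power_divide V P_def[symmetric])
    have T'2: "integrable M (\<lambda>\<omega>. (T' \<omega>)\<^sup>2)"
      using sq[of "Zc m"] m2 P(1) by (simp_all add: T'_def power_divide)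
    have D_eq: "D \<omega> = (\<Sum>n\<in>A. Z n \<omega> - Zc m n \<omega>) / sqrt P" for \<omega>
      by (simp add: D_def T_def T'_def sum_subtractf diff_divide_distrib)
    have D2: "integrable M (\<lambda>\<omega>. (D \<omega>)\<^sup>2)" "(\<integral>\<omega>. (D \<omega>)\<^sup>2 \<partial>M) \<le> \<rho> m"
    proof -
      show "integrable M (\<lambda>\<omega>. (D \<omega>)\<^sup>2)"
        unfolding D_eq using sq[of "\<lambda>n \<omega>. Z n \<omega> - Zc m n \<omega>"] m2 by (simp add: power_divide)
      show "(\<integral>\<omega>. (D \<omega>)\<^sup>2 \<partial>M) \<le> \<rho> m"
        unfolding D_eq using diff_sum_second_moment[OF int2 \<delta>(1-3) m fin] P(1)
        by (simp add: power_divide \<rho>_def P_def field_simps)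
    qed
    have "0 \<le> V" unfolding T2(2)[symmetric] by simp
    then have Vw: "V \<le> w" using Vv0 by (simp add: w_def)
    have absD: "integrable M D" "(\<integral>\<omega>. \<bar>D \<omega>\<bar> \<partial>M) \<le> sqrt (\<rho> m)"
      using expectation_abs_mult_le[of D "\<lambda>_. 1" "sqrt (\<rho> m)" 1] D2 \<rho>0 by (auto simp: prob_space)
    have TD: "integrable M (\<lambda>\<omega>. T \<omega> * D \<omega>)" "(\<integral>\<omega>. \<bar>T \<omega> * D \<omega>\<bar> \<partial>M) \<le> sqrt w * sqrt (\<rho> m)"
      using T2 D2 \<rho>0[of m] Vw \<open>0 \<le> V\<close> expectation_abs_mult_le[of T D "sqrt w" "sqrt (\<rho> m)"] by auto
    define V' where "V' = (\<integral>\<omega>. (T' \<omega>)\<^sup>2 \<partial>M)"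
    have "0 \<le> V'" by (simp add: V'_def)
    have "V - V' = (\<integral>\<omega>. 2 * (T \<omega> * D \<omega>) - (D \<omega>)\<^sup>2 \<partial>M)"
      unfolding T2(2)[symmetric] V'_def using T2 T'2
      by (subst Bochner_Integration.integral_diff[symmetric]) (auto simp: D_def power2_eq_square algebra_simps)
    also have "\<dots> = 2 * (\<integral>\<omega>. T \<omega> * D \<omega> \<partial>M) - (\<integral>\<omega>. (D \<omega>)\<^sup>2 \<partial>M)"
      using TD D2 by simp
    finally have "\<bar>V - V'\<bar> \<le> 2 * \<bar>\<integral>\<omega>. T \<omega> * D \<omega> \<partial>M\<bar> + \<bar>\<integral>\<omega>. (D \<omega>)\<^sup>2 \<partial>M\<bar>" by linarith
    also have "\<dots> \<le> 2 * (sqrt w * sqrt (\<rho> m)) + \<rho> m"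
      using D2(2) order_trans[OF integral_abs_bound TD(2)] by (intro add_mono mult_left_mono) auto
    finally have VV': "\<bar>V - V'\<bar> \<le> 2 * sqrt w * sqrt (\<rho> m) + \<rho> m" by simp
    have p1: "cmod ((\<integral>\<omega>. iexp (u * T \<omega>) \<partial>M) - (\<integral>\<omega>. iexp (u * T' \<omega>) \<partial>M)) \<le> \<bar>u\<bar> * sqrt (\<rho> m)"
    proof -
      have ii: "integrable M (\<lambda>\<omega>. iexp (u * f \<omega>))" if "f \<in> borel_measurable M" for f :: "'a \<Rightarrow> real"
        by (rule integrable_iexp) (use that in auto)
      have "(\<integral>\<omega>. iexp (u * T \<omega>) \<partial>M) - (\<integral>\<omega>. iexp (u * T' \<omega>) \<partial>M)
        = (\<integral>\<omega>. iexp (u * T \<omega>) - iexp (u * T' \<omega>) \<partial>M)"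
        by (rule Bochner_Integration.integral_diff[symmetric]; rule ii; measurable)
      also have "cmod \<dots> \<le> (\<integral>\<omega>. \<bar>u\<bar> * \<bar>D \<omega>\<bar> \<partial>M)"
      proof (rule norm_integral_le_integral)
        show "integrable M (\<lambda>\<omega>. \<bar>u\<bar> * \<bar>D \<omega>\<bar>)" using absD by simp
        show "cmod (iexp (u * T \<omega>) - iexp (u * T' \<omega>)) \<le> \<bar>u\<bar> * \<bar>D \<omega>\<bar>" for \<omega>
          using cmod_iexp_diff_le[of "u * T \<omega>" "u * T' \<omega>"] by (simp add: D_def abs_mult flip: right_diff_distrib)
      qed
      also have "\<dots> \<le> \<bar>u\<bar> * sqrt (\<rho> m)" using absD(2) by (simp add: mult_left_mono)
      finally show ?thesis .
    qed
    have p2: "cmod ((\<integral>\<omega>. iexp (u * T' \<omega>) \<partial>M) - of_real (exp (- (u\<^sup>2 * V' / 2)))) \<le> K / sqrt P"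
    proof -
      have "cmod ((\<integral>\<omega>. iexp (u / sqrt P * (\<Sum>a\<in>A. Zc m a \<omega>)) \<partial>M)
        - of_real (exp (- ((u / sqrt P)\<^sup>2 * (\<integral>\<omega>. (\<Sum>a\<in>A. Zc m a \<omega>)\<^sup>2 \<partial>M) / 2))))
        \<le> 38 * c\<^sup>2 * (real m)\<^sup>2 * real (card A) * \<bar>u / sqrt P\<bar> ^ 3"
        by (rule m_dependent_char_bound[OF fin _ i3 _ _ c _ m Zc_indep[OF _ m]])
          (use m2 m1 centered in auto)
      also have "38 * c\<^sup>2 * (real m)\<^sup>2 * real (card A) * \<bar>u / sqrt P\<bar> ^ 3 = K / sqrt P"
        using P(1) by (simp add: K_def P_def[symmetric] power3_eq_cube field_simps)
      finally show ?thesis using P(1) by (simp add: T'_def V'_def power_divide)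
    qed
    have p3: "cmod (of_real (exp (- (u\<^sup>2 * V' / 2))) - of_real (exp (- (u\<^sup>2 * V / 2))))
      \<le> u\<^sup>2 / 2 * (2 * sqrt w * sqrt (\<rho> m) + \<rho> m)"
    proof -
      have "cmod (of_real (exp (- (u\<^sup>2 * V' / 2))) - of_real (exp (- (u\<^sup>2 * V / 2))))
        \<le> \<bar>u\<^sup>2 * V' / 2 - u\<^sup>2 * V / 2\<bar>"
        using \<open>0 \<le> V\<close> \<open>0 \<le> V'\<close> by (intro exp_neg_lipschitz) auto
      also have "\<dots> = u\<^sup>2 / 2 * \<bar>V - V'\<bar>"
        by (simp add: abs_mult abs_minus_commute flip: right_diff_distrib diff_divide_distrib)
      also have "\<dots> \<le> u\<^sup>2 / 2 * (2 * sqrt w * sqrt (\<rho> m) + \<rho> m)"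
        by (intro mult_left_mono VV') auto
      finally show ?thesis .
    qed
    have "cmod ((\<integral>\<omega>. iexp (u * T \<omega>) \<partial>M) - of_real (exp (- (u\<^sup>2 * V / 2))))
      \<le> \<bar>u\<bar> * sqrt (\<rho> m) + K / sqrt P + u\<^sup>2 / 2 * (2 * sqrt w * sqrt (\<rho> m) + \<rho> m)"
    proof -
      have "cmod (a - d) \<le> cmod (a - b) + cmod (b - c) + cmod (c - d)" for a b c d :: complex
        using norm_triangle_ineq[of "a - b" "b - c"] norm_triangle_ineq[of "a - c" "c - d"] by simp
      from this[of "\<integral>\<omega>. iexp (u * T \<omega>) \<partial>M" "of_real (exp (- (u\<^sup>2 * V / 2)))"
          "\<integral>\<omega>. iexp (u * T' \<omega>) \<partial>M" "of_real (exp (- (u\<^sup>2 * V' / 2)))"] p1 p2 p3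
      show ?thesis by linarith
    qed
    also have "\<dots> \<le> \<eta>" using errm P(2) unfolding err_def by linarith
    finally show "cmod ((\<integral>\<omega>. iexp (u * ((\<Sum>n\<in>A. Z n \<omega>) / sqrt (real (card A)))) \<partial>M) - of_real (exp (- (u\<^sup>2 * V / 2)))) \<le> \<eta>"
      unfolding T_def P_def .
  qed
qed

end

section \<open>Marginals of a weakly dependent process\<close>

lemma ennpowr_supnorm_ge:
  assumes "u \<in> time_domain" "0 < p"
  shows "ennreal (\<bar>x u\<bar> powr p) \<le> ennpowr (supnorm x) p"
proof (cases "supnorm x = \<top>")
  case False
  have le: "ennreal \<bar>x u\<bar> \<le> supnorm x"
    unfolding supnorm_def using assms(1) by (intro SUP_upper)
  then have "\<bar>x u\<bar> \<le> enn2real (supnorm x)"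
    using False enn2real_mono[OF le] by (simp add: top.not_eq_extremum)
  then show ?thesis
    using False assms(2) by (simp add: ennpowr_def powr_mono2 ennreal_leI)
qed (simp add: ennpowr_def)

lemma nn_integral_powr_le_nu:
  assumes "0 < p" "0 \<le> a" "nu M p Z \<le> ennreal a"
  shows "(\<integral>\<^sup>+\<omega>. ennpowr (Z \<omega>) p \<partial>M) \<le> ennreal (a powr p)"
proof -
  let ?I = "\<integral>\<^sup>+\<omega>. ennpowr (Z \<omega>) p \<partial>M"
  have fin: "?I \<noteq> \<top>" using assms(3) by (auto simp: nu_def ennpowr_def[of "\<top>"] top_unique)
  then have "enn2real ?I powr (1 / p) \<le> a"
    using assms by (simp add: nu_def ennpowr_def)
  then have "(enn2real ?I powr (1 / p)) powr p \<le> a powr p"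
    using assms(1) by (intro powr_mono2) auto
  then have "enn2real ?I \<le> a powr p"
    using assms(1) by (simp add: powr_powr)
  then show ?thesis using fin by (metis ennreal_enn2real ennreal_leI top.not_eq_extremum)
qed

lemma integrable_from_powr:
  fixes Y :: "'a \<Rightarrow> real"
  assumes [measurable]: "Y \<in> borel_measurable M"
    and fin: "(\<integral>\<^sup>+\<omega>. ennreal (\<bar>Y \<omega>\<bar> powr p) \<partial>M) < \<top>"
  shows "integrable M (\<lambda>\<omega>. \<bar>Y \<omega>\<bar> powr p)"
  by (rule integrableI_bounded) (use fin in auto)

context
  fixes Pr :: "'a measure" and X :: "int \<Rightarrow> 'a \<Rightarrow> real \<Rightarrow> real"
    and p :: real and S :: "'s measure" and f :: "(nat \<Rightarrow> 's) \<Rightarrow> real \<Rightarrow> real"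
    and \<xi> :: "int \<Rightarrow> 'a \<Rightarrow> 's" and \<xi>' :: "int \<Rightarrow> int \<Rightarrow> 'a \<Rightarrow> 's" and t :: real
  assumes prob: "prob_space Pr" and dep: "weakly_dependent Pr X p S f \<xi> \<xi>'"
    and Xm: "\<And>n. (\<lambda>\<omega>. X n \<omega> t) \<in> borel_measurable Pr"
    and t: "t \<in> time_domain"
begin

interpretation prob_space Pr by (rule prob)

abbreviation (input) "mean_t \<equiv> mean_fun Pr X t"

lemma causal_functional_at: "causal_functional Pr S \<xi> \<xi>' (\<lambda>s. f s t - mean_t)"
proof
  show "indep_vars (\<lambda>_. S) (innovation \<xi> \<xi>') UNIV"
    using dep by (simp add: weakly_dependent_def innovation_def)
  show "distr Pr S (innovation \<xi> \<xi>' j) = distr Pr S (\<xi> 0)" for j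
    using dep by (auto simp: weakly_dependent_def innovation_def split: sum.split)
  show "(\<lambda>s. f s t - mean_t) \<in> borel_measurable (Pi\<^sub>M UNIV (\<lambda>_. S))"
    using dep t by (intro borel_measurable_diff) (auto simp: weakly_dependent_def)
qed

interpretation causal_functional Pr S \<xi> \<xi>' "\<lambda>s. f s t - mean_t"
  by (rule causal_functional_at)

lemma Z_AE: "AE \<omega> in Pr. X n \<omega> t - mean_t = Z n \<omega>"
proof -
  have "AE \<omega> in Pr. \<forall>u\<in>time_domain. X n \<omega> u = f (\<lambda>k. \<xi> (n - int k) \<omega>) u"
    using dep by (simp add: weakly_dependent_def)
  then show ?thesis by eventually_elim (use t in \<open>auto simp: Z_def\<close>)
qed

lemma p_ge: "4 \<le> p" using dep by (simp add: weakly_dependent_def)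

text \<open>The sup norm is not known to be measurable, but the nonnegative integral is monotone
  without measurability, which is enough to pass to the value at \<open>t\<close>.\<close>

lemma X_moment: "integrable Pr (\<lambda>\<omega>. \<bar>X n \<omega> t\<bar> powr p)"
proof (rule integrable_from_powr[OF Xm])
  have "nu Pr p (\<lambda>\<omega>. supnorm (X n \<omega>)) < \<top>"
    using dep by (simp add: weakly_dependent_def)
  then obtain a where "0 \<le> a" "nu Pr p (\<lambda>\<omega>. supnorm (X n \<omega>)) \<le> ennreal a"
    by (cases "nu Pr p (\<lambda>\<omega>. supnorm (X n \<omega>))") auto
  then have "(\<integral>\<^sup>+\<omega>. ennpowr (supnorm (X n \<omega>)) p \<partial>Pr) \<le> ennreal (a powr p)"
    using p_ge by (intro nn_integral_powr_le_nu) auto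
  moreover have "(\<integral>\<^sup>+\<omega>. ennreal (\<bar>X n \<omega> t\<bar> powr p) \<partial>Pr) \<le> (\<integral>\<^sup>+\<omega>. ennpowr (supnorm (X n \<omega>)) p \<partial>Pr)"
    using p_ge t by (intro nn_integral_mono ennpowr_supnorm_ge) auto
  ultimately show "(\<integral>\<^sup>+\<omega>. ennreal (\<bar>X n \<omega> t\<bar> powr p) \<partial>Pr) < \<top>"
    using ennreal_less_top order.strict_trans1 order_trans by meson
qed

lemma power_le_one_plus_powr:
  fixes x :: real assumes "0 \<le> x" "real k \<le> p"
  shows "x ^ k \<le> 1 + x powr p"
proof (cases "x \<le> 1")
  case True
  then have "x ^ k \<le> 1" using assms by (simp add: power_le_one)
  then show ?thesis by (simp add: add_increasing2)
next
  case False
  then have "x ^ k = x powr real k" by (simp add: powr_realpow)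
  also have "\<dots> \<le> x powr p" using False assms by (intro powr_mono) auto
  finally show ?thesis by simp
qed

lemma Z_moments:
  "integrable Pr (\<lambda>\<omega>. \<bar>Z 0 \<omega>\<bar> ^ 3)" "integrable Pr (\<lambda>\<omega>. \<bar>Z 0 \<omega>\<bar> ^ 2)" "(\<integral>\<omega>. Z 0 \<omega> \<partial>Pr) = 0"
proof -
  have ik: "integrable Pr (\<lambda>\<omega>. \<bar>X 0 \<omega> t\<bar> ^ k)" if "real k \<le> p" for k
  proof (rule integrable_nonneg_le)
    show "integrable Pr (\<lambda>\<omega>. 1 + \<bar>X 0 \<omega> t\<bar> powr p)" using X_moment[of 0] by simp
    show "(\<lambda>\<omega>. \<bar>X 0 \<omega> t\<bar> ^ k) \<in> borel_measurable Pr" using Xm[of 0] by measurable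
  qed (use that power_le_one_plus_powr in auto)
  have iX: "integrable Pr (\<lambda>\<omega>. X 0 \<omega> t)"
    using ik[of 1] p_ge Xm[of 0] by (subst integrable_abs_iff[symmetric]) auto
  have "(\<integral>\<omega>. Z 0 \<omega> \<partial>Pr) = (\<integral>\<omega>. X 0 \<omega> t - mean_t \<partial>Pr)"
    by (rule integral_cong_AE) (use Z_AE[of 0] Xm[of 0] in auto)
  also have "\<dots> = 0" using iX by (simp add: prob_space mean_fun_def)
  finally show "(\<integral>\<omega>. Z 0 \<omega> \<partial>Pr) = 0" .
  have bd: "\<bar>x - m\<bar> ^ k \<le> 2 ^ k * (\<bar>x\<bar> ^ k + \<bar>m\<bar> ^ k)" for x m :: real and k
  proof -
    have "\<bar>x - m\<bar> ^ k \<le> (2 * max \<bar>x\<bar> \<bar>m\<bar>) ^ k" by (rule power_mono) auto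
    also have "\<dots> \<le> 2 ^ k * (\<bar>x\<bar> ^ k + \<bar>m\<bar> ^ k)"
      by (auto simp: power_mult_distrib max_def)
    finally show ?thesis .
  qed
  have "integrable Pr (\<lambda>\<omega>. \<bar>X 0 \<omega> t - mean_t\<bar> ^ k)" if "real k \<le> p" for k
  proof (rule integrable_nonneg_le)
    show "integrable Pr (\<lambda>\<omega>. 2 ^ k * (\<bar>X 0 \<omega> t\<bar> ^ k + \<bar>mean_t\<bar> ^ k))" using ik[OF that] by simp
    show "(\<lambda>\<omega>. \<bar>X 0 \<omega> t - mean_t\<bar> ^ k) \<in> borel_measurable Pr" using Xm[of 0] by measurable
  qed (use bd in auto)
  note iXk = this
  have "integrable Pr (\<lambda>\<omega>. \<bar>Z 0 \<omega>\<bar> ^ k)" if "real k \<le> p" for k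
    by (rule integrable_cong_AE_imp[OF iXk[OF that]]) (use Z_AE[of 0] in auto)
  from this[of 3] this[of 2] show "integrable Pr (\<lambda>\<omega>. \<bar>Z 0 \<omega>\<bar> ^ 3)" "integrable Pr (\<lambda>\<omega>. \<bar>Z 0 \<omega>\<bar> ^ 2)"
    using p_ge by auto
qed

text \<open>The second moment is compared with the p-th through y^2 <= 1 + y^p at y = |D| / a, where
  \<open>a\<close> is the coupling bound; this yields E D^2 <= 2 a^2. The rate \<alpha> > 3/2 makes
  k^(- \<alpha>) summable and sends k^(1 - 2 \<alpha>) to 0.\<close>

lemma coupling_rate:
  obtains \<delta> where "\<And>k. 1 \<le> k \<Longrightarrow> (\<integral>\<omega>. (Z (int k) \<omega> - Zc k (int k) \<omega>)\<^sup>2 \<partial>Pr) \<le> (\<delta> k)\<^sup>2"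
    "\<And>k. 0 \<le> \<delta> k" "summable \<delta>" "(\<lambda>k. real k * (\<delta> k)\<^sup>2) \<longlonglongrightarrow> 0"
proof -
  obtain c \<alpha> where c: "0 < c" and \<alpha>: "3 / 2 < \<alpha>" and
    nu_le: "\<And>m. 1 \<le> m \<Longrightarrow> nu Pr p (\<lambda>\<omega>. supnorm (\<lambda>u. X (int m) \<omega> u - coupled_version f \<xi> \<xi>' (int m) m \<omega> u))
       \<le> ennreal (c * real m powr - \<alpha>)"
    using dep unfolding weakly_dependent_def by blast
  \<comment> \<open>The factor 2 leaves room for the constant: 2 a^2 <= (2 a)^2.\<close>
  define \<delta> where "\<delta> k = 2 * c * real k powr - \<alpha>" for k
  show thesis
  proof (rule that)
    show "0 \<le> \<delta> k" for k using c by (simp add: \<delta>_def)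
    show "summable \<delta>"
      unfolding \<delta>_def by (intro summable_mult) (use \<alpha> in \<open>simp add: summable_real_powr_iff\<close>)
    have "(\<lambda>k. 4 * c\<^sup>2 * real k powr (1 - 2 * \<alpha>)) \<longlonglongrightarrow> 4 * c\<^sup>2 * 0"
      by (intro tendsto_mult tendsto_const tendsto_neg_powr filterlim_real_sequentially) (use \<alpha> in simp)
    moreover have "4 * c\<^sup>2 * real k powr (1 - 2 * \<alpha>) = real k * (\<delta> k)\<^sup>2" for k
    proof (cases "k = 0")
      case False
      then have "real k powr (1 - 2 * \<alpha>) = real k powr 1 * (real k powr - \<alpha> * real k powr - \<alpha>)"
        by (simp only: powr_add[symmetric]) simp
      then show ?thesis using False by (simp add: \<delta>_def power2_eq_square)
    qed (simp add: \<delta>_def)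
    ultimately show "(\<lambda>k. real k * (\<delta> k)\<^sup>2) \<longlonglongrightarrow> 0" by simp
  next
    fix k :: nat assume k: "1 \<le> k"
    define a where "a = c * real k powr - \<alpha>"
    define D where "D \<omega> = Z (int k) \<omega> - Zc k (int k) \<omega>" for \<omega>
    have a: "0 < a" using c k by (simp add: a_def)
    have [measurable]: "D \<in> borel_measurable Pr" by (simp add: D_def[abs_def])
    have D_eq: "AE \<omega> in Pr. D \<omega> = X (int k) \<omega> t - coupled_version f \<xi> \<xi>' (int k) k \<omega> t"
      using Z_AE[of "int k"] by eventually_elim (auto simp: D_def Zc_def coupled_version_def)
    have "(\<integral>\<^sup>+\<omega>. ennreal (\<bar>D \<omega>\<bar> powr p) \<partial>Pr)
      \<le> (\<integral>\<^sup>+\<omega>. ennpowr (supnorm (\<lambda>u. X (int k) \<omega> u - coupled_version f \<xi> \<xi>' (int k) k \<omega> u)) p \<partial>Pr)"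
    proof (rule nn_integral_mono_AE)
      show "AE \<omega> in Pr. ennreal (\<bar>D \<omega>\<bar> powr p)
        \<le> ennpowr (supnorm (\<lambda>u. X (int k) \<omega> u - coupled_version f \<xi> \<xi>' (int k) k \<omega> u)) p"
        using D_eq
      proof eventually_elim
        case (elim \<omega>)
        then show ?case
          using ennpowr_supnorm_ge[OF t, of p "\<lambda>u. X (int k) \<omega> u - coupled_version f \<xi> \<xi>' (int k) k \<omega> u"] p_ge
          by simp
      qed
    qed
    also have "\<dots> \<le> ennreal (a powr p)"
      unfolding a_def by (rule nn_integral_powr_le_nu) (use nu_le[OF k] p_ge c in auto)
    finally have I: "(\<integral>\<^sup>+\<omega>. ennreal (\<bar>D \<omega>\<bar> powr p) \<partial>Pr) \<le> ennreal (a powr p)" .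
    then have iD: "integrable Pr (\<lambda>\<omega>. \<bar>D \<omega>\<bar> powr p)"
      by (intro integrable_from_powr) (auto intro: order.strict_trans1)
    have ED: "(\<integral>\<omega>. \<bar>D \<omega>\<bar> powr p \<partial>Pr) \<le> a powr p"
      using I nn_integral_eq_integral[OF iD] by (simp add: ennreal_le_iff)
    have bd: "(D \<omega>)\<^sup>2 \<le> a\<^sup>2 * (1 + \<bar>D \<omega>\<bar> powr p / a powr p)" for \<omega>
    proof -
      have "(\<bar>D \<omega>\<bar> / a)\<^sup>2 \<le> 1 + (\<bar>D \<omega>\<bar> / a) powr p"
        using a p_ge by (intro power_le_one_plus_powr) auto
      then have "a\<^sup>2 * (\<bar>D \<omega>\<bar> / a)\<^sup>2 \<le> a\<^sup>2 * (1 + \<bar>D \<omega>\<bar> powr p / a powr p)"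
        using a by (intro mult_left_mono) (auto simp: powr_divide)
      then show ?thesis using a by (simp add: power_divide)
    qed
    have ib: "integrable Pr (\<lambda>\<omega>. a\<^sup>2 * (1 + \<bar>D \<omega>\<bar> powr p / a powr p))" using iD by simp
    have "(\<integral>\<omega>. (D \<omega>)\<^sup>2 \<partial>Pr) \<le> (\<integral>\<omega>. a\<^sup>2 * (1 + \<bar>D \<omega>\<bar> powr p / a powr p) \<partial>Pr)"
      by (rule integral_mono'[OF ib bd]) (use a in \<open>auto intro!: mult_nonneg_nonneg add_nonneg_nonneg\<close>)
    also have "\<dots> = a\<^sup>2 * (1 + (\<integral>\<omega>. \<bar>D \<omega>\<bar> powr p \<partial>Pr) / a powr p)"
      using iD by (simp add: prob_space)
    also have "\<dots> \<le> a\<^sup>2 * (1 + 1)"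
      using ED a by (intro mult_left_mono add_left_mono) (auto simp: divide_le_eq)
    also have "\<dots> \<le> (\<delta> k)\<^sup>2" by (simp add: \<delta>_def a_def power_mult_distrib)
    finally show "(\<integral>\<omega>. (Z (int k) \<omega> - Zc k (int k) \<omega>)\<^sup>2 \<partial>Pr) \<le> (\<delta> k)\<^sup>2" by (simp add: D_def)
  qed
qed

lemma weakly_dependent_moments:
  "integrable Pr (\<lambda>\<omega>. (X n \<omega> t - mean_t)\<^sup>2)" "integrable Pr (\<lambda>\<omega>. X n \<omega> t - mean_t)"
  "(\<integral>\<omega>. X n \<omega> t - mean_t \<partial>Pr) = 0"
proof -
  have i2: "integrable Pr (\<lambda>\<omega>. (Z 0 \<omega>)\<^sup>2)" using Z_moments(2) by simp
  have i1: "integrable Pr (Z 0)" using square_integrable_imp_integrable[OF _ i2] by simp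
  have [measurable]: "(\<lambda>\<omega>. X n \<omega> t) \<in> borel_measurable Pr" by (rule Xm)
  show "integrable Pr (\<lambda>\<omega>. (X n \<omega> t - mean_t)\<^sup>2)"
    by (rule integrable_cong_AE_imp[OF diff_second_moment(1)[OF i2, of n]]) (use Z_AE[of n] in auto)
  show "integrable Pr (\<lambda>\<omega>. X n \<omega> t - mean_t)"
    by (rule integrable_cong_AE_imp[OF Zc_zero_mean_diff(1)[OF i1, of n]]) (use Z_AE[of n] in auto)
  have "(\<integral>\<omega>. X n \<omega> t - mean_t \<partial>Pr) = (\<integral>\<omega>. Z n \<omega> \<partial>Pr)"
    by (rule integral_cong_AE) (use Z_AE[of n] in auto)
  then show "(\<integral>\<omega>. X n \<omega> t - mean_t \<partial>Pr) = 0"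
    using Zc_zero_mean_diff(5)[OF i1, of n] Z_moments(3) by simp
qed

theorem weakly_dependent_uniform_clt:
  assumes "0 < \<eta>"
  shows "\<exists>P0. \<forall>A V. finite A \<longrightarrow> P0 \<le> card A \<longrightarrow>
      V = (\<integral>\<omega>. (\<Sum>n\<in>A. X n \<omega> t - mean_t)\<^sup>2 \<partial>Pr) / real (card A) \<longrightarrow> V \<le> v0 \<longrightarrow>
    cmod ((\<integral>\<omega>. iexp (u * ((\<Sum>n\<in>A. X n \<omega> t - mean_t) / sqrt (real (card A)))) \<partial>Pr)
      - of_real (exp (- (u\<^sup>2 * V / 2)))) \<le> \<eta>"
proof -
  have [measurable]: "(\<lambda>\<omega>. X n \<omega> t) \<in> borel_measurable Pr" for n by (rule Xm)
  obtain \<delta> where \<delta>: "\<And>k. 1 \<le> k \<Longrightarrow> (\<integral>\<omega>. (Z (int k) \<omega> - Zc k (int k) \<omega>)\<^sup>2 \<partial>Pr) \<le> (\<delta> k)\<^sup>2"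
    "\<And>k. 0 \<le> \<delta> k" "summable \<delta>" "(\<lambda>k. real k * (\<delta> k)\<^sup>2) \<longlonglongrightarrow> 0"
    by (rule coupling_rate) blast
  have sum_AE: "AE \<omega> in Pr. (\<Sum>n\<in>A. X n \<omega> t - mean_t) = (\<Sum>n\<in>A. Z n \<omega>)" if "finite A" for A
  proof -
    have "AE \<omega> in Pr. \<forall>n\<in>A. X n \<omega> t - mean_t = Z n \<omega>"
      using that Z_AE by (intro AE_finite_allI) auto
    then show ?thesis by eventually_elim (auto intro: sum.cong)
  qed
  have e1: "(\<integral>\<omega>. (\<Sum>n\<in>A. X n \<omega> t - mean_t)\<^sup>2 \<partial>Pr) = (\<integral>\<omega>. (\<Sum>n\<in>A. Z n \<omega>)\<^sup>2 \<partial>Pr)" if "finite A" for A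
    by (rule integral_cong_AE) (use sum_AE[OF that] in auto)
  have e2: "(\<integral>\<omega>. iexp (u * ((\<Sum>n\<in>A. X n \<omega> t - mean_t) / sqrt (real (card A)))) \<partial>Pr)
      = (\<integral>\<omega>. iexp (u * ((\<Sum>n\<in>A. Z n \<omega>) / sqrt (real (card A)))) \<partial>Pr)" if "finite A" for A
  proof (rule integral_cong_AE)
    show "AE \<omega> in Pr. iexp (u * ((\<Sum>n\<in>A. X n \<omega> t - mean_t) / sqrt (real (card A))))
        = iexp (u * ((\<Sum>n\<in>A. Z n \<omega>) / sqrt (real (card A))))"
      using sum_AE[OF that] by eventually_elim (simp only:)
  qed measurable
  obtain P0 where P0: "\<And>A V. finite A \<Longrightarrow> P0 \<le> card A \<Longrightarrow>
      V = (\<integral>\<omega>. (\<Sum>n\<in>A. Z n \<omega>)\<^sup>2 \<partial>Pr) / real (card A) \<Longrightarrow> V \<le> v0 \<Longrightarrow>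
    cmod ((\<integral>\<omega>. iexp (u * ((\<Sum>n\<in>A. Z n \<omega>) / sqrt (real (card A)))) \<partial>Pr)
      - of_real (exp (- (u\<^sup>2 * V / 2)))) \<le> \<eta>"
    using uniform_clt[OF Z_moments(1,3) \<delta> assms, of v0 u] by blast
  show ?thesis
  proof (intro exI[of _ P0] allI impI)
    fix A :: "int set" and V
    assume A: "finite A" "P0 \<le> card A" "V = (\<integral>\<omega>. (\<Sum>n\<in>A. X n \<omega> t - mean_t)\<^sup>2 \<partial>Pr) / real (card A)" "V \<le> v0"
    show "cmod ((\<integral>\<omega>. iexp (u * ((\<Sum>n\<in>A. X n \<omega> t - mean_t) / sqrt (real (card A)))) \<partial>Pr)
      - of_real (exp (- (u\<^sup>2 * V / 2)))) \<le> \<eta>"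
      unfolding e2[OF A(1)] by (rule P0[OF A(1,2) _ A(4)]) (simp only: A(3) e1[OF A(1)])
  qed
qed

end

section \<open>Independence of the design and the responses\<close>

text \<open>Independence enters through preimages, so that the two variables may take values in
  different types, as the design and the responses do.\<close>

lemma (in prob_space) distr_pair_indep:
  assumes U: "U \<in> measurable M N1" and V: "V \<in> measurable M N2"
    and ind: "\<And>A B. A \<in> sets N1 \<Longrightarrow> B \<in> sets N2 \<Longrightarrow>
      prob ((U -` A \<inter> space M) \<inter> (V -` B \<inter> space M)) = prob (U -` A \<inter> space M) * prob (V -` B \<inter> space M)"
  shows "distr M N1 U \<Otimes>\<^sub>M distr M N2 V = distr M (N1 \<Otimes>\<^sub>M N2) (\<lambda>\<omega>. (U \<omega>, V \<omega>))"
proof -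
  interpret U: prob_space "distr M N1 U" by (rule prob_space_distr[OF U])
  interpret V: prob_space "distr M N2 V" by (rule prob_space_distr[OF V])
  show ?thesis
  proof (rule pair_measure_eqI)
    show "sigma_finite_measure (distr M N1 U)" "sigma_finite_measure (distr M N2 V)"
      by (rule U.sigma_finite_measure_axioms V.sigma_finite_measure_axioms)+
    show "sets (distr M N1 U \<Otimes>\<^sub>M distr M N2 V) = sets (distr M (N1 \<Otimes>\<^sub>M N2) (\<lambda>\<omega>. (U \<omega>, V \<omega>)))"
      by (simp cong: sets_pair_measure_cong)
    fix A B assume "A \<in> sets (distr M N1 U)" "B \<in> sets (distr M N2 V)"
    then have AB: "A \<in> sets N1" "B \<in> sets N2" by auto
    have "(\<lambda>\<omega>. (U \<omega>, V \<omega>)) -` (A \<times> B) \<inter> space M = (U -` A \<inter> space M) \<inter> (V -` B \<inter> space M)" by auto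
    then show "emeasure (distr M N1 U) A * emeasure (distr M N2 V) B
      = emeasure (distr M (N1 \<Otimes>\<^sub>M N2) (\<lambda>\<omega>. (U \<omega>, V \<omega>))) (A \<times> B)"
      using AB U V ind[OF AB]
      by (simp add: emeasure_distr measurable_Pair emeasure_eq_measure ennreal_mult'')
  qed
qed

text \<open>Fubini for the joint law, pulled back to the probability space:
  \<open>U \<omega>\<close> is frozen and \<open>V\<close> is integrated over a second variable
  \<open>\<omega>'\<close>. This takes the part of conditioning on \<open>U\<close>.\<close>

lemma (in prob_space) integral_indep_pair:
  fixes F :: "'b \<times> 'c \<Rightarrow> 'd :: {banach, second_countable_topology}"
  assumes U: "U \<in> measurable M N1" and V: "V \<in> measurable M N2"
    and ind: "\<And>A B. A \<in> sets N1 \<Longrightarrow> B \<in> sets N2 \<Longrightarrow>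
      prob ((U -` A \<inter> space M) \<inter> (V -` B \<inter> space M)) = prob (U -` A \<inter> space M) * prob (V -` B \<inter> space M)"
    and F: "F \<in> borel_measurable (N1 \<Otimes>\<^sub>M N2)" and int: "integrable M (\<lambda>\<omega>. F (U \<omega>, V \<omega>))"
  shows "(\<integral>\<omega>. F (U \<omega>, V \<omega>) \<partial>M) = (\<integral>\<omega>. (\<integral>\<omega>'. F (U \<omega>, V \<omega>') \<partial>M) \<partial>M)"
    "(\<lambda>\<omega>. \<integral>\<omega>'. F (U \<omega>, V \<omega>') \<partial>M) \<in> borel_measurable M"
proof -
  have eq: "distr M N1 U \<Otimes>\<^sub>M distr M N2 V = distr M (N1 \<Otimes>\<^sub>M N2) (\<lambda>\<omega>. (U \<omega>, V \<omega>))"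
    by (rule distr_pair_indep[OF U V]) (rule ind)
  interpret U: prob_space "distr M N1 U" by (rule prob_space_distr[OF U])
  interpret V: prob_space "distr M N2 V" by (rule prob_space_distr[OF V])
  interpret UV: pair_sigma_finite "distr M N1 U" "distr M N2 V" ..
  have UVm: "(\<lambda>\<omega>. (U \<omega>, V \<omega>)) \<in> measurable M (N1 \<Otimes>\<^sub>M N2)" using U V by measurable
  have F': "F \<in> borel_measurable (distr M N1 U \<Otimes>\<^sub>M distr M N2 V)"
    using F by (simp cong: measurable_cong_sets sets_pair_measure_cong)
  have iF: "integrable (distr M N1 U \<Otimes>\<^sub>M distr M N2 V) F"
    unfolding eq using int by (simp add: integrable_distr_eq[OF UVm F])
  have inner: "(\<integral>y. F (x, y) \<partial>distr M N2 V) = (\<integral>\<omega>'. F (x, V \<omega>') \<partial>M)" if "x \<in> space N1" for x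
  proof -
    have "(\<lambda>y. F (x, y)) \<in> borel_measurable N2"
      using measurable_compose[OF measurable_Pair1'[OF that] F] .
    then show ?thesis by (rule integral_distr[OF V])
  qed
  have m1: "(\<lambda>x. \<integral>y. F (x, y) \<partial>distr M N2 V) \<in> borel_measurable N1"
    using V.borel_measurable_lebesgue_integral[of "\<lambda>x y. F (x, y)" "distr M N1 U"] F' by simp
  have Us: "U \<omega> \<in> space N1" if "\<omega> \<in> space M" for \<omega> using measurable_space[OF U that] .
  have m2: "(\<lambda>\<omega>. \<integral>y. F (U \<omega>, y) \<partial>distr M N2 V) \<in> borel_measurable M"
    using measurable_compose[OF U m1] .
  then show "(\<lambda>\<omega>. \<integral>\<omega>'. F (U \<omega>, V \<omega>') \<partial>M) \<in> borel_measurable M"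
    by (subst measurable_cong[where g = "\<lambda>\<omega>. \<integral>y. F (U \<omega>, y) \<partial>distr M N2 V"]) (simp_all add: inner Us)
  have "(\<integral>\<omega>. F (U \<omega>, V \<omega>) \<partial>M) = (\<integral>z. F z \<partial>(distr M N1 U \<Otimes>\<^sub>M distr M N2 V))"
    unfolding eq by (rule integral_distr[OF UVm F, symmetric])
  also have "\<dots> = (\<integral>x. (\<integral>y. F (x, y) \<partial>distr M N2 V) \<partial>distr M N1 U)"
    by (rule UV.integral_fst'[OF iF, symmetric])
  also have "\<dots> = (\<integral>\<omega>. (\<integral>y. F (U \<omega>, y) \<partial>distr M N2 V) \<partial>M)"
    by (rule integral_distr[OF U m1])
  also have "\<dots> = (\<integral>\<omega>. (\<integral>\<omega>'. F (U \<omega>, V \<omega>') \<partial>M) \<partial>M)"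
    by (rule Bochner_Integration.integral_cong) (simp_all add: inner Us)
  finally show "(\<integral>\<omega>. F (U \<omega>, V \<omega>) \<partial>M) = (\<integral>\<omega>. (\<integral>\<omega>'. F (U \<omega>, V \<omega>') \<partial>M) \<partial>M)" .
qed

section \<open>Sigma-algebras generated by groups of sources\<close>

context sampling_model
begin

text \<open>Once variables are known to be measurable for the algebras of their groups, their
  independence is the disjointness of the groups.\<close>

definition source_algebra :: "nat \<Rightarrow> source set \<Rightarrow> 'a measure" where
  "source_algebra N K = sigma (space Pr) (\<Union>j\<in>K. source_events Pr X (Mc N) T \<epsilon> j)"

lemma source_events_sigma: "sigma_algebra (space Pr) (source_events Pr X (Mc N) T \<epsilon> j)"
proof -
  have "sigma_algebra (space Pr) (sets (vimage_algebra (space Pr) Y M'))" for Y :: "'a \<Rightarrow> 'z" and M'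
    using sets.sigma_algebra_axioms[of "vimage_algebra (space Pr) Y M'"] by simp
  note * = this
  show ?thesis by (cases j) (simp_all add: *)
qed

lemma source_events_subset:
  assumes "1 \<le> N" "j \<in> sources N"
  shows "source_events Pr X (Mc N) T \<epsilon> j \<subseteq> sets Pr"
  using sources_indep[OF assms(1)] assms(2) by (auto simp: indep_sets_def)

lemma source_events_Pow: "source_events Pr X (Mc N) T \<epsilon> j \<subseteq> Pow (space Pr)"
  using source_events_sigma[of N j] by (simp add: sigma_algebra_iff2)

lemma space_source_algebra[simp]: "space (source_algebra N K) = space Pr"
  by (simp add: source_algebra_def space_measure_of_conv)

lemma sets_source_algebra:
  "sets (source_algebra N K) = sigma_sets (space Pr) (\<Union>j\<in>K. source_events Pr X (Mc N) T \<epsilon> j)"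
  unfolding source_algebra_def by (rule sets_measure_of) (use source_events_Pow in blast)

lemma source_algebra_subset:
  assumes "1 \<le> N" "K \<subseteq> sources N"
  shows "sets (source_algebra N K) \<subseteq> sets Pr"
  unfolding sets_source_algebra
  by (rule sets.sigma_sets_subset) (use source_events_subset[OF assms(1)] assms(2) in blast)

lemma measurable_source_algebra_Pr:
  assumes "1 \<le> N" "K \<subseteq> sources N" "f \<in> measurable (source_algebra N K) M'"
  shows "f \<in> measurable Pr M'"
proof -
  have "measurable (source_algebra N K) M' \<subseteq> measurable Pr M'"
    by (rule measurable_mono) (use source_algebra_subset[OF assms(1,2)] in auto)
  then show ?thesis using assms(3) by blast
qed

lemma measurable_source_algebraI:
  assumes "j \<in> K" "f \<in> space Pr \<rightarrow> space M'"
    "\<And>A. A \<in> sets M' \<Longrightarrow> f -` A \<inter> space Pr \<in> source_events Pr X (Mc N) T \<epsilon> j"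
  shows "f \<in> measurable (source_algebra N K) M'"
  by (rule measurableI) (use assms in \<open>auto simp: sets_source_algebra intro!: sigma_sets.Basic\<close>)

lemma T_source: "Point n i \<in> K \<Longrightarrow> T n i \<in> borel_measurable (source_algebra N K)"
  by (rule measurable_source_algebraI) (auto intro!: in_vimage_algebra)

lemma eps_source: "Noise n i \<in> K \<Longrightarrow> \<epsilon> n i \<in> borel_measurable (source_algebra N K)"
  by (rule measurable_source_algebraI) (auto intro!: in_vimage_algebra)

lemma Mc_source: "Count n \<in> K \<Longrightarrow> Mc N n \<in> measurable (source_algebra N K) (count_space UNIV)"
  by (rule measurable_source_algebraI) (auto intro!: in_vimage_algebra)

lemma path_family_source:
  assumes "Process \<in> K"
  shows "path_family X \<in> measurable (source_algebra N K) path_family_space"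
  by (rule measurable_source_algebraI[OF assms])
    (auto intro!: in_vimage_algebra simp: path_family_def space_PiM)

lemma X_source:
  assumes "Process \<in> K" "u \<in> time_domain"
  shows "(\<lambda>\<omega>. X n \<omega> u) \<in> borel_measurable (source_algebra N K)"
proof -
  have "(\<lambda>\<omega>. path_family X \<omega> (n, u)) \<in> borel_measurable (source_algebra N K)"
    by (rule measurable_compose[OF path_family_source[OF assms(1)]]) (use assms(2) in auto)
  then show ?thesis using assms(2) by (simp add: path_family_def)
qed

text \<open>The events of a single source form a sigma-algebra and are stable under intersections,
  so independence extends to the algebras generated by disjoint groups.\<close>

lemma source_algebra_indep:
  assumes "1 \<le> N" "\<And>j. j \<in> J \<Longrightarrow> I j \<subseteq> sources N" "disjoint_family_on I J"
  shows "indep_sets (\<lambda>j. sets (source_algebra N (I j))) J"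
  unfolding sets_source_algebra
proof (rule indep_sets_collect_sigma)
  show "indep_sets (source_events Pr X (Mc N) T \<epsilon>) (\<Union>j\<in>J. I j)"
    by (rule indep_sets_mono_index[OF _ sources_indep[OF assms(1)]]) (use assms(2) in blast)
  show "Int_stable (source_events Pr X (Mc N) T \<epsilon> i)" for i
    by (cases i) (auto simp: Int_stable_def)
qed fact

lemma source_algebra_indep_vars:
  assumes "1 \<le> N" "\<And>j. j \<in> J \<Longrightarrow> I j \<subseteq> sources N" "disjoint_family_on I J"
    and Y: "\<And>j. j \<in> J \<Longrightarrow> Y j \<in> measurable (source_algebra N (I j)) (M' j)"
  shows "indep_vars M' Y J"
  unfolding indep_vars_def2
proof (intro conjI ballI)
  show "random_variable (M' j) (Y j)" if "j \<in> J" for j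
    by (rule measurable_source_algebra_Pr[OF assms(1) assms(2)[OF that] Y[OF that]])
  show "indep_sets (\<lambda>j. {Y j -` A \<inter> space Pr |A. A \<in> sets (M' j)}) J"
    by (rule indep_sets_mono_sets[OF source_algebra_indep[OF assms(1-3)]])
      (use measurable_sets[OF Y] in auto)
qed

lemma source_algebra_indep_var:
  fixes f f' :: "'a \<Rightarrow> 'b"
  assumes "1 \<le> N" "K1 \<subseteq> sources N" "K2 \<subseteq> sources N" "K1 \<inter> K2 = {}"
    "f \<in> measurable (source_algebra N K1) M1" "f' \<in> measurable (source_algebra N K2) M2"
  shows "indep_var M1 f M2 f'"
  unfolding indep_var_def
  by (rule source_algebra_indep_vars[where N = N and I = "case_bool K1 K2"])
    (use assms in \<open>auto split: bool.splits simp: disjoint_family_on_def\<close>)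

lemma source_algebra_prob_Int:
  assumes "1 \<le> N" "K1 \<subseteq> sources N" "K2 \<subseteq> sources N" "K1 \<inter> K2 = {}"
    "A \<in> sets (source_algebra N K1)" "B \<in> sets (source_algebra N K2)"
  shows "prob (A \<inter> B) = prob A * prob B"
proof -
  have "indep_sets (\<lambda>j. sets (source_algebra N (case_bool K1 K2 j))) UNIV"
    by (rule source_algebra_indep) (use assms in \<open>auto split: bool.splits simp: disjoint_family_on_def\<close>)
  from indep_setsD[OF this, of UNIV "case_bool A B"] assms(5,6)
  show ?thesis by (simp add: UNIV_bool Int_commute mult.commute split: bool.splits)
qed

section \<open>The design and the responses as two independent groups\<close>

definition design_sources :: "nat \<Rightarrow> source set" where
  "design_sources N = Count ` {1..N} \<union> {Point n i | n i. 1 \<le> n \<and> 1 \<le> i}"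

definition response_sources :: "source set" where
  "response_sources = {Process} \<union> {Noise n i | n i. 1 \<le> n \<and> 1 \<le> i}"

lemma design_response_sources:
  "design_sources N \<subseteq> sources N" "response_sources \<subseteq> sources N" "design_sources N \<inter> response_sources = {}"
  by (auto simp: design_sources_def response_sources_def sources_def)

definition design :: "nat \<Rightarrow> 'a \<Rightarrow> (nat \<Rightarrow> nat) \<times> (nat \<times> nat \<Rightarrow> real)" where
  "design N \<omega> = (count_record N (Mc N) \<omega>, array_record N (Mc N) T \<omega>)"

abbreviation design_space :: "nat \<Rightarrow> ((nat \<Rightarrow> nat) \<times> (nat \<times> nat \<Rightarrow> real)) measure" where
  "design_space N \<equiv> count_record_space N \<Otimes>\<^sub>M array_record_space N"

text \<open>Signal and noise involve the curves at \<open>t\<close> only. The paths at the random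
  points appear in the bias alone, which is treated by moments and not by freezing the
  design.\<close>

definition response :: "nat \<Rightarrow> real \<Rightarrow> 'a \<Rightarrow> (nat \<Rightarrow> real) \<times> (nat \<times> nat \<Rightarrow> real)" where
  "response N t \<omega> = (\<lambda>n\<in>{1..N}. X (int n) \<omega> t, \<lambda>(n, i)\<in>{1..N} \<times> {1..}. \<epsilon> n i \<omega>)"

abbreviation response_space :: "nat \<Rightarrow> ((nat \<Rightarrow> real) \<times> (nat \<times> nat \<Rightarrow> real)) measure" where
  "response_space N \<equiv> Pi\<^sub>M {1..N} (\<lambda>_. borel) \<Otimes>\<^sub>M array_record_space N"

lemma design_source: "design N \<in> measurable (source_algebra N (design_sources N)) (design_space N)"
proof -
  let ?A = "source_algebra N (design_sources N)"
  have Mc: "Mc N n \<in> measurable ?A (count_space UNIV)" if "n \<in> {1..N}" for n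
    by (rule Mc_source) (use that in \<open>auto simp: design_sources_def\<close>)
  have T: "T n i \<in> borel_measurable ?A" if "n \<in> {1..N}" "1 \<le> i" for n i
    by (rule T_source) (use that in \<open>auto simp: design_sources_def\<close>)
  have "(\<lambda>\<omega>. case x of (n, i) \<Rightarrow> if i \<le> Mc N n \<omega> then T n i \<omega> else 0) \<in> borel_measurable ?A"
    if "x \<in> {1..N} \<times> {1..}" for x
  proof -
    obtain n i where x: "x = (n, i)" by (cases x)
    have [measurable]: "Mc N n \<in> measurable ?A (count_space UNIV)" "T n i \<in> borel_measurable ?A"
      using that x Mc T by auto
    show ?thesis unfolding x prod.case by measurable
  qed
  then show ?thesis
    unfolding design_def[abs_def] count_record_def[abs_def] array_record_def[abs_def]
    by (intro measurable_Pair measurable_restrict Mc)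
qed

lemma response_source:
  assumes "t \<in> time_domain"
  shows "response N t \<in> measurable (source_algebra N response_sources) (response_space N)"
proof -
  have "(\<lambda>\<omega>. case x of (n, i) \<Rightarrow> \<epsilon> n i \<omega>) \<in> borel_measurable (source_algebra N response_sources)"
    if "x \<in> {1..N} \<times> {1..}" for x
    using that by (auto intro!: eps_source simp: response_sources_def split: prod.splits)
  moreover have "(\<lambda>\<omega>. X (int n) \<omega> t) \<in> borel_measurable (source_algebra N response_sources)" for n
    by (rule X_source[OF _ assms]) (simp add: response_sources_def)
  ultimately show ?thesis
    unfolding response_def[abs_def] by (intro measurable_Pair measurable_restrict)
qed

lemma integral_design_response:
  fixes F :: "_ \<Rightarrow> 'd :: {banach, second_countable_topology}"
  assumes N: "1 \<le> N" and t: "t \<in> time_domain"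
    and F: "F \<in> borel_measurable (design_space N \<Otimes>\<^sub>M response_space N)"
    and int: "integrable Pr (\<lambda>\<omega>. F (design N \<omega>, response N t \<omega>))"
  shows "(\<integral>\<omega>. F (design N \<omega>, response N t \<omega>) \<partial>Pr) = (\<integral>\<omega>. (\<integral>\<omega>'. F (design N \<omega>, response N t \<omega>') \<partial>Pr) \<partial>Pr)"
    "(\<lambda>\<omega>. \<integral>\<omega>'. F (design N \<omega>, response N t \<omega>') \<partial>Pr) \<in> borel_measurable Pr"
proof -
  note ds = design_response_sources
  have ind: "prob ((design N -` A \<inter> space Pr) \<inter> (response N t -` B \<inter> space Pr))
      = prob (design N -` A \<inter> space Pr) * prob (response N t -` B \<inter> space Pr)"
    if "A \<in> sets (design_space N)" "B \<in> sets (response_space N)" for A B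
    by (rule source_algebra_prob_Int[OF N ds])
      (use measurable_sets[OF design_source that(1)] measurable_sets[OF response_source[OF t] that(2)] in auto)
  note * = measurable_source_algebra_Pr[OF N ds(1) design_source]
    measurable_source_algebra_Pr[OF N ds(2) response_source[OF t]]
  show "(\<integral>\<omega>. F (design N \<omega>, response N t \<omega>) \<partial>Pr) = (\<integral>\<omega>. (\<integral>\<omega>'. F (design N \<omega>, response N t \<omega>') \<partial>Pr) \<partial>Pr)"
    by (rule integral_indep_pair(1)[OF * _ F int]) (rule ind)
  show "(\<lambda>\<omega>. \<integral>\<omega>'. F (design N \<omega>, response N t \<omega>') \<partial>Pr) \<in> borel_measurable Pr"
    by (rule integral_indep_pair(2)[OF * _ F int]) (rule ind)
qed

lemma design_algebra_eq: "design_algebra Pr N (Mc N) T = vimage_algebra (space Pr) (design N) (design_space N)"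
  by (simp add: design_algebra_def design_def[abs_def])

lemma design_algebra_subset: "sets (design_algebra Pr N (Mc N) T) \<subseteq> sets (source_algebra N (design_sources N))"
  unfolding design_algebra_eq by (rule sets_image_in_sets) (use design_source in auto)

lemma design_algebra_subalgebra:
  assumes "1 \<le> N"
  shows "finite_measure_subalgebra Pr (design_algebra Pr N (Mc N) T)"
proof
  show "subalgebra Pr (design_algebra Pr N (Mc N) T)"
    using design_algebra_subset[of N] source_algebra_subset[OF assms design_response_sources(1)]
    by (auto simp: subalgebra_def design_algebra_eq)
qed

lemma design_algebra_measurable:
  assumes "f \<in> measurable (design_space N) M'"
  shows "(\<lambda>\<omega>. f (design N \<omega>)) \<in> measurable (design_algebra Pr N (Mc N) T) M'"
proof -
  have "design N \<in> measurable (design_algebra Pr N (Mc N) T) (design_space N)"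
    unfolding design_algebra_eq using measurable_space[OF design_source[of N]]
    by (intro measurable_vimage_algebra1) auto
  then show ?thesis using assms by (rule measurable_compose)
qed

text \<open>The conditional expectation is identified by its integrals over design events, and these
  factorise because the responses come from other sources.\<close>

lemma cond_exp_response:
  assumes N: "1 \<le> N" and Y: "Y \<in> borel_measurable (source_algebra N response_sources)" and int: "integrable Pr Y"
  shows "AE \<omega> in Pr. real_cond_exp Pr (design_algebra Pr N (Mc N) T) Y \<omega> = (\<integral>\<omega>. Y \<omega> \<partial>Pr)"
proof -
  interpret G: finite_measure_subalgebra Pr "design_algebra Pr N (Mc N) T"
    by (rule design_algebra_subalgebra[OF N])
  show ?thesis
  proof (rule G.real_cond_exp_charact)
    fix A assume A: "A \<in> sets (design_algebra Pr N (Mc N) T)"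
    then have A': "A \<in> sets (source_algebra N (design_sources N))" using design_algebra_subset by blast
    then have AP: "A \<in> sets Pr" using source_algebra_subset[OF N design_response_sources(1)] by blast
    have ind: "indep_var borel (indicator A :: 'a \<Rightarrow> real) borel Y"
      by (rule source_algebra_indep_var[OF N design_response_sources]) (use A' Y in auto)
    have "(\<integral>\<omega>. indicator A \<omega> * Y \<omega> \<partial>Pr) = (\<integral>\<omega>. indicator A \<omega> \<partial>Pr) * (\<integral>\<omega>. Y \<omega> \<partial>Pr)"
      by (rule indep_var_lebesgue_integral[OF ind _ int]) (use AP in \<open>simp add: emeasure_eq_measure\<close>)
    then show "(LINT \<omega>:A|Pr. Y \<omega>) = (LINT \<omega>:A|Pr. (\<integral>\<omega>. Y \<omega> \<partial>Pr))"
      using AP by (simp add: set_lebesgue_integral_def)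
  qed (use int in auto)
qed

end

section \<open>Signal and noise given the design\<close>

lemma sel_cong: "m = m' \<Longrightarrow> (\<And>i. i \<in> {1..m'} \<Longrightarrow> s i = s' i) \<Longrightarrow> sel m s t h = sel m' s' t h"
  by (simp add: sel_def)

lemma nw_weight_cong:
  "m = m' \<Longrightarrow> (\<And>i. i \<in> {1..m'} \<Longrightarrow> s i = s' i) \<Longrightarrow> i \<in> {1..m'} \<Longrightarrow>
    nw_weight K m s t h i = nw_weight K m' s' t h i"
  by (simp add: nw_weight_def)

lemma sel_values: "sel m s t h = 0 \<or> sel m s t h = 1"
  by (simp add: sel_def)

lemma sel_measurable:
  assumes "c \<in> measurable M (count_space UNIV)" "\<And>i. 1 \<le> i \<Longrightarrow> s i \<in> borel_measurable M"
  shows "(\<lambda>x. sel (c x) (\<lambda>i. s i x) t h) \<in> borel_measurable M"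
proof (rule measurable_compose_countable[OF _ assms(1)])
  fix m :: nat
  have [measurable]: "s i \<in> borel_measurable M" if "i \<in> {1..m}" for i using assms(2) that by auto
  show "(\<lambda>x. sel m (\<lambda>i. s i x) t h) \<in> borel_measurable M"
    unfolding sel_def by measurable
qed

lemma random_sum_measurable:
  fixes f :: "nat \<Rightarrow> 'b \<Rightarrow> real"
  assumes "c \<in> measurable M (count_space UNIV)" "\<And>i. 1 \<le> i \<Longrightarrow> f i \<in> borel_measurable M"
  shows "(\<lambda>x. \<Sum>i=1..c x. f i x) \<in> borel_measurable M"
proof (rule measurable_compose_countable[OF _ assms(1)])
  show "(\<lambda>x. \<Sum>i=1..m. f i x) \<in> borel_measurable M" for m
    using assms(2) by (intro borel_measurable_sum) auto
qed

lemma nw_weight_measurable: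
  assumes "c \<in> measurable M (count_space UNIV)" "\<And>i. 1 \<le> i \<Longrightarrow> s i \<in> borel_measurable M"
    and K: "K \<in> borel_measurable borel" and i: "1 \<le> i"
  shows "(\<lambda>x. nw_weight K (c x) (\<lambda>i. s i x) t h i) \<in> borel_measurable M"
proof -
  have "(\<lambda>x. K ((s i x - t) / h)) \<in> borel_measurable M" if "1 \<le> i" for i
    by (rule measurable_compose[OF _ K]) (use assms(2)[OF that] in measurable)
  then show ?thesis
    unfolding nw_weight_def by (intro borel_measurable_divide random_sum_measurable assms(1)) (use i in auto)
qed

locale local_smoothing = sampling_model +
  fixes K :: "real \<Rightarrow> real" and t :: real and h :: "nat \<Rightarrow> real"
  assumes t_domain: "t \<in> time_domain" and kernel: "smoothing_kernel K"
begin

definition \<pi> :: "nat \<Rightarrow> nat \<Rightarrow> 'a \<Rightarrow> real" where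
  "\<pi> N n \<omega> = sel (Mc N n \<omega>) (\<lambda>i. T n i \<omega>) t (h N)"

definition PN :: "nat \<Rightarrow> 'a \<Rightarrow> real" where
  "PN N \<omega> = sel_count N (\<lambda>n. Mc N n \<omega>) (\<lambda>n i. T n i \<omega>) t (h N)"

definition W :: "nat \<Rightarrow> nat \<Rightarrow> nat \<Rightarrow> 'a \<Rightarrow> real" where
  "W N n i \<omega> = nw_weight K (Mc N n \<omega>) (\<lambda>i. T n i \<omega>) t (h N) i"

definition \<mu>t :: real where "\<mu>t = mean_fun Pr X t"

text \<open>\<open>\<sigma>\<close> is measurable on the domain only. Its extension by 0 is a Borel
  function and agrees with it at all design points outside a null set.\<close>

definition \<sigma>0 :: "real \<Rightarrow> real" where "\<sigma>0 u = indicator time_domain u * \<sigma> u"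

definition coef :: "nat \<Rightarrow> nat \<Rightarrow> nat \<Rightarrow> 'a \<Rightarrow> real" where
  "coef N n i \<omega> = \<pi> N n \<omega> / sqrt (PN N \<omega>) * W N n i \<omega> * \<sigma>0 (T n i \<omega>)"

definition signal :: "nat \<Rightarrow> 'a \<Rightarrow> real" where
  "signal N \<omega> = 1 / sqrt (PN N \<omega>) * (\<Sum>n=1..N. \<pi> N n \<omega> * (X (int n) \<omega> t - \<mu>t))"

definition noise :: "nat \<Rightarrow> 'a \<Rightarrow> real" where
  "noise N \<omega> = (\<Sum>n=1..N. \<Sum>i=1..Mc N n \<omega>. coef N n i \<omega> * \<epsilon> n i \<omega>)"

definition selected :: "nat \<Rightarrow> 'a \<Rightarrow> int set" where
  "selected N \<omega> = int ` {n\<in>{1..N}. \<pi> N n \<omega> = 1}"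

text \<open>The index set is frozen at \<open>\<omega>\<close> while the process is integrated over
  \<open>\<omega>'\<close>, so this depends on the design alone; \<open>cond_var_signal\<close>
  identifies it with the conditional variance. It is 0 if no curve is selected.\<close>

definition var_sel :: "nat \<Rightarrow> 'a \<Rightarrow> real" where
  "var_sel N \<omega> = (\<integral>\<omega>'. (\<Sum>n\<in>selected N \<omega>. X n \<omega>' t - \<mu>t)\<^sup>2 \<partial>Pr) / real (card (selected N \<omega>))"

lemma finite_selected[simp]: "finite (selected N \<omega>)" by (simp add: selected_def)

lemma \<pi>_values: "\<pi> N n \<omega> = 0 \<or> \<pi> N n \<omega> = 1"
  unfolding \<pi>_def by (rule sel_values)

lemma sum_selected: "(\<Sum>n=1..N. \<pi> N n \<omega> * f (int n)) = (\<Sum>n\<in>selected N \<omega>. f n)"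
proof -
  have "(\<Sum>n\<in>selected N \<omega>. f n) = (\<Sum>n\<in>{n\<in>{1..N}. \<pi> N n \<omega> = 1}. f (int n))"
    unfolding selected_def by (subst sum.reindex) (auto simp: inj_on_def)
  also have "\<dots> = (\<Sum>n=1..N. if \<pi> N n \<omega> = 1 then f (int n) else 0)"
    by (rule sum.inter_filter) simp
  also have "\<dots> = (\<Sum>n=1..N. \<pi> N n \<omega> * f (int n))"
    by (rule sum.cong) (use \<pi>_values in force)+
  finally show ?thesis ..
qed

lemma PN_sum: "PN N \<omega> = (\<Sum>n=1..N. \<pi> N n \<omega>)"
  by (simp add: PN_def sel_count_def \<pi>_def)

lemma PN_card: "PN N \<omega> = real (card (selected N \<omega>))"
  using sum_selected[of N \<omega> "\<lambda>_. 1"] by (simp add: PN_sum)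

lemma PN_nonneg: "0 \<le> PN N \<omega>" by (simp add: PN_card)

lemma K_measurable[measurable]: "K \<in> borel_measurable borel"
  using kernel by (simp add: smoothing_kernel_def)

lemma \<sigma>0_measurable[measurable]: "\<sigma>0 \<in> borel_measurable borel"
  using sigma_measurable by (simp add: \<sigma>0_def[abs_def] set_borel_measurable_def)

lemma T_measurable[measurable]: "1 \<le> n \<Longrightarrow> 1 \<le> i \<Longrightarrow> T n i \<in> borel_measurable Pr"
  using points_distr[of n i] by (simp add: distributed_def)

lemma X_measurable[measurable]: "u \<in> time_domain \<Longrightarrow> (\<lambda>\<omega>. X n \<omega> u) \<in> borel_measurable Pr"
  using stationary by (simp add: strictly_stationary_def)

lemma eps_measurable[measurable]: "1 \<le> n \<Longrightarrow> 1 \<le> i \<Longrightarrow> \<epsilon> n i \<in> borel_measurable Pr"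
  by (rule noise_measurable)

text \<open>The same quantities as functions of the record of the design, so that Fubini applies to the
  joint law of the design and the responses.\<close>

definition rsel :: "nat \<Rightarrow> nat \<Rightarrow> (nat \<Rightarrow> nat) \<times> (nat \<times> nat \<Rightarrow> real) \<Rightarrow> real" where
  "rsel N n d = sel (fst d n) (\<lambda>i. snd d (n, i)) t (h N)"

definition rcount :: "nat \<Rightarrow> (nat \<Rightarrow> nat) \<times> (nat \<times> nat \<Rightarrow> real) \<Rightarrow> real" where
  "rcount N d = (\<Sum>n=1..N. rsel N n d)"

definition rcoef :: "nat \<Rightarrow> nat \<Rightarrow> nat \<Rightarrow> (nat \<Rightarrow> nat) \<times> (nat \<times> nat \<Rightarrow> real) \<Rightarrow> real" where
  "rcoef N n i d = rsel N n d / sqrt (rcount N d)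
    * nw_weight K (fst d n) (\<lambda>i. snd d (n, i)) t (h N) i * \<sigma>0 (snd d (n, i))"

lemma design_components:
  "n \<in> {1..N} \<Longrightarrow> fst (design N \<omega>) n = Mc N n \<omega>"
  "n \<in> {1..N} \<Longrightarrow> i \<in> {1..Mc N n \<omega>} \<Longrightarrow> snd (design N \<omega>) (n, i) = T n i \<omega>"
  by (auto simp: design_def count_record_def array_record_def)

lemma rsel_design: "n \<in> {1..N} \<Longrightarrow> rsel N n (design N \<omega>) = \<pi> N n \<omega>"
  unfolding rsel_def \<pi>_def by (rule sel_cong) (simp_all only: design_components)

lemma rcount_design: "rcount N (design N \<omega>) = PN N \<omega>"
  unfolding rcount_def PN_sum by (rule sum.cong[OF refl]) (rule rsel_design)

text \<open>The record stores 0 in place of the points beyond the count, and no weight of an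
  observed point reads those entries.\<close>

lemma rcoef_design:
  assumes "n \<in> {1..N}" "i \<in> {1..Mc N n \<omega>}"
  shows "rcoef N n i (design N \<omega>) = coef N n i \<omega>"
proof -
  have "nw_weight K (Mc N n \<omega>) (\<lambda>i. snd (design N \<omega>) (n, i)) t (h N) i
      = nw_weight K (Mc N n \<omega>) (\<lambda>i. T n i \<omega>) t (h N) i"
    by (rule nw_weight_cong[OF refl _ assms(2)]) (rule design_components(2)[OF assms(1)])
  then show ?thesis
    using assms by (simp only: rcoef_def coef_def W_def rcount_design rsel_design design_components)
qed

lemma record_measurable:
  "n \<in> {1..N} \<Longrightarrow> (\<lambda>d. fst d n) \<in> measurable (design_space N) (count_space UNIV)"
  "n \<in> {1..N} \<Longrightarrow> 1 \<le> i \<Longrightarrow> (\<lambda>d. snd d (n, i)) \<in> borel_measurable (design_space N)"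
  by measurable

lemma rsel_measurable: "n \<in> {1..N} \<Longrightarrow> rsel N n \<in> borel_measurable (design_space N)"
  unfolding rsel_def[abs_def] by (intro sel_measurable record_measurable)

lemma rcount_measurable: "rcount N \<in> borel_measurable (design_space N)"
  unfolding rcount_def[abs_def] by (intro borel_measurable_sum rsel_measurable)

lemma rcoef_measurable: "n \<in> {1..N} \<Longrightarrow> 1 \<le> i \<Longrightarrow> rcoef N n i \<in> borel_measurable (design_space N)"
  unfolding rcoef_def[abs_def]
  by (intro borel_measurable_times borel_measurable_divide nw_weight_measurable K_measurable rsel_measurable
      record_measurable measurable_compose[OF rcount_measurable] measurable_compose[OF record_measurable(2) \<sigma>0_measurable])
    auto

lemma design_measurable:
  assumes "1 \<le> N" "f \<in> measurable (design_space N) M'"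
  shows "(\<lambda>\<omega>. f (design N \<omega>)) \<in> measurable Pr M'"
  using measurable_source_algebra_Pr[OF assms(1) design_response_sources(1) design_source] assms(2)
  by (rule measurable_compose)

lemma \<pi>_measurable: "n \<in> {1..N} \<Longrightarrow> \<pi> N n \<in> borel_measurable Pr"
  using design_measurable[OF _ rsel_measurable, of N n]
  by (subst measurable_cong[where g = "\<lambda>\<omega>. rsel N n (design N \<omega>)"]) (auto simp: rsel_design)

lemma PN_measurable: "PN N \<in> borel_measurable Pr"
  unfolding PN_sum[abs_def] by (intro borel_measurable_sum \<pi>_measurable)

lemma Mc_measurable: "n \<in> {1..N} \<Longrightarrow> Mc N n \<in> measurable Pr (count_space UNIV)"
  using count_measurable by simp

lemma W_measurable: "n \<in> {1..N} \<Longrightarrow> 1 \<le> i \<Longrightarrow> W N n i \<in> borel_measurable Pr"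
  unfolding W_def[abs_def] by (intro nw_weight_measurable Mc_measurable T_measurable K_measurable) auto

lemma coef_measurable: "n \<in> {1..N} \<Longrightarrow> 1 \<le> i \<Longrightarrow> coef N n i \<in> borel_measurable Pr"
  unfolding coef_def[abs_def]
  by (intro borel_measurable_times borel_measurable_divide \<pi>_measurable W_measurable
      measurable_compose[OF PN_measurable] measurable_compose[OF T_measurable \<sigma>0_measurable]) auto

lemma signal_measurable: "signal N \<in> borel_measurable Pr"
  unfolding signal_def[abs_def]
  by (intro borel_measurable_times borel_measurable_divide borel_measurable_sum borel_measurable_diff \<pi>_measurable
      measurable_compose[OF PN_measurable] X_measurable[OF t_domain]) auto

lemma noise_term_measurable: "noise N \<in> borel_measurable Pr"
  unfolding noise_def[abs_def]
  by (intro borel_measurable_sum random_sum_measurable Mc_measurable borel_measurable_times coef_measurable eps_measurable) auto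

section \<open>The characteristic function of signal plus noise given the design\<close>

lemma char_noise:
  assumes "1 \<le> n" "1 \<le> i"
  shows "(\<integral>\<omega>. iexp (s * \<epsilon> n i \<omega>) \<partial>Pr) = char noise_law s"
proof -
  have "char noise_law s = (\<integral>x. iexp (s * x) \<partial>distr Pr borel (\<epsilon> n i))"
    unfolding char_def noise_distr[OF assms] ..
  also have "\<dots> = (\<integral>\<omega>. iexp (s * \<epsilon> n i \<omega>) \<partial>Pr)"
    by (rule integral_distr) (use eps_measurable[OF assms] in auto)
  finally show ?thesis ..
qed

text \<open>For deterministic weights and counts, the whole process is a single source and gives one
  factor, its curves being dependent; every error is a source of its own and gives one factor of the
  common law.\<close>

lemma signal_noise_char:
  assumes N: "1 \<le> N"
  shows "(\<integral>\<omega>. iexp (u * ((\<Sum>n=1..N. a n * (X (int n) \<omega> t - \<mu>t)) + (\<Sum>n=1..N. \<Sum>i=1..m n. b n i * \<epsilon> n i \<omega>))) \<partial>Pr)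
    = (\<integral>\<omega>. iexp (u * (\<Sum>n=1..N. a n * (X (int n) \<omega> t - \<mu>t))) \<partial>Pr)
      * (\<Prod>n=1..N. \<Prod>i=1..m n. char noise_law (u * b n i))"
proof -
  define I where "I = Sigma {1..N} (\<lambda>n. {1..m n})"
  define Y :: "source \<Rightarrow> 'a \<Rightarrow> complex" where "Y j \<omega> = (case j of
      Process \<Rightarrow> iexp (u * (\<Sum>n=1..N. a n * (X (int n) \<omega> t - \<mu>t)))
    | Noise n i \<Rightarrow> iexp (u * b n i * \<epsilon> n i \<omega>) | _ \<Rightarrow> 1)" for j \<omega>
  define J where "J = insert Process (case_prod Noise ` I)"
  have fin: "finite I" "finite J" by (auto simp: I_def J_def)
  have inj: "inj_on (case_prod Noise) I" by (auto simp: inj_on_def)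
  have JN: "J \<subseteq> sources N" by (auto simp: J_def I_def sources_def)
  have Ym: "Y j \<in> borel_measurable (source_algebra N {j})" if "j \<in> J" for j
  proof -
    have [measurable]: "(\<lambda>\<omega>. X n \<omega> t) \<in> borel_measurable (source_algebra N {Process})" for n
      by (rule X_source) (use t_domain in simp_all)
    have [measurable]: "\<epsilon> n i \<in> borel_measurable (source_algebra N {Noise n i})" for n i
      by (rule eps_source) simp
    show ?thesis using that unfolding J_def
    proof (elim insertE imageE)
      assume j: "j = Process"
      show ?thesis unfolding j Y_def[abs_def] source.case by measurable
    next
      fix x assume "j = case_prod Noise x"
      then obtain n i where j: "j = Noise n i" by (cases x) auto
      show ?thesis unfolding j Y_def[abs_def] source.case by measurable
    qed
  qed
  have ind: "indep_vars (\<lambda>_. borel) Y J"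
    by (rule source_algebra_indep_vars[OF N _ _ Ym]) (use JN in \<open>auto simp: disjoint_family_on_def\<close>)
  have int: "integrable Pr (Y j)" if "j \<in> J" for j
  proof (rule integrable_const_bound[of _ 1])
    show "AE \<omega> in Pr. cmod (Y j \<omega>) \<le> 1"
      by (intro AE_I2) (simp add: Y_def split: source.split)
    show "Y j \<in> borel_measurable Pr"
      by (rule measurable_source_algebra_Pr[OF N _ Ym[OF that]]) (use JN that in auto)
  qed
  have prod_J: "(\<Prod>j\<in>J. f j) = f Process * (\<Prod>n=1..N. \<Prod>i=1..m n. f (Noise n i))" for f :: "source \<Rightarrow> complex"
  proof -
    have "(\<Prod>j\<in>J. f j) = f Process * (\<Prod>j\<in>case_prod Noise ` I. f j)"
      unfolding J_def using fin by (subst prod.insert) auto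
    also have "(\<Prod>j\<in>case_prod Noise ` I. f j) = (\<Prod>(n, i)\<in>I. f (Noise n i))"
      by (subst prod.reindex[OF inj]) (simp add: comp_def case_prod_beta)
    also have "\<dots> = (\<Prod>n=1..N. \<Prod>i=1..m n. f (Noise n i))"
      unfolding I_def by (subst prod.Sigma) auto
    finally show ?thesis .
  qed
  have split: "iexp (u * ((\<Sum>n=1..N. a n * (X (int n) \<omega> t - \<mu>t)) + (\<Sum>n=1..N. \<Sum>i=1..m n. b n i * \<epsilon> n i \<omega>)))
      = (\<Prod>j\<in>J. Y j \<omega>)" for \<omega>
  proof -
    have "(\<Prod>n=1..N. \<Prod>i=1..m n. Y (Noise n i) \<omega>) = iexp (u * (\<Sum>n=1..N. \<Sum>i=1..m n. b n i * \<epsilon> n i \<omega>))"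
      by (simp add: Y_def exp_sum[symmetric] sum_distrib_left mult.assoc)
    then show ?thesis
      unfolding prod_J by (simp add: Y_def distrib_left exp_add)
  qed
  have "(\<integral>\<omega>. (\<Prod>j\<in>J. Y j \<omega>) \<partial>Pr) = (\<Prod>j\<in>J. \<integral>\<omega>. Y j \<omega> \<partial>Pr)"
    by (rule indep_vars_lebesgue_integral[OF fin(2) ind int])
  also have "\<dots> = (\<integral>\<omega>. iexp (u * (\<Sum>n=1..N. a n * (X (int n) \<omega> t - \<mu>t))) \<partial>Pr)
      * (\<Prod>n=1..N. \<Prod>i=1..m n. char noise_law (u * b n i))"
  proof -
    have "(\<integral>\<omega>. Y (Noise n i) \<omega> \<partial>Pr) = char noise_law (u * b n i)" if "n \<in> {1..N}" "i \<in> {1..m n}" for n i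
      using char_noise[of n i "u * b n i"] that by (simp add: Y_def[abs_def])
    then show ?thesis
      unfolding prod_J by (intro arg_cong2[of _ _ _ _ "(*)"] prod.cong) (simp_all add: Y_def[abs_def])
  qed
  finally show ?thesis unfolding split .
qed

text \<open>The characteristic function of signal plus noise with the design frozen at
  \<open>\<omega>\<close>, in factorised form.\<close>

definition cond_char :: "nat \<Rightarrow> real \<Rightarrow> 'a \<Rightarrow> complex" where
  "cond_char N u \<omega> = (\<integral>\<omega>'. iexp (u * ((\<Sum>n\<in>selected N \<omega>. X n \<omega>' t - \<mu>t) / sqrt (real (card (selected N \<omega>))))) \<partial>Pr)
    * (\<Prod>n=1..N. \<Prod>i=1..Mc N n \<omega>. char noise_law (u * coef N n i \<omega>))"

text \<open>Signal plus noise is a function of the design record and the responses, so the design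
  can be frozen; \<open>signal_noise_char\<close> evaluates the inner integral. Measurability in
  \<open>\<omega>\<close> comes from the same Fubini argument.\<close>

lemma cond_char:
  assumes N: "1 \<le> N"
  shows "(\<integral>\<omega>. iexp (u * (signal N \<omega> + noise N \<omega>)) \<partial>Pr) = (\<integral>\<omega>. cond_char N u \<omega> \<partial>Pr)"
    "cond_char N u \<in> borel_measurable Pr"
proof -
  define F where "F z = iexp (u * (1 / sqrt (rcount N (fst z)) * (\<Sum>n=1..N. rsel N n (fst z) * (fst (snd z) n - \<mu>t))
      + (\<Sum>n=1..N. \<Sum>i=1..fst (fst z) n. rcoef N n i (fst z) * snd (snd z) (n, i))))"
    for z :: "((nat \<Rightarrow> nat) \<times> (nat \<times> nat \<Rightarrow> real)) \<times> ((nat \<Rightarrow> real) \<times> (nat \<times> nat \<Rightarrow> real))"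
  let ?S = "design_space N \<Otimes>\<^sub>M response_space N"
  have m1: "(\<lambda>z. 1 / sqrt (rcount N (fst z)) * (\<Sum>n=1..N. rsel N n (fst z) * (fst (snd z) n - \<mu>t))) \<in> borel_measurable ?S"
    by (intro borel_measurable_times borel_measurable_divide borel_measurable_sum borel_measurable_diff
        measurable_compose[OF measurable_fst rsel_measurable] measurable_compose[OF measurable_fst rcount_measurable]
        measurable_compose[OF measurable_compose[OF measurable_fst rcount_measurable]]) auto
  have m2: "(\<lambda>z. \<Sum>n=1..N. \<Sum>i=1..fst (fst z) n. rcoef N n i (fst z) * snd (snd z) (n, i)) \<in> borel_measurable ?S"
  proof (intro borel_measurable_sum random_sum_measurable borel_measurable_times)
    fix n assume n: "n \<in> {1..N}"
    show "(\<lambda>z. fst (fst z) n) \<in> measurable ?S (count_space UNIV)"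
      by (rule measurable_compose[OF measurable_fst record_measurable(1)[OF n]])
    fix i :: nat assume i: "1 \<le> i"
    show "(\<lambda>z. rcoef N n i (fst z)) \<in> borel_measurable ?S"
      by (rule measurable_compose[OF measurable_fst rcoef_measurable[OF n i]])
    have "(\<lambda>r. snd r (n, i)) \<in> borel_measurable (response_space N)"
      using n i by (intro measurable_compose[OF measurable_snd measurable_component_singleton]) auto
    then show "(\<lambda>z. snd (snd z) (n, i)) \<in> borel_measurable ?S"
      by (rule measurable_compose[OF measurable_snd])
  qed
  have F: "F \<in> borel_measurable ?S"
    unfolding F_def[abs_def] using m1 m2 by measurable
  have F_eq: "F (design N \<omega>, response N t \<omega>') = iexp (u * ((\<Sum>n=1..N. \<pi> N n \<omega> / sqrt (PN N \<omega>) * (X (int n) \<omega>' t - \<mu>t))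
      + (\<Sum>n=1..N. \<Sum>i=1..Mc N n \<omega>. coef N n i \<omega> * \<epsilon> n i \<omega>')))" for \<omega> \<omega>'
  proof -
    have "1 / sqrt (rcount N (design N \<omega>)) * (\<Sum>n=1..N. rsel N n (design N \<omega>) * (fst (response N t \<omega>') n - \<mu>t))
      = (\<Sum>n=1..N. \<pi> N n \<omega> / sqrt (PN N \<omega>) * (X (int n) \<omega>' t - \<mu>t))"
      unfolding sum_distrib_left by (rule sum.cong) (simp_all add: rsel_design rcount_design response_def)
    moreover have "(\<Sum>n=1..N. \<Sum>i=1..fst (design N \<omega>) n. rcoef N n i (design N \<omega>) * snd (response N t \<omega>') (n, i))
      = (\<Sum>n=1..N. \<Sum>i=1..Mc N n \<omega>. coef N n i \<omega> * \<epsilon> n i \<omega>')"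
      by (intro sum.cong) (auto simp: design_components rcoef_design response_def)
    ultimately show ?thesis by (simp only: F_def fst_conv snd_conv)
  qed
  have diag: "F (design N \<omega>, response N t \<omega>) = iexp (u * (signal N \<omega> + noise N \<omega>))" for \<omega>
    unfolding F_eq by (simp add: signal_def noise_def sum_distrib_left)
  have inner: "(\<integral>\<omega>'. F (design N \<omega>, response N t \<omega>') \<partial>Pr) = cond_char N u \<omega>" for \<omega>
  proof -
    have "(\<Sum>n=1..N. \<pi> N n \<omega> / sqrt (PN N \<omega>) * (X (int n) \<omega>' t - \<mu>t))
        = (\<Sum>n\<in>selected N \<omega>. X n \<omega>' t - \<mu>t) / sqrt (real (card (selected N \<omega>)))" for \<omega>'
      unfolding sum_selected[of N \<omega> "\<lambda>n. X n \<omega>' t - \<mu>t", symmetric] PN_card[symmetric] by (simp add: sum_divide_distrib)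
    then show ?thesis
      unfolding F_eq signal_noise_char[OF N] cond_char_def by simp
  qed
  have int: "integrable Pr (\<lambda>\<omega>. F (design N \<omega>, response N t \<omega>))"
  proof (rule integrable_const_bound[of _ 1])
    show "(\<lambda>\<omega>. F (design N \<omega>, response N t \<omega>)) \<in> borel_measurable Pr"
      unfolding diag using signal_measurable noise_term_measurable by measurable
  qed (simp add: F_def)
  show "(\<integral>\<omega>. iexp (u * (signal N \<omega> + noise N \<omega>)) \<partial>Pr) = (\<integral>\<omega>. cond_char N u \<omega> \<partial>Pr)"
    "cond_char N u \<in> borel_measurable Pr"
    using integral_design_response[OF N t_domain F int] unfolding diag inner by simp_all
qed

text \<open>The coefficients are functions of the design and leave the conditional expectation,
  whereas products of centred curve values are independent of the design and are replaced by their
  means. What remains is the quadratic form behind \<open>var_sel\<close>.\<close>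

lemma cond_var_signal:
  assumes N: "1 \<le> N"
    and int2: "\<And>n. integrable Pr (\<lambda>\<omega>. (X n \<omega> t - \<mu>t)\<^sup>2)" and int1: "\<And>n. integrable Pr (\<lambda>\<omega>. X n \<omega> t - \<mu>t)"
    and zero: "\<And>n. (\<integral>\<omega>. X n \<omega> t - \<mu>t \<partial>Pr) = 0"
  shows "AE \<omega> in Pr. cond_var Pr (design_algebra Pr N (Mc N) T) (signal N) \<omega> = var_sel N \<omega>"
proof -
  let ?G = "design_algebra Pr N (Mc N) T"
  interpret G: finite_measure_subalgebra Pr ?G by (rule design_algebra_subalgebra[OF N])
  define z where "z n \<omega> = X (int n) \<omega> t - \<mu>t" for n \<omega>
  define a where "a n \<omega> = (if n \<in> {1..N} then \<pi> N n \<omega> / sqrt (PN N \<omega>) else 0)" for n \<omega>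
  have zm[measurable]: "z n \<in> borel_measurable Pr" for n
    unfolding z_def[abs_def] by (intro borel_measurable_diff X_measurable[OF t_domain]) auto
  have zs: "z n \<in> borel_measurable (source_algebra N response_sources)" for n
    unfolding z_def[abs_def] by (intro borel_measurable_diff X_source[OF _ t_domain]) (auto simp: response_sources_def)
  have aG: "a n \<in> borel_measurable ?G" for n
  proof (cases "n \<in> {1..N}")
    case True
    have "(\<lambda>\<omega>. rsel N n (design N \<omega>) / sqrt (rcount N (design N \<omega>))) \<in> borel_measurable ?G"
      by (intro borel_measurable_divide design_algebra_measurable[OF rsel_measurable[OF True]]
          measurable_compose[OF design_algebra_measurable[OF rcount_measurable]]) auto
    then show ?thesis
      by (subst measurable_cong[where g = "\<lambda>\<omega>. rsel N n (design N \<omega>) / sqrt (rcount N (design N \<omega>))"])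
        (use True in \<open>auto simp: a_def rsel_design rcount_design\<close>)
  next
    case False
    then have "a n = (\<lambda>_. 0)" by (auto simp: a_def fun_eq_iff)
    then show ?thesis by simp
  qed
  have am: "a n \<in> borel_measurable Pr" for n
    using measurable_from_subalg[OF G.subalg aG] .
  \<comment> \<open>A selected curve forces \<open>PN N \<omega>\<close> to be at least 1; if there
    is none, division by 0 gives 0. Boundedness makes all the products below integrable.\<close>
  have ab: "\<bar>a n \<omega>\<bar> \<le> 1" for n \<omega>
  proof (cases "selected N \<omega> = {}")
    case False
    then have "1 \<le> PN N \<omega>" by (simp add: PN_card Suc_le_eq card_gt_0_iff)
    then have "1 \<le> sqrt (PN N \<omega>)" by simp
    moreover have "\<bar>\<pi> N n \<omega>\<bar> \<le> 1" using \<pi>_values[of N n \<omega>] by auto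
    ultimately have "\<bar>\<pi> N n \<omega>\<bar> \<le> sqrt (PN N \<omega>)" by linarith
    then show ?thesis using \<open>1 \<le> PN N \<omega>\<close> by (auto simp: a_def abs_divide divide_le_eq)
  qed (simp add: a_def PN_card)
  have S: "signal N = (\<lambda>\<omega>. \<Sum>n=1..N. a n \<omega> * z n \<omega>)"
    by (auto simp: signal_def a_def z_def sum_distrib_left)
  have mult_int: "integrable Pr (\<lambda>\<omega>. f \<omega> * g \<omega>)"
    if "f \<in> borel_measurable Pr" "\<And>\<omega>. \<bar>f \<omega>\<bar> \<le> 1" "integrable Pr g" for f g :: "'a \<Rightarrow> real"
    by (rule Bochner_Integration.integrable_bound[OF that(3)])
      (use that in \<open>auto simp: abs_mult intro!: AE_I2 mult_left_le_one_le\<close>)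
  have iz: "integrable Pr (z n)" for n unfolding z_def[abs_def] by (rule int1)
  have izz: "integrable Pr (\<lambda>\<omega>. z n \<omega> * z n' \<omega>)" for n n'
    by (rule expectation_abs_mult_le(1)[where a = "sqrt (\<integral>\<omega>. (z n \<omega>)\<^sup>2 \<partial>Pr)" and b = "sqrt (\<integral>\<omega>. (z n' \<omega>)\<^sup>2 \<partial>Pr)",
          OF zm zm]) (use int2 in \<open>auto simp: z_def\<close>)
  have ce1: "AE \<omega> in Pr. real_cond_exp Pr ?G (\<lambda>\<omega>. a n \<omega> * z n \<omega>) \<omega> = 0" for n
  proof -
    have "AE \<omega> in Pr. real_cond_exp Pr ?G (\<lambda>\<omega>. a n \<omega> * z n \<omega>) \<omega> = a n \<omega> * real_cond_exp Pr ?G (z n) \<omega>"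
      by (rule G.real_cond_exp_mult[OF aG zm mult_int[OF am ab iz]])
    moreover have "AE \<omega> in Pr. real_cond_exp Pr ?G (z n) \<omega> = (\<integral>\<omega>. z n \<omega> \<partial>Pr)"
      by (rule cond_exp_response[OF N zs iz])
    ultimately show ?thesis by eventually_elim (simp add: z_def zero)
  qed
  have "AE \<omega> in Pr. real_cond_exp Pr ?G (signal N) \<omega> = (\<Sum>n=1..N. real_cond_exp Pr ?G (\<lambda>\<omega>. a n \<omega> * z n \<omega>) \<omega>)"
    unfolding S by (rule G.real_cond_exp_sum) (rule mult_int[OF am ab iz])
  moreover have "AE \<omega> in Pr. \<forall>n\<in>{1..N}. real_cond_exp Pr ?G (\<lambda>\<omega>. a n \<omega> * z n \<omega>) \<omega> = 0"
    by (rule AE_finite_allI) (use ce1 in auto)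
  ultimately have E0: "AE \<omega> in Pr. real_cond_exp Pr ?G (signal N) \<omega> = 0"
    by eventually_elim simp
  have ce2: "AE \<omega> in Pr. real_cond_exp Pr ?G (\<lambda>\<omega>. (a n \<omega> * a n' \<omega>) * (z n \<omega> * z n' \<omega>)) \<omega>
      = a n \<omega> * a n' \<omega> * (\<integral>\<omega>. z n \<omega> * z n' \<omega> \<partial>Pr)"
    and zz_int: "integrable Pr (\<lambda>\<omega>. (a n \<omega> * a n' \<omega>) * (z n \<omega> * z n' \<omega>))" for n n'
  proof -
    have ab2: "\<bar>a n \<omega> * a n' \<omega>\<bar> \<le> 1" for \<omega>
      using mult_mono[OF ab[of n \<omega>] ab[of n' \<omega>]] by (simp add: abs_mult)
    show int: "integrable Pr (\<lambda>\<omega>. (a n \<omega> * a n' \<omega>) * (z n \<omega> * z n' \<omega>))"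
      by (rule mult_int[OF borel_measurable_times[OF am am] ab2 izz])
    have "AE \<omega> in Pr. real_cond_exp Pr ?G (\<lambda>\<omega>. (a n \<omega> * a n' \<omega>) * (z n \<omega> * z n' \<omega>)) \<omega>
      = a n \<omega> * a n' \<omega> * real_cond_exp Pr ?G (\<lambda>\<omega>. z n \<omega> * z n' \<omega>) \<omega>"
      by (rule G.real_cond_exp_mult[OF borel_measurable_times[OF aG aG] borel_measurable_times[OF zm zm] int])
    moreover have "AE \<omega> in Pr. real_cond_exp Pr ?G (\<lambda>\<omega>. z n \<omega> * z n' \<omega>) \<omega> = (\<integral>\<omega>. z n \<omega> * z n' \<omega> \<partial>Pr)"
      by (rule cond_exp_response[OF N borel_measurable_times[OF zs zs] izz])
    ultimately show "AE \<omega> in Pr. real_cond_exp Pr ?G (\<lambda>\<omega>. (a n \<omega> * a n' \<omega>) * (z n \<omega> * z n' \<omega>)) \<omega>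
      = a n \<omega> * a n' \<omega> * (\<integral>\<omega>. z n \<omega> * z n' \<omega> \<partial>Pr)" by eventually_elim simp
  qed
  let ?I = "{1..N} \<times> {1..N}"
  define q where "q x \<omega> = (a (fst x) \<omega> * a (snd x) \<omega>) * (z (fst x) \<omega> * z (snd x) \<omega>)" for x \<omega>
  have S2: "(signal N \<omega>)\<^sup>2 = (\<Sum>x\<in>?I. q x \<omega>)" for \<omega>
    by (simp add: S q_def power2_eq_square sum_product sum.cartesian_product case_prod_beta mult_ac)
  have Sm: "(\<lambda>\<omega>. \<Sum>x\<in>?I. q x \<omega>) \<in> borel_measurable Pr"
    unfolding q_def by (intro borel_measurable_sum borel_measurable_integrable zz_int)
  have vs: "(\<Sum>x\<in>?I. a (fst x) \<omega> * a (snd x) \<omega> * (\<integral>\<omega>. z (fst x) \<omega> * z (snd x) \<omega> \<partial>Pr)) = var_sel N \<omega>" for \<omega>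
  proof -
    have "(\<integral>\<omega>'. (\<Sum>n\<in>selected N \<omega>. X n \<omega>' t - \<mu>t)\<^sup>2 \<partial>Pr)
      = (\<integral>\<omega>'. (\<Sum>x\<in>?I. (\<pi> N (fst x) \<omega> * \<pi> N (snd x) \<omega>) * (z (fst x) \<omega>' * z (snd x) \<omega>')) \<partial>Pr)"
      unfolding sum_selected[of N \<omega> "\<lambda>n. X n _ t - \<mu>t", symmetric]
      by (simp add: z_def power2_eq_square sum_product sum.cartesian_product case_prod_beta mult_ac)
    also have "\<dots> = (\<Sum>x\<in>?I. (\<pi> N (fst x) \<omega> * \<pi> N (snd x) \<omega>) * (\<integral>\<omega>'. z (fst x) \<omega>' * z (snd x) \<omega>' \<partial>Pr))"
      using izz by (subst Bochner_Integration.integral_sum) auto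
    finally have "var_sel N \<omega> = (\<Sum>x\<in>?I. (\<pi> N (fst x) \<omega> * \<pi> N (snd x) \<omega>) * (\<integral>\<omega>'. z (fst x) \<omega>' * z (snd x) \<omega>' \<partial>Pr)) / PN N \<omega>"
      by (simp add: var_sel_def PN_card)
    also have "\<dots> = (\<Sum>x\<in>?I. a (fst x) \<omega> * a (snd x) \<omega> * (\<integral>\<omega>. z (fst x) \<omega> * z (snd x) \<omega> \<partial>Pr))"
      unfolding sum_divide_distrib
      by (rule sum.cong) (auto simp: a_def PN_nonneg)
    finally show ?thesis ..
  qed
  have "AE \<omega> in Pr. cond_var Pr ?G (signal N) \<omega> = real_cond_exp Pr ?G (\<lambda>\<omega>. \<Sum>x\<in>?I. q x \<omega>) \<omega>"
    unfolding cond_var_def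
  proof (rule G.real_cond_exp_cong[OF _ _ Sm])
    show "AE \<omega> in Pr. (signal N \<omega> - real_cond_exp Pr ?G (signal N) \<omega>)\<^sup>2 = (\<Sum>x\<in>?I. q x \<omega>)"
      using E0 by eventually_elim (simp add: S2)
    show "(\<lambda>\<omega>. (signal N \<omega> - real_cond_exp Pr ?G (signal N) \<omega>)\<^sup>2) \<in> borel_measurable Pr"
      using signal_measurable by measurable
  qed
  moreover have "AE \<omega> in Pr. real_cond_exp Pr ?G (\<lambda>\<omega>. \<Sum>x\<in>?I. q x \<omega>) \<omega> = (\<Sum>x\<in>?I. real_cond_exp Pr ?G (q x) \<omega>)"
    by (rule G.real_cond_exp_sum) (simp only: q_def[abs_def] zz_int)
  moreover have "AE \<omega> in Pr. \<forall>x\<in>?I. real_cond_exp Pr ?G (q x) \<omega>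
      = a (fst x) \<omega> * a (snd x) \<omega> * (\<integral>\<omega>. z (fst x) \<omega> * z (snd x) \<omega> \<partial>Pr)"
    by (rule AE_finite_allI) (simp_all only: q_def[abs_def] ce2 finite_cartesian_product finite_atLeastAtMost)
  ultimately show ?thesis by eventually_elim (simp add: vs[unfolded One_nat_def])
qed

end

section \<open>Kernel weights and the number of selected curves\<close>

text \<open>All weights share one denominator, so their sum is a quotient D / D: it is 1 if some
  point lies in the window, where the kernel is positive, and otherwise 0 by the convention for
  division.\<close>

lemma nw_weight_facts:
  assumes K: "smoothing_kernel K" and h: "0 < h"
  shows "0 \<le> nw_weight K m s t h i"
    "nw_weight K m s t h i \<noteq> 0 \<Longrightarrow> s i \<in> {t - h..t + h}"
    "(\<Sum>i=1..m. nw_weight K m s t h i) \<le> 1"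
    "sel m s t h = 1 \<Longrightarrow> (\<Sum>i=1..m. nw_weight K m s t h i) = 1"
    "i \<in> {1..m} \<Longrightarrow> nw_weight K m s t h i \<le> 1"
proof -
  have K0: "0 \<le> K u" for u using K by (simp add: smoothing_kernel_def)
  have Kout: "K u = 0" if "1 < \<bar>u\<bar>" for u using K that by (simp add: smoothing_kernel_def)
  have Kpos: "0 < K u" if "\<bar>u\<bar> \<le> 1" for u
  proof -
    have "(INF u\<in>{-1..1}. K u) \<le> K u"
      by (rule cINF_lower) (use K0 that in \<open>auto intro!: bdd_belowI2[of _ 0]\<close>)
    then show ?thesis using K by (simp add: smoothing_kernel_def)
  qed
  have win: "\<bar>(x - t) / h\<bar> \<le> 1 \<longleftrightarrow> x \<in> {t - h..t + h}" for x
    using h by (auto simp: abs_le_iff field_simps)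
  let ?D = "\<Sum>k=1..m. K ((s k - t) / h)"
  have D0: "0 \<le> ?D" by (intro sum_nonneg K0)
  show nn: "0 \<le> nw_weight K m s t h i" for i
    unfolding nw_weight_def using K0 D0 by (intro divide_nonneg_nonneg)
  show "s i \<in> {t - h..t + h}" if "nw_weight K m s t h i \<noteq> 0"
    using that Kout[of "(s i - t) / h"] unfolding win[symmetric] by (auto simp: nw_weight_def not_less[symmetric])
  have sum: "(\<Sum>i=1..m. nw_weight K m s t h i) = ?D / ?D"
    unfolding nw_weight_def by (rule sum_divide_distrib[symmetric])
  show le: "(\<Sum>i=1..m. nw_weight K m s t h i) \<le> 1" unfolding sum by simp
  show "(\<Sum>i=1..m. nw_weight K m s t h i) = 1" if s1: "sel m s t h = 1"
  proof -
    obtain i where i: "i \<in> {1..m}" "s i \<in> {t - h..t + h}"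
      using s1 by (auto simp: sel_def split: if_splits)
    have "0 < K ((s i - t) / h)" by (rule Kpos) (use i win in simp)
    also have "\<dots> \<le> ?D" by (rule member_le_sum[OF i(1)]) (use K0 in auto)
    finally show ?thesis unfolding sum by simp
  qed
  show "nw_weight K m s t h i \<le> 1" if "i \<in> {1..m}"
    using member_le_sum[OF that, of "\<lambda>i. nw_weight K m s t h i"] nn le by force
qed

context local_smoothing
begin

lemma W_facts:
  assumes "0 < h N"
  shows "0 \<le> W N n i \<omega>" "W N n i \<omega> \<noteq> 0 \<Longrightarrow> T n i \<omega> \<in> {t - h N..t + h N}"
    "(\<Sum>i=1..Mc N n \<omega>. W N n i \<omega>) \<le> 1" "\<pi> N n \<omega> = 1 \<Longrightarrow> (\<Sum>i=1..Mc N n \<omega>. W N n i \<omega>) = 1"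
    "i \<in> {1..Mc N n \<omega>} \<Longrightarrow> W N n i \<omega> \<le> 1"
  unfolding W_def \<pi>_def using nw_weight_facts[OF kernel assms] by blast+

lemma W_square_sum:
  assumes "0 < h N"
  shows "(\<Sum>i=1..Mc N n \<omega>. (W N n i \<omega>)\<^sup>2) \<le> 1"
proof -
  have "(\<Sum>i=1..Mc N n \<omega>. (W N n i \<omega>)\<^sup>2) \<le> (\<Sum>i=1..Mc N n \<omega>. W N n i \<omega>)"
    using W_facts[OF assms] by (intro sum_mono) (auto simp: power2_eq_square intro!: mult_left_le)
  also have "\<dots> \<le> 1" by (rule W_facts[OF assms])
  finally show ?thesis .
qed

text \<open>A quotient m / \<lambda> of at least c > 0 forces \<lambda> > 0, since m is nonnegative
  and division by 0 gives 0. As m is at least 2, the upper bound on the quotient keeps \<lambda>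
  away from 0 uniformly in N.\<close>

lemma lam_bounds:
  obtains c C where "0 < c" "0 < C" "\<And>N. 1 \<le> N \<Longrightarrow> 0 < lam N" "\<And>N. 1 \<le> N \<Longrightarrow> 2 / C \<le> lam N"
    "\<And>N m. 1 \<le> N \<Longrightarrow> m \<in> set_pmf (Mlaw N) \<Longrightarrow> c * lam N \<le> real m \<and> real m \<le> C * lam N"
proof -
  obtain c C where c: "0 < c" "0 < C"
    and r: "\<And>N m. 1 \<le> N \<Longrightarrow> m \<in> set_pmf (Mlaw N) \<Longrightarrow> c \<le> real m / lam N \<and> real m / lam N \<le> C"
    using count_law_ratio by blast
  have pos: "0 < lam N" if "1 \<le> N" for N
  proof -
    obtain m where m: "m \<in> set_pmf (Mlaw N)" using set_pmf_not_empty[of "Mlaw N"] by blast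
    have "0 < real m / lam N" using r[OF that m] c(1) by linarith
    then show ?thesis by (simp add: zero_less_divide_iff)
  qed
  have b: "c * lam N \<le> real m \<and> real m \<le> C * lam N" if "1 \<le> N" "m \<in> set_pmf (Mlaw N)" for N m
    using r[OF that] pos[OF that(1)] by (simp add: field_simps)
  have "2 / C \<le> lam N" if "1 \<le> N" for N
  proof -
    obtain m where m: "m \<in> set_pmf (Mlaw N)" using set_pmf_not_empty[of "Mlaw N"] by blast
    have "2 \<le> real m" using count_law_ge_2[OF that m] by simp
    then show ?thesis using b[OF that m] c(2) by (simp add: field_simps)
  qed
  with c pos b show thesis by (intro that)
qed

lemma count_AE:
  assumes "1 \<le> N"
  shows "AE \<omega> in Pr. \<forall>n\<in>{1..N}. Mc N n \<omega> \<in> set_pmf (Mlaw N)"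
proof (rule AE_finite_allI)
  fix n assume n: "n \<in> {1..N}"
  have "AE m in distr Pr (count_space UNIV) (Mc N n). m \<in> set_pmf (Mlaw N)"
    using n by (subst count_distr) (auto simp: AE_measure_pmf)
  then show "AE \<omega> in Pr. Mc N n \<omega> \<in> set_pmf (Mlaw N)"
    using Mc_measurable[OF n] by (subst (asm) AE_distr_iff) auto
qed simp

lemma T_AE: "AE \<omega> in Pr. \<forall>n\<ge>1. \<forall>i\<ge>1. T n i \<omega> \<in> time_domain"
proof -
  have *: "AE \<omega> in Pr. 1 \<le> n \<longrightarrow> 1 \<le> i \<longrightarrow> T n i \<omega> \<in> time_domain" for n i
  proof (cases "1 \<le> n \<and> 1 \<le> i")
    case True
    then have d: "distributed Pr lborel (T n i) (\<lambda>u. ennreal (g u) * indicator time_domain u)"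
      using points_distr by simp
    have "AE u in distr Pr lborel (T n i). u \<in> time_domain"
      unfolding distributed_distr_eq_density[OF d]
      using distributed_borel_measurable[OF d] by (subst AE_density) (auto simp: indicator_def)
    then show ?thesis
      using True by (subst (asm) AE_distr_iff) (auto simp: T_measurable)
  qed auto
  then have "AE \<omega> in Pr. \<forall>n. \<forall>i. 1 \<le> n \<longrightarrow> 1 \<le> i \<longrightarrow> T n i \<omega> \<in> time_domain"
    by (simp only: AE_all_countable) blast
  then show ?thesis by eventually_elim auto
qed

lemma T_prob_bounds:
  obtains c C where "0 < c" "0 < C"
    "\<And>n i a b. 1 \<le> n \<Longrightarrow> 1 \<le> i \<Longrightarrow> a \<le> b \<Longrightarrow> {a..b} \<subseteq> time_domain \<Longrightarrow>
      c * (b - a) \<le> prob (T n i -` {a..b} \<inter> space Pr)"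
    "\<And>n i a b. 1 \<le> n \<Longrightarrow> 1 \<le> i \<Longrightarrow> a \<le> b \<Longrightarrow> prob (T n i -` {a..b} \<inter> space Pr) \<le> C * (b - a)"
proof -
  obtain c C where c: "0 < c" and b: "\<And>u. u \<in> time_domain \<Longrightarrow> c \<le> g u \<and> g u \<le> C"
    using density_bounds by blast
  have C: "0 < C" using b[of 1] c by simp
  have em: "ennreal (prob (T n i -` {a..b} \<inter> space Pr))
      = (\<integral>\<^sup>+u. ennreal (g u) * indicator time_domain u * indicator {a..b} u \<partial>lborel)"
    if "1 \<le> n" "1 \<le> i" for n i a b
    using distributed_emeasure[OF points_distr[OF that], of "{a..b}"] by (simp add: emeasure_eq_measure)
  show thesis
  proof (rule that[OF c C])
    fix n i :: nat and a b :: real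
    assume A: "1 \<le> n" "1 \<le> i" "a \<le> b"
    have "ennreal (prob (T n i -` {a..b} \<inter> space Pr)) \<le> (\<integral>\<^sup>+u. ennreal C * indicator {a..b} u \<partial>lborel)"
      unfolding em[OF A(1,2)]
      by (rule nn_integral_mono) (use b in \<open>auto simp: indicator_def intro!: ennreal_leI\<close>)
    also have "\<dots> = ennreal (C * (b - a))"
      using A C by (simp add: nn_integral_cmult_indicator ennreal_mult)
    finally show "prob (T n i -` {a..b} \<inter> space Pr) \<le> C * (b - a)"
      using A C by (simp add: ennreal_le_iff)
    assume sub: "{a..b} \<subseteq> time_domain"
    have "ennreal (c * (b - a)) = (\<integral>\<^sup>+u. ennreal c * indicator {a..b} u \<partial>lborel)"
      using A c by (simp add: nn_integral_cmult_indicator ennreal_mult)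
    also have "\<dots> \<le> ennreal (prob (T n i -` {a..b} \<inter> space Pr))"
      unfolding em[OF A(1,2)]
      by (rule nn_integral_mono) (use b sub in \<open>auto simp: indicator_def intro!: ennreal_leI\<close>)
    finally show "c * (b - a) \<le> prob (T n i -` {a..b} \<inter> space Pr)"
      by (simp add: ennreal_le_iff)
  qed
qed

text \<open>Chernoff bound: the events that one of the first \<open>m\<close> points of a curve falls
  in the window are independent across curves.\<close>

lemma PN_small_prob:
  assumes N: "1 \<le> N" and m: "\<And>k. k \<in> set_pmf (Mlaw N) \<Longrightarrow> m \<le> k"
    and q: "\<And>n i. 1 \<le> n \<Longrightarrow> 1 \<le> i \<Longrightarrow> q \<le> prob (T n i -` {t - h N..t + h N} \<inter> space Pr)"
    and q0: "0 \<le> q"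
  shows "prob {\<omega> \<in> space Pr. PN N \<omega> < x} \<le> exp (x - (1 - exp (- 1)) * (1 - exp (- (q * real m))) * real N)"
proof -
  let ?w = "{t - h N..t + h N}"
  \<comment> \<open>\<open>m\<close> is a lower bound of all possible counts. Restricting to the
    first \<open>m\<close> points makes the event depend on the points of curve \<open>n\<close>
    alone and not on its random count.\<close>
  define A where "A n \<omega> \<longleftrightarrow> (\<exists>i\<in>{1..m}. T n i \<omega> \<in> ?w)" for n \<omega>
  \<comment> \<open>The exponential of minus the indicator of \<open>A n\<close>, hence almost
    surely an upper bound of the exponential of minus \<open>\<pi> N n\<close>.\<close>
  define V where "V n \<omega> = (if A n \<omega> then exp (- 1) else 1 :: real)" for n \<omega>
  define J where "J n = {Point n i | i. i \<in> {1..m}}" for n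
  have J: "J n \<subseteq> sources N" if "n \<in> {1..N}" for n
    using that by (auto simp: J_def sources_def)
  have Ts: "T n i \<in> borel_measurable (source_algebra N (J n))" if "i \<in> {1..m}" for n i
    by (rule T_source) (use that in \<open>auto simp: J_def\<close>)
  have Vs: "V n \<in> borel_measurable (source_algebra N (J n))" for n
  proof -
    have [measurable]: "T n i \<in> borel_measurable (source_algebra N (J n))" if "i \<in> {1..m}" for i
      by (rule Ts[OF that])
    show ?thesis unfolding V_def[abs_def] A_def by measurable
  qed
  have Vm: "V n \<in> borel_measurable Pr" if "n \<in> {1..N}" for n
    by (rule measurable_source_algebra_Pr[OF N J[OF that] Vs])
  have V01: "0 \<le> V n \<omega>" "V n \<omega> \<le> 1" for n \<omega> by (auto simp: V_def)
  have iV: "integrable Pr (V n)" if "n \<in> {1..N}" for n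
    by (rule integrable_const_bound[of _ 1]) (use V01 Vm[OF that] in auto)
  have indV: "indep_vars (\<lambda>_. borel) V {1..N}"
    by (rule source_algebra_indep_vars[OF N J _ Vs]) (auto simp: disjoint_family_on_def J_def)
  have EV: "(\<integral>\<omega>. V n \<omega> \<partial>Pr) \<le> exp (- ((1 - exp (- 1)) * (1 - exp (- (q * real m)))))" if n: "n \<in> {1..N}" for n
  proof -
    define U where "U i \<omega> = (if T n i \<omega> \<in> ?w then 0 else 1 :: real)" for i \<omega>
    have Us: "U i \<in> borel_measurable (source_algebra N {Point n i})" for i
    proof -
      have [measurable]: "T n i \<in> borel_measurable (source_algebra N {Point n i})" by (rule T_source) simp
      show ?thesis unfolding U_def[abs_def] by measurable
    qed
    have sub: "{Point n i} \<subseteq> sources N" if "i \<in> {1..m}" for i using that n by (auto simp: sources_def)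
    have indU: "indep_vars (\<lambda>_. borel) U {1..m}"
      by (rule source_algebra_indep_vars[OF N sub _ Us]) (auto simp: disjoint_family_on_def)
    have iU: "integrable Pr (U i)" if "i \<in> {1..m}" for i
      by (rule integrable_const_bound[of _ 1])
        (use measurable_source_algebra_Pr[OF N sub[OF that] Us] in \<open>auto simp: U_def\<close>)
    have EU: "(\<integral>\<omega>. U i \<omega> \<partial>Pr) \<le> exp (- q)" if i: "i \<in> {1..m}" for i
    proof -
      have [measurable]: "T n i \<in> borel_measurable Pr" using i n by (intro T_measurable) auto
      have "(\<integral>\<omega>. U i \<omega> \<partial>Pr) = (\<integral>\<omega>. 1 - indicator (T n i -` ?w \<inter> space Pr) \<omega> \<partial>Pr)"
        by (rule Bochner_Integration.integral_cong) (auto simp: U_def)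
      also have "\<dots> = 1 - prob (T n i -` ?w \<inter> space Pr)"
        by (subst Bochner_Integration.integral_diff) (auto simp: prob_space emeasure_eq_measure)
      also have "\<dots> \<le> 1 - q" using q[of n i] i n by simp
      also have "\<dots> \<le> exp (- q)" using exp_ge_add_one_self[of "- q"] by simp
      finally show ?thesis .
    qed
    \<comment> \<open>The product of the \<open>U i\<close> indicates that all \<open>m\<close>
      points miss the window, so the expectation of \<open>V n\<close> factorises over the
      points.\<close>
    have V_eq: "V n \<omega> = exp (- 1) + (1 - exp (- 1)) * (\<Prod>i\<in>{1..m}. U i \<omega>)" for \<omega>
    proof -
      have "(\<Prod>i\<in>{1..m}. U i \<omega>) = (if A n \<omega> then 0 else 1)"
      proof (cases "A n \<omega>")
        case True
        then have "(\<Prod>i\<in>{1..m}. U i \<omega>) = 0"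
          by (intro prod_zero) (auto simp: A_def U_def)
        then show ?thesis using True by simp
      next
        case False
        then have "(\<Prod>i\<in>{1..m}. U i \<omega>) = 1"
          by (intro prod.neutral) (auto simp: A_def U_def)
        then show ?thesis using False by simp
      qed
      then show ?thesis by (simp add: V_def)
    qed
    have "(\<integral>\<omega>. (\<Prod>i\<in>{1..m}. U i \<omega>) \<partial>Pr) = (\<Prod>i\<in>{1..m}. \<integral>\<omega>. U i \<omega> \<partial>Pr)"
      by (rule indep_vars_lebesgue_integral[OF _ indU iU]) auto
    also have "\<dots> \<le> (\<Prod>i\<in>{1..m}. exp (- q))"
      by (rule prod_mono) (use EU in \<open>auto simp: U_def\<close>)
    also have "\<dots> = exp (- (q * real m))" by (simp add: exp_of_nat_mult[symmetric] mult.commute)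
    finally have le: "(\<integral>\<omega>. (\<Prod>i\<in>{1..m}. U i \<omega>) \<partial>Pr) \<le> exp (- (q * real m))" .
    have "(\<integral>\<omega>. V n \<omega> \<partial>Pr) = exp (- 1) + (1 - exp (- 1)) * (\<integral>\<omega>. (\<Prod>i\<in>{1..m}. U i \<omega>) \<partial>Pr)"
      unfolding V_eq using indep_vars_integrable[OF _ indU iU] by (simp add: prob_space)
    also have "\<dots> \<le> exp (- 1) + (1 - exp (- 1)) * exp (- (q * real m))"
      using le by (intro add_left_mono mult_left_mono) auto
    also have "\<dots> = 1 + - ((1 - exp (- 1)) * (1 - exp (- (q * real m))))" by (simp add: algebra_simps)
    also have "\<dots> \<le> exp (- ((1 - exp (- 1)) * (1 - exp (- (q * real m)))))"
      by (rule exp_ge_add_one_self)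
    finally show ?thesis .
  qed
  have AE: "AE \<omega> in Pr. exp (- PN N \<omega>) \<le> (\<Prod>n\<in>{1..N}. V n \<omega>)"
    using count_AE[OF N]
  proof eventually_elim
    case (elim \<omega>)
    have "exp (- PN N \<omega>) = (\<Prod>n\<in>{1..N}. exp (- \<pi> N n \<omega>))"
      by (simp add: PN_sum exp_sum[symmetric] sum_negf)
    also have "\<dots> \<le> (\<Prod>n\<in>{1..N}. V n \<omega>)"
    proof (rule prod_mono, safe)
      fix n assume n: "n \<in> {1..N}"
      show "exp (- \<pi> N n \<omega>) \<le> V n \<omega>"
      proof (cases "A n \<omega>")
        case True
        then obtain i where i: "i \<in> {1..m}" "T n i \<omega> \<in> ?w" by (auto simp: A_def)
        have "m \<le> Mc N n \<omega>" using elim n m by blast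
        then have "\<pi> N n \<omega> = 1" using i by (auto simp: \<pi>_def sel_def)
        then show ?thesis using True by (simp add: V_def)
      next
        case False
        then show ?thesis using \<pi>_values[of N n \<omega>] by (auto simp: V_def)
      qed
    qed simp
    finally show ?case .
  qed
  have iP: "integrable Pr (\<lambda>\<omega>. \<Prod>n\<in>{1..N}. V n \<omega>)"
    by (rule indep_vars_integrable[OF _ indV iV]) auto
  have "prob {\<omega> \<in> space Pr. PN N \<omega> < x} = (\<integral>\<omega>. indicator {\<omega> \<in> space Pr. PN N \<omega> < x} \<omega> \<partial>Pr)"
    using PN_measurable[of N] by simp
  \<comment> \<open>The exponential Markov inequality with parameter 1.\<close>
  also have "\<dots> \<le> (\<integral>\<omega>. exp x * (\<Prod>n\<in>{1..N}. V n \<omega>) \<partial>Pr)"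
  proof (rule integral_mono_AE)
    show "AE \<omega> in Pr. indicator {\<omega> \<in> space Pr. PN N \<omega> < x} \<omega> \<le> exp x * (\<Prod>n\<in>{1..N}. V n \<omega>)"
      using AE
    proof eventually_elim
      case (elim \<omega>)
      have "1 \<le> exp x * exp (- PN N \<omega>)" if "PN N \<omega> < x"
        using that by (simp flip: exp_add)
      also have "exp x * exp (- PN N \<omega>) \<le> exp x * (\<Prod>n\<in>{1..N}. V n \<omega>)" using elim by simp
      finally have "1 \<le> exp x * (\<Prod>n\<in>{1..N}. V n \<omega>)" if "PN N \<omega> < x" using that .
      moreover have "0 \<le> exp x * (\<Prod>n\<in>{1..N}. V n \<omega>)"
        using V01 by (intro mult_nonneg_nonneg prod_nonneg) auto
      ultimately show ?case by (auto simp: indicator_def)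
    qed
  qed (use iP PN_measurable[of N] in \<open>auto simp: emeasure_eq_measure\<close>)
  also have "\<dots> = exp x * (\<Prod>n\<in>{1..N}. \<integral>\<omega>. V n \<omega> \<partial>Pr)"
    using indep_vars_lebesgue_integral[OF _ indV iV] by simp
  also have "\<dots> \<le> exp x * (\<Prod>n\<in>{1..N}. exp (- ((1 - exp (- 1)) * (1 - exp (- (q * real m))))))"
    by (intro mult_left_mono prod_mono) (use EV V01 in auto)
  also have "\<dots> = exp (x - (1 - exp (- 1)) * (1 - exp (- (q * real m))) * real N)"
    by (simp add: exp_of_nat_mult[symmetric] exp_add[symmetric] algebra_simps)
  finally show ?thesis .
qed

end

section \<open>The smoothing bias\<close>

lemma cell_distance:
  fixes x u :: real
  assumes "1 \<le> k" "real k * u \<le> x" "x \<le> real k * u + 1"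
  shows "0 \<le> x / real k - u" "x / real k - u \<le> 1 / real k"
proof -
  have eq: "x / real k - u = (x - real k * u) / real k" using assms(1) by (simp add: diff_divide_distrib)
  show "0 \<le> x / real k - u" unfolding eq using assms by (intro divide_nonneg_nonneg) auto
  show "x / real k - u \<le> 1 / real k" unfolding eq using assms by (intro divide_right_mono) auto
qed

context local_smoothing
begin

text \<open>A curve hits the window with probability at least 1 - exp (- y), where y is of order
  \<lambda> h, and this is at least half the minimum of y and 1. The Chernoff exponent is therefore
  of the order of the minimum of N \<lambda> h and N, which diverges.\<close>

lemma PN_at_top:
  assumes r: "0 < r" "{t - r..t + r} \<subseteq> time_domain" and h0: "h \<longlonglongrightarrow> 0"
    and top: "filterlim (\<lambda>N. real N * lam N * h N) at_top sequentially"
  shows "(\<lambda>N. prob {\<omega> \<in> space Pr. PN N \<omega> < x}) \<longlonglongrightarrow> 0"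
proof -
  obtain c C where c: "0 < c" "0 < C" and lam: "\<And>N. 1 \<le> N \<Longrightarrow> 0 < lam N"
    "\<And>N m. 1 \<le> N \<Longrightarrow> m \<in> set_pmf (Mlaw N) \<Longrightarrow> c * lam N \<le> real m \<and> real m \<le> C * lam N"
    by (rule lam_bounds) (rule that; assumption)
  obtain cp where cp: "0 < cp"
    and Tp: "\<And>n i a b. 1 \<le> n \<Longrightarrow> 1 \<le> i \<Longrightarrow> a \<le> b \<Longrightarrow> {a..b} \<subseteq> time_domain \<Longrightarrow>
      cp * (b - a) \<le> prob (T n i -` {a..b} \<inter> space Pr)"
    by (rule T_prob_bounds) (rule that; assumption)
  define \<kappa> :: real where "\<kappa> = 1 - exp (- 1)"
  have \<kappa>: "0 < \<kappa>" by (simp add: \<kappa>_def)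
  define y where "y N = 2 * cp * h N * (c * lam N)" for N
  define E where "E N = min (real N * y N) (real N) / 2" for N
  have Etop: "filterlim E at_top sequentially"
    unfolding filterlim_at_top
  proof
    fix Z :: real
    have "filterlim (\<lambda>N. 2 * cp * c * (real N * lam N * h N)) at_top sequentially"
      by (rule filterlim_tendsto_pos_mult_at_top[OF tendsto_const _ top]) (use cp c in simp)
    then have "\<forall>\<^sub>F N in sequentially. 2 * Z \<le> 2 * cp * c * (real N * lam N * h N)"
      unfolding filterlim_at_top by blast
    moreover have "\<forall>\<^sub>F N in sequentially. 2 * Z \<le> real N"
      using filterlim_real_sequentially by (simp add: filterlim_at_top)
    ultimately show "\<forall>\<^sub>F N in sequentially. Z \<le> E N"
      by eventually_elim (simp add: E_def y_def algebra_simps)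
  qed
  have "\<forall>\<^sub>F N in sequentially. 1 \<le> real N * lam N * h N"
    using top by (simp add: filterlim_at_top)
  moreover have "\<forall>\<^sub>F N in sequentially. h N < r"
    using h0 r(1) by (rule order_tendstoD(2))
  moreover have "\<forall>\<^sub>F N in sequentially. 1 \<le> N" by (rule eventually_ge_at_top)
  ultimately have bound: "\<forall>\<^sub>F N in sequentially. prob {\<omega> \<in> space Pr. PN N \<omega> < x} \<le> exp (x - \<kappa> * E N)"
  proof eventually_elim
    case (elim N)
    have "0 < (real N * lam N) * h N" using elim(1) by linarith
    moreover have "0 < real N * lam N" using elim(3) lam(1)[OF elim(3)] by simp
    ultimately have hpos: "0 < h N" by (simp only: zero_less_mult_pos)
    define m where "m = nat \<lceil>c * lam N\<rceil>"
    have m: "c * lam N \<le> real m" unfolding m_def by linarith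
    have mk: "m \<le> k" if "k \<in> set_pmf (Mlaw N)" for k
      using lam(2)[OF elim(3) that] unfolding m_def by linarith
    define q where "q = cp * (2 * h N)"
    have q: "q \<le> prob (T n i -` {t - h N..t + h N} \<inter> space Pr)" if "1 \<le> n" "1 \<le> i" for n i
    proof -
      have "{t - h N..t + h N} \<subseteq> {t - r..t + r}" using elim(2) by auto
      then have "{t - h N..t + h N} \<subseteq> time_domain" using r(2) by (rule subset_trans)
      then show ?thesis using Tp[OF that, of "t - h N" "t + h N"] hpos by (simp add: q_def)
    qed
    have y: "0 < y N" "y N \<le> q * real m"
      using m hpos cp c(1) lam(1)[OF elim(3)] by (auto simp: y_def q_def mult_left_mono)
    have "E N \<le> (1 - exp (- y N)) * real N"
    proof -
      have "exp (- y N) \<le> 1 / (1 + y N)"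
        using y(1) exp_ge_add_one_self[of "y N"] by (simp add: exp_minus field_simps)
      moreover have "min (y N) 1 / 2 \<le> 1 - 1 / (1 + y N)"
      proof -
        have "1 - 1 / (1 + y N) = y N / (1 + y N)" using y(1) by (simp add: field_simps)
        moreover have "min (y N) 1 / 2 \<le> y N / (1 + y N)"
        proof (cases "y N \<le> 1")
          case True
          then have "y N / 2 \<le> y N / (1 + y N)" using y(1) by (intro divide_left_mono) auto
          then show ?thesis using True by simp
        next
          case False
          then show ?thesis by (simp add: field_simps)
        qed
        ultimately show ?thesis by simp
      qed
      ultimately have "min (y N) 1 / 2 \<le> 1 - exp (- y N)" by linarith
      then have "min (y N) 1 / 2 * real N \<le> (1 - exp (- y N)) * real N" by (rule mult_right_mono) simp
      moreover have "min (y N) 1 / 2 * real N = E N"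
        by (cases "N = 0") (auto simp: E_def min_def mult.commute mult_le_cancel_left1 mult_le_cancel_left2)
      ultimately show ?thesis by simp
    qed
    also have "\<dots> \<le> (1 - exp (- (q * real m))) * real N"
      using y(2) by (intro mult_right_mono) auto
    finally have E_le: "\<kappa> * E N \<le> \<kappa> * ((1 - exp (- (q * real m))) * real N)"
      using \<kappa> by (intro mult_left_mono) auto
    have "0 \<le> q" using cp hpos by (simp add: q_def)
    then have "prob {\<omega> \<in> space Pr. PN N \<omega> < x} \<le> exp (x - \<kappa> * (1 - exp (- (q * real m))) * real N)"
      using PN_small_prob[OF elim(3) mk q, of x] by (simp only: \<kappa>_def)
    also have "\<dots> \<le> exp (x - \<kappa> * E N)"
      using E_le by (simp add: mult.assoc)
    finally show ?case .
  qed
  have lim: "(\<lambda>N. exp (x - \<kappa> * E N)) \<longlonglongrightarrow> 0"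
  proof (rule filterlim_compose[OF exp_at_bot])
    have "filterlim (\<lambda>N. \<kappa> * E N) at_top sequentially"
      by (rule filterlim_tendsto_pos_mult_at_top[OF tendsto_const \<kappa> Etop])
    then have "filterlim (\<lambda>N. - (- x + \<kappa> * E N)) at_bot sequentially"
      by (intro filterlim_compose[OF filterlim_uminus_at_bot_at_top] filterlim_tendsto_add_at_top[OF tendsto_const])
    then show "filterlim (\<lambda>N. x - \<kappa> * E N) at_bot sequentially" by simp
  qed
  show ?thesis
    by (rule tendsto_sandwich[OF _ bound tendsto_const lim]) simp
qed

section \<open>Decomposition of the estimation error\<close>

definition muhat :: "nat \<Rightarrow> 'a \<Rightarrow> real" where
  "muhat N \<omega> = mean_hat K N (\<lambda>n. Mc N n \<omega>) (\<lambda>n i. T n i \<omega>) (\<lambda>n i. obs X T \<sigma> \<epsilon> n i \<omega>) t (h N)"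

text \<open>Defined as a remainder, so that the decomposition is exact at every outcome; the
  explicit formula of \<open>bias_eq\<close> holds where all points lie in the domain and the
  bandwidth is positive.\<close>

definition bias :: "nat \<Rightarrow> 'a \<Rightarrow> real" where
  "bias N \<omega> = sqrt (PN N \<omega>) * (muhat N \<omega> - \<mu>t) - signal N \<omega> - noise N \<omega>"

lemma muhat_eq: "muhat N \<omega> = (\<Sum>n=1..N. \<pi> N n \<omega> * (\<Sum>i=1..Mc N n \<omega>. W N n i \<omega> * obs X T \<sigma> \<epsilon> n i \<omega>)) / PN N \<omega>"
  by (simp add: muhat_def mean_hat_def curve_hat_def \<pi>_def W_def PN_def)

lemma muhat_measurable: "muhat N \<in> borel_measurable Pr"
  unfolding muhat_eq[abs_def]
  by (intro borel_measurable_divide borel_measurable_sum borel_measurable_times random_sum_measurable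
      \<pi>_measurable W_measurable Mc_measurable PN_measurable obs_measurable) auto

lemma bias_measurable: "bias N \<in> borel_measurable Pr"
  unfolding bias_def[abs_def]
  by (intro borel_measurable_diff borel_measurable_times muhat_measurable signal_measurable noise_term_measurable
      measurable_compose[OF PN_measurable]) auto

text \<open>On a selected curve the weights sum to 1, so the value at \<open>t\<close> can be
  subtracted under the weights. If no curve is selected, both sides are 0 by the convention for
  division.\<close>

lemma bias_eq:
  assumes h: "0 < h N" and T: "\<And>n i. 1 \<le> n \<Longrightarrow> 1 \<le> i \<Longrightarrow> T n i \<omega> \<in> time_domain"
  shows "bias N \<omega> = 1 / sqrt (PN N \<omega>) *
    (\<Sum>n=1..N. \<pi> N n \<omega> * (\<Sum>i=1..Mc N n \<omega>. W N n i \<omega> * (X (int n) \<omega> (T n i \<omega>) - X (int n) \<omega> t)))"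
proof (cases "PN N \<omega> = 0")
  case True
  then show ?thesis by (simp add: bias_def signal_def noise_def coef_def)
next
  case False
  then have P: "0 < PN N \<omega>" using PN_nonneg[of N \<omega>] by simp
  let ?P = "PN N \<omega>"
  define xh where "xh n = (\<Sum>i=1..Mc N n \<omega>. W N n i \<omega> * obs X T \<sigma> \<epsilon> n i \<omega>)" for n
  define e where "e n = (\<Sum>i=1..Mc N n \<omega>. W N n i \<omega> * (\<sigma>0 (T n i \<omega>) * \<epsilon> n i \<omega>))" for n
  define d where "d n = (\<Sum>i=1..Mc N n \<omega>. W N n i \<omega> * (X (int n) \<omega> (T n i \<omega>) - X (int n) \<omega> t))" for n
  have "sqrt ?P * (muhat N \<omega> - \<mu>t) = (sqrt ?P / ?P) * ((\<Sum>n=1..N. \<pi> N n \<omega> * xh n) - ?P * \<mu>t)"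
    using P by (simp add: muhat_eq xh_def field_simps)
  also have "sqrt ?P / ?P = 1 / sqrt ?P" using P by (simp add: field_simps)
  also have "(\<Sum>n=1..N. \<pi> N n \<omega> * xh n) - ?P * \<mu>t = (\<Sum>n=1..N. \<pi> N n \<omega> * (xh n - \<mu>t))"
    by (simp add: PN_sum sum_distrib_right right_diff_distrib sum_subtractf)
  also have "\<dots> = (\<Sum>n=1..N. \<pi> N n \<omega> * (X (int n) \<omega> t - \<mu>t) + \<pi> N n \<omega> * e n + \<pi> N n \<omega> * d n)"
  proof (rule sum.cong[OF refl])
    fix n assume n: "n \<in> {1..N}"
    show "\<pi> N n \<omega> * (xh n - \<mu>t) = \<pi> N n \<omega> * (X (int n) \<omega> t - \<mu>t) + \<pi> N n \<omega> * e n + \<pi> N n \<omega> * d n"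
    proof (cases "\<pi> N n \<omega> = 1")
      case True
      have "xh n = (\<Sum>i=1..Mc N n \<omega>. W N n i \<omega> * (X (int n) \<omega> (T n i \<omega>) - X (int n) \<omega> t)
          + W N n i \<omega> * (\<sigma>0 (T n i \<omega>) * \<epsilon> n i \<omega>) + W N n i \<omega> * X (int n) \<omega> t)"
        unfolding xh_def
        by (rule sum.cong[OF refl]) (use T n in \<open>simp add: obs_def \<sigma>0_def algebra_simps\<close>)
      also have "\<dots> = d n + e n + (\<Sum>i=1..Mc N n \<omega>. W N n i \<omega>) * X (int n) \<omega> t"
        by (simp add: sum.distrib d_def e_def sum_distrib_right)
      also have "(\<Sum>i=1..Mc N n \<omega>. W N n i \<omega>) = 1" using W_facts(4)[OF h True] .
      finally show ?thesis using True by simp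
    next
      case False
      then show ?thesis using \<pi>_values[of N n \<omega>] by simp
    qed
  qed
  also have "1 / sqrt ?P * \<dots> = signal N \<omega> + 1 / sqrt ?P * (\<Sum>n=1..N. \<pi> N n \<omega> * e n) + 1 / sqrt ?P * (\<Sum>n=1..N. \<pi> N n \<omega> * d n)"
    by (simp add: sum.distrib signal_def distrib_left)
  also have "1 / sqrt ?P * (\<Sum>n=1..N. \<pi> N n \<omega> * e n) = noise N \<omega>"
    by (simp add: noise_def coef_def e_def sum_distrib_left mult_ac)
  finally show ?thesis by (simp add: bias_def d_def)
qed

text \<open>Cauchy-Schwarz is applied twice: across the selected curves, where the normalisation
  cancels their number, and within a curve, where the weights sum to at most 1. Replacing weights by
  window indicators and counts by their bound \<open>m\<close> removes the random denominators, so
  that expectations can be taken point by point.\<close>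

lemma bias_square_le:
  assumes h: "0 < h N" and T: "\<And>n i. 1 \<le> n \<Longrightarrow> 1 \<le> i \<Longrightarrow> T n i \<omega> \<in> time_domain"
    and m: "\<And>n. n \<in> {1..N} \<Longrightarrow> Mc N n \<omega> \<le> m"
  shows "(bias N \<omega>)\<^sup>2 \<le> (\<Sum>n=1..N. \<Sum>i=1..m. indicator {t - h N..t + h N} (T n i \<omega>) *
    (X (int n) \<omega> (T n i \<omega>) - X (int n) \<omega> t)\<^sup>2)"
proof -
  define D where "D n i = X (int n) \<omega> (T n i \<omega>) - X (int n) \<omega> t" for n i
  define b where "b n = (\<Sum>i=1..Mc N n \<omega>. W N n i \<omega> * D n i)" for n
  let ?P = "PN N \<omega>"
  have \<pi>2: "(\<pi> N n \<omega>)\<^sup>2 = \<pi> N n \<omega>" for n using \<pi>_values[of N n \<omega>] by auto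
  have pp: "\<pi> N n \<omega> * (\<pi> N n \<omega> * x) = \<pi> N n \<omega> * x" for n x using \<pi>_values[of N n \<omega>] by auto
  have "(\<Sum>n=1..N. \<pi> N n \<omega> * b n)\<^sup>2 = (\<Sum>n=1..N. \<pi> N n \<omega> * (\<pi> N n \<omega> * b n))\<^sup>2"
    by (simp add: pp)
  also have "\<dots> \<le> (\<Sum>n=1..N. (\<pi> N n \<omega>)\<^sup>2) * (\<Sum>n=1..N. (\<pi> N n \<omega> * b n)\<^sup>2)"
    by (rule Cauchy_Schwarz_ineq_sum)
  also have "(\<Sum>n=1..N. (\<pi> N n \<omega>)\<^sup>2) = ?P"
    unfolding PN_sum \<pi>2 ..
  finally have cs: "(\<Sum>n=1..N. \<pi> N n \<omega> * b n)\<^sup>2 \<le> ?P * (\<Sum>n=1..N. (\<pi> N n \<omega> * b n)\<^sup>2)" .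
  have bias: "bias N \<omega> = 1 / sqrt ?P * (\<Sum>n=1..N. \<pi> N n \<omega> * b n)"
    using bias_eq[OF h T] by (simp add: b_def D_def)
  have "(bias N \<omega>)\<^sup>2 \<le> (\<Sum>n=1..N. (\<pi> N n \<omega> * b n)\<^sup>2)"
  proof (cases "?P = 0")
    case True
    then show ?thesis unfolding bias by (simp add: sum_nonneg)
  next
    case False
    then have P: "0 < ?P" using PN_nonneg[of N \<omega>] by simp
    have "(bias N \<omega>)\<^sup>2 = (\<Sum>n=1..N. \<pi> N n \<omega> * b n)\<^sup>2 / ?P"
      unfolding bias using P by (simp add: power_mult_distrib power_divide)
    then show ?thesis using cs P by (simp add: divide_le_eq mult.commute)
  qed
  also have "\<dots> \<le> (\<Sum>n=1..N. \<Sum>i=1..m. indicator {t - h N..t + h N} (T n i \<omega>) * (D n i)\<^sup>2)"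
  proof (rule sum_mono)
    fix n assume n: "n \<in> {1..N}"
    note Wf = W_facts[OF h, where n = n and \<omega> = \<omega>]
    have "(\<pi> N n \<omega> * b n)\<^sup>2 \<le> (b n)\<^sup>2" using \<pi>_values[of N n \<omega>] by auto
    also have "(b n)\<^sup>2 = (\<Sum>i=1..Mc N n \<omega>. sqrt (W N n i \<omega>) * (sqrt (W N n i \<omega>) * D n i))\<^sup>2"
      unfolding b_def using Wf(1) by (simp flip: mult.assoc)
    also have "\<dots> \<le> (\<Sum>i=1..Mc N n \<omega>. (sqrt (W N n i \<omega>))\<^sup>2) * (\<Sum>i=1..Mc N n \<omega>. (sqrt (W N n i \<omega>) * D n i)\<^sup>2)"
      by (rule Cauchy_Schwarz_ineq_sum)
    also have "\<dots> = (\<Sum>i=1..Mc N n \<omega>. W N n i \<omega>) * (\<Sum>i=1..Mc N n \<omega>. W N n i \<omega> * (D n i)\<^sup>2)"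
      using Wf(1) by (simp add: power_mult_distrib)
    also have "\<dots> \<le> (\<Sum>i=1..Mc N n \<omega>. W N n i \<omega> * (D n i)\<^sup>2)"
      using Wf(1,3) by (intro mult_left_le_one_le sum_nonneg mult_nonneg_nonneg) auto
    also have "\<dots> \<le> (\<Sum>i=1..Mc N n \<omega>. indicator {t - h N..t + h N} (T n i \<omega>) * (D n i)\<^sup>2)"
    proof (intro sum_mono mult_right_mono)
      fix i assume i: "i \<in> {1..Mc N n \<omega>}"
      show "W N n i \<omega> \<le> indicator {t - h N..t + h N} (T n i \<omega>)"
        using Wf(5)[OF i] Wf(2)[of i] by (cases "W N n i \<omega> = 0") auto
    qed simp
    also have "\<dots> \<le> (\<Sum>i=1..m. indicator {t - h N..t + h N} (T n i \<omega>) * (D n i)\<^sup>2)"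
      using m[OF n] by (intro sum_mono2) auto
    finally show "(\<pi> N n \<omega> * b n)\<^sup>2 \<le> (\<Sum>i=1..m. indicator {t - h N..t + h N} (T n i \<omega>) * (D n i)\<^sup>2)" .
  qed
  finally show ?thesis by (simp add: D_def)
qed

text \<open>The point \<open>T\<close> is approximated by the right end point of its cell in the grid of mesh \<open>1/k\<close>, so that
  only finitely many values of the path, all independent of \<open>T\<close>, are involved.\<close>

definition grid_increment :: "nat \<Rightarrow> nat \<Rightarrow> nat \<Rightarrow> nat \<Rightarrow> 'a \<Rightarrow> real" where
  "grid_increment N k n i \<omega> = (\<Sum>j=1..k. indicator {u \<in> {t - h N..t + h N}. \<lceil>real k * u\<rceil> = int j} (T n i \<omega>) *
    (X (int n) \<omega> (real j / real k) - X (int n) \<omega> t)\<^sup>2)"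

lemma cell_measurable[measurable]: "{u \<in> {a..b}. \<lceil>real k * u\<rceil> = int j} \<in> sets borel"
  by measurable

lemma grid_increment_eq:
  assumes "T n i \<omega> \<in> time_domain" "1 \<le> k"
  shows "grid_increment N k n i \<omega> = indicator {t - h N..t + h N} (T n i \<omega>) *
    (X (int n) \<omega> (of_int \<lceil>real k * T n i \<omega>\<rceil> / real k) - X (int n) \<omega> t)\<^sup>2"
    "of_int \<lceil>real k * T n i \<omega>\<rceil> / real k \<in> time_domain"
    "\<bar>of_int \<lceil>real k * T n i \<omega>\<rceil> / real k - T n i \<omega>\<bar> \<le> 1 / real k"
proof -
  let ?u = "T n i \<omega>"
  define j where "j = nat \<lceil>real k * ?u\<rceil>"
  have u: "0 < ?u" "?u \<le> 1" using assms(1) by auto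
  have ku: "0 < real k * ?u" "real k * ?u \<le> real k" using u assms(2) by (auto simp: mult_left_le)
  have c1: "1 \<le> \<lceil>real k * ?u\<rceil>" using ku by (simp add: one_le_ceiling)
  have c2: "\<lceil>real k * ?u\<rceil> \<le> int k" using ku by (simp add: ceiling_le_iff)
  have j: "j \<in> {1..k}" "int j = \<lceil>real k * ?u\<rceil>" "real j = of_int \<lceil>real k * ?u\<rceil>"
    using c1 c2 by (auto simp: j_def nat_le_iff of_nat_nat le_nat_iff)
  have "grid_increment N k n i \<omega> = (\<Sum>l=1..k. if l = j then indicator {t - h N..t + h N} ?u *
      (X (int n) \<omega> (real l / real k) - X (int n) \<omega> t)\<^sup>2 else 0)"
    unfolding grid_increment_def by (rule sum.cong) (auto simp: indicator_def j(2)[symmetric])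
  also have "\<dots> = indicator {t - h N..t + h N} ?u * (X (int n) \<omega> (real j / real k) - X (int n) \<omega> t)\<^sup>2"
    using j(1) by (simp only: sum.delta finite_atLeastAtMost if_True)
  finally show "grid_increment N k n i \<omega> = indicator {t - h N..t + h N} ?u *
    (X (int n) \<omega> (of_int \<lceil>real k * ?u\<rceil> / real k) - X (int n) \<omega> t)\<^sup>2"
    by (simp only: j(3))
  show "of_int \<lceil>real k * ?u\<rceil> / real k \<in> time_domain"
    using j(1) by (simp add: j(3)[symmetric])
  have "0 \<le> of_int \<lceil>real k * ?u\<rceil> / real k - ?u" "of_int \<lceil>real k * ?u\<rceil> / real k - ?u \<le> 1 / real k"
    by (rule cell_distance[OF assms(2)]; linarith)+
  then show "\<bar>of_int \<lceil>real k * ?u\<rceil> / real k - ?u\<bar> \<le> 1 / real k" by simp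
qed

text \<open>The cell of the point and the path at a fixed end point come from different sources,
  hence are independent. The cells are disjoint, so their probabilities add up to at most that of
  the window.\<close>

lemma grid_increment_expectation:
  assumes N: "1 \<le> N" and n: "n \<in> {1..N}" and i: "1 \<le> i" and k: "1 \<le> k" "1 / real k \<le> h N"
    and int: "\<And>u. u \<in> time_domain \<Longrightarrow> \<bar>u - t\<bar> \<le> 2 * h N \<Longrightarrow>
      integrable Pr (\<lambda>\<omega>. (X (int n) \<omega> u - X (int n) \<omega> t)\<^sup>2)"
    and bound: "\<And>u. u \<in> time_domain \<Longrightarrow> \<bar>u - t\<bar> \<le> 2 * h N \<Longrightarrow>
      (\<integral>\<omega>. (X (int n) \<omega> u - X (int n) \<omega> t)\<^sup>2 \<partial>Pr) \<le> B" and B: "0 \<le> B"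
  shows "integrable Pr (grid_increment N k n i)"
    "(\<integral>\<omega>. grid_increment N k n i \<omega> \<partial>Pr) \<le> B * prob (T n i -` {t - h N..t + h N} \<inter> space Pr)"
proof -
  define c where "c j = {u \<in> {t - h N..t + h N}. \<lceil>real k * u\<rceil> = int j}" for j :: nat
  define D where "D j \<omega> = indicator (c j) (T n i \<omega>) * (X (int n) \<omega> (real j / real k) - X (int n) \<omega> t)\<^sup>2" for j \<omega>
  have [measurable]: "T n i \<in> borel_measurable Pr" using n i by (intro T_measurable) auto
  have cm[measurable]: "c j \<in> sets borel" for j unfolding c_def by (rule cell_measurable)
  have D: "integrable Pr (D j) \<and> (\<integral>\<omega>. D j \<omega> \<partial>Pr) \<le> B * (\<integral>\<omega>. indicator (c j) (T n i \<omega>) \<partial>Pr)"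
    if j: "j \<in> {1..k}" for j
  \<comment> \<open>Only cells that meet the window contribute. For the others the end point may be
    far from \<open>t\<close>, where no moment bound is available.\<close>
  proof (cases "c j = {}")
    case True
    then show ?thesis by (simp add: D_def[abs_def])
  next
    case False
    then obtain u where u: "u \<in> {t - h N..t + h N}" "\<lceil>real k * u\<rceil> = int j" by (auto simp: c_def)
    have "0 \<le> real j / real k - u" "real j / real k - u \<le> 1 / real k"
      by (rule cell_distance[OF k(1)]; use u(2) in linarith)+
    \<comment> \<open>One h stems from the window and one from the mesh, which is at most h.\<close>
    then have near: "\<bar>real j / real k - t\<bar> \<le> 2 * h N" using u(1) k(2) by auto
    have dom: "real j / real k \<in> time_domain" using j by auto
    let ?f = "\<lambda>\<omega>. indicator (c j) (T n i \<omega>) :: real" and ?g = "\<lambda>\<omega>. (X (int n) \<omega> (real j / real k) - X (int n) \<omega> t)\<^sup>2"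
    have "indep_var borel ?f borel ?g"
    proof (rule source_algebra_indep_var[OF N, of "{Point n i}" "{Process}"])
      have "T n i \<in> borel_measurable (source_algebra N {Point n i})" by (rule T_source) simp
      then show "?f \<in> borel_measurable (source_algebra N {Point n i})" by measurable
      have "(\<lambda>\<omega>. X (int n) \<omega> (real j / real k)) \<in> borel_measurable (source_algebra N {Process})"
        "(\<lambda>\<omega>. X (int n) \<omega> t) \<in> borel_measurable (source_algebra N {Process})"
        by (rule X_source; use dom t_domain in simp)+
      then show "?g \<in> borel_measurable (source_algebra N {Process})" by measurable
    qed (use n i in \<open>auto simp: sources_def\<close>)
    moreover have "integrable Pr ?f"
      by (rule integrable_const_bound[of _ 1]) auto
    moreover note int[OF dom near]
    ultimately have "integrable Pr (D j)" "(\<integral>\<omega>. D j \<omega> \<partial>Pr) = (\<integral>\<omega>. ?f \<omega> \<partial>Pr) * (\<integral>\<omega>. ?g \<omega> \<partial>Pr)"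
      unfolding D_def by (rule indep_var_integrable, rule indep_var_lebesgue_integral)
    moreover have "(\<integral>\<omega>. ?f \<omega> \<partial>Pr) * (\<integral>\<omega>. ?g \<omega> \<partial>Pr) \<le> (\<integral>\<omega>. ?f \<omega> \<partial>Pr) * B"
      by (rule mult_left_mono[OF bound[OF dom near]]) simp
    ultimately show ?thesis by (simp add: mult.commute)
  qed
  have eq: "grid_increment N k n i = (\<lambda>\<omega>. \<Sum>j=1..k. D j \<omega>)"
    by (auto simp: grid_increment_def D_def c_def)
  show "integrable Pr (grid_increment N k n i)"
    unfolding eq using D by (intro Bochner_Integration.integrable_sum) blast
  have ind: "integrable Pr (\<lambda>\<omega>. indicator A (T n i \<omega>) :: real)" if "A \<in> sets borel" for A
    by (rule integrable_const_bound[of _ 1]) (use that in auto)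
  have "(\<integral>\<omega>. grid_increment N k n i \<omega> \<partial>Pr) = (\<Sum>j=1..k. \<integral>\<omega>. D j \<omega> \<partial>Pr)"
    unfolding eq using D by (intro Bochner_Integration.integral_sum) blast
  also have "\<dots> \<le> (\<Sum>j=1..k. B * (\<integral>\<omega>. indicator (c j) (T n i \<omega>) \<partial>Pr))"
    using D by (intro sum_mono) blast
  also have "\<dots> = B * (\<integral>\<omega>. (\<Sum>j=1..k. indicator (c j) (T n i \<omega>)) \<partial>Pr)"
    using ind[OF cm] by (simp add: sum_distrib_left Bochner_Integration.integral_sum)
  also have "\<dots> \<le> B * (\<integral>\<omega>. indicator {t - h N..t + h N} (T n i \<omega>) \<partial>Pr)"
  proof (intro mult_left_mono[OF _ B] integral_mono)
    fix \<omega>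
    let ?u = "T n i \<omega>"
    have "(\<Sum>j=1..k. indicator (c j) ?u) \<le> (\<Sum>j=1..k. if j = nat \<lceil>real k * ?u\<rceil> then indicator {t - h N..t + h N} ?u else 0 :: real)"
      by (rule sum_mono) (auto simp: c_def indicator_def)
    also have "\<dots> \<le> indicator {t - h N..t + h N} ?u" by (simp add: sum.delta)
    finally show "(\<Sum>j=1..k. indicator (c j) ?u) \<le> (indicator {t - h N..t + h N} ?u :: real)" .
  qed (use ind in auto)
  also have "(\<integral>\<omega>. indicator {t - h N..t + h N} (T n i \<omega>) \<partial>Pr) = prob (T n i -` {t - h N..t + h N} \<inter> space Pr)"
  proof -
    have "(\<integral>\<omega>. indicator {t - h N..t + h N} (T n i \<omega>) \<partial>Pr) = (\<integral>\<omega>. indicator (T n i -` {t - h N..t + h N} \<inter> space Pr) \<omega> \<partial>Pr)"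
      by (rule Bochner_Integration.integral_cong) (auto simp: indicator_def)
    also have "\<dots> = prob (T n i -` {t - h N..t + h N} \<inter> space Pr)"
      by (simp only: Bochner_Integration.integral_indicator Int_assoc Int_absorb)
    finally show ?thesis .
  qed
  finally show "(\<integral>\<omega>. grid_increment N k n i \<omega> \<partial>Pr) \<le> B * prob (T n i -` {t - h N..t + h N} \<inter> space Pr)" .
qed

text \<open>By continuity of the paths the grid sums converge almost surely to a bound of the
  squared bias, and Fatou's lemma passes on the bound of their expectations, which is uniform in the
  mesh. Nonnegative integrals are used since integrability is part of the conclusion.\<close>

lemma bias_second_moment:
  assumes N: "1 \<le> N" and h: "0 < h N" and m: "\<And>k. k \<in> set_pmf (Mlaw N) \<Longrightarrow> k \<le> m"
    and int: "\<And>n u. u \<in> time_domain \<Longrightarrow> \<bar>u - t\<bar> \<le> 2 * h N \<Longrightarrow>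
      integrable Pr (\<lambda>\<omega>. (X n \<omega> u - X n \<omega> t)\<^sup>2)"
    and bound: "\<And>n u. u \<in> time_domain \<Longrightarrow> \<bar>u - t\<bar> \<le> 2 * h N \<Longrightarrow>
      (\<integral>\<omega>. (X n \<omega> u - X n \<omega> t)\<^sup>2 \<partial>Pr) \<le> B" and B: "0 \<le> B"
    and q: "\<And>n i. 1 \<le> n \<Longrightarrow> 1 \<le> i \<Longrightarrow> prob (T n i -` {t - h N..t + h N} \<inter> space Pr) \<le> q"
  shows "integrable Pr (\<lambda>\<omega>. (bias N \<omega>)\<^sup>2)" "(\<integral>\<omega>. (bias N \<omega>)\<^sup>2 \<partial>Pr) \<le> real N * (real m * (B * q))"
proof -
  define b where "b = real N * (real m * (B * q))"
  have q0: "0 \<le> q" using q[of 1 1] measure_nonneg order_trans by (metis le_refl)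
  have b0: "0 \<le> b" using B q0 by (simp add: b_def)
  define D where "D k \<omega> = (\<Sum>n=1..N. \<Sum>i=1..m. grid_increment N k n i \<omega>)" for k \<omega>
  obtain k0 :: nat where k0: "1 / h N < real k0" using reals_Archimedean2 by blast
  have kk: "1 \<le> k \<and> 1 / real k \<le> h N" if "k0 \<le> k" for k
  proof -
    have "1 / h N < real k" using k0 that by linarith
    moreover have "0 < 1 / h N" using h by simp
    ultimately have "0 < real k" by linarith
    then show ?thesis using \<open>1 / h N < real k\<close> h by (auto simp: field_simps)
  qed
  have gi: "integrable Pr (grid_increment N k n i)"
    "(\<integral>\<omega>. grid_increment N k n i \<omega> \<partial>Pr) \<le> B * q" if "k0 \<le> k" "n \<in> {1..N}" "1 \<le> i" for k n i
  proof -
    have k: "1 \<le> k" "1 / real k \<le> h N" using kk[OF that(1)] by auto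
    note * = grid_increment_expectation[OF N that(2,3) k int bound B]
    show "integrable Pr (grid_increment N k n i)" by (rule *(1))
    have "B * prob (T n i -` {t - h N..t + h N} \<inter> space Pr) \<le> B * q"
      using that by (intro mult_left_mono q B) auto
    then show "(\<integral>\<omega>. grid_increment N k n i \<omega> \<partial>Pr) \<le> B * q" using *(2) by linarith
  qed
  have D0: "0 \<le> D k \<omega>" for k \<omega>
    unfolding D_def grid_increment_def by (intro sum_nonneg mult_nonneg_nonneg) auto
  have Dm: "D k \<in> borel_measurable Pr" for k
    unfolding D_def[abs_def] grid_increment_def
  proof (intro borel_measurable_sum borel_measurable_times borel_measurable_power borel_measurable_diff)
    fix n i j assume A: "n \<in> {1..N}" "i \<in> {1..m}" "j \<in> {1..k}"
    show "(\<lambda>\<omega>. indicator {u \<in> {t - h N..t + h N}. \<lceil>real k * u\<rceil> = int j} (T n i \<omega>) :: real) \<in> borel_measurable Pr"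
      by (rule measurable_compose[OF T_measurable borel_measurable_indicator[OF cell_measurable]]) (use A in auto)
    show "(\<lambda>\<omega>. X (int n) \<omega> (real j / real k)) \<in> borel_measurable Pr"
      by (rule X_measurable) (use A in auto)
    show "(\<lambda>\<omega>. X (int n) \<omega> t) \<in> borel_measurable Pr" by (rule X_measurable[OF t_domain])
  qed
  have D_int: "(\<integral>\<^sup>+\<omega>. ennreal (D k \<omega>) \<partial>Pr) \<le> ennreal b" if k: "k0 \<le> k" for k
  proof -
    have i: "integrable Pr (D k)"
      unfolding D_def[abs_def] using gi(1)[OF k] by (intro Bochner_Integration.integrable_sum) auto
    have "(\<integral>\<omega>. D k \<omega> \<partial>Pr) = (\<Sum>n=1..N. \<Sum>i=1..m. \<integral>\<omega>. grid_increment N k n i \<omega> \<partial>Pr)"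
      unfolding D_def using gi(1)[OF k]
      by (subst Bochner_Integration.integral_sum; (intro Bochner_Integration.integrable_sum sum.cong refl Bochner_Integration.integral_sum)?) auto
    also have "\<dots> \<le> (\<Sum>n=1..N. \<Sum>i=1..m. B * q)"
      using gi(2)[OF k] by (intro sum_mono) auto
    also have "\<dots> = b" by (simp add: b_def)
    finally show ?thesis
      using nn_integral_eq_integral[OF i] D0 by (simp add: ennreal_leI)
  qed
  have paths: "AE \<omega> in Pr. \<forall>n\<in>{1..N}. continuous_on time_domain (X (int n) \<omega>)"
    by (rule AE_finite_allI) (use continuous_paths in auto)
  have AE: "AE \<omega> in Pr. ennreal ((bias N \<omega>)\<^sup>2) \<le> liminf (\<lambda>k. ennreal (D k \<omega>))"
    using T_AE count_AE[OF N] paths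
  proof eventually_elim
    case (elim \<omega>)
    have lim1: "(\<lambda>k. grid_increment N k n i \<omega>) \<longlonglongrightarrow> indicator {t - h N..t + h N} (T n i \<omega>) *
        (X (int n) \<omega> (T n i \<omega>) - X (int n) \<omega> t)\<^sup>2" if n: "n \<in> {1..N}" and i: "i \<in> {1..m}" for n i
    proof -
      let ?u = "T n i \<omega>"
      define r where "r k = of_int \<lceil>real k * ?u\<rceil> / real k" for k
      have u: "?u \<in> time_domain" using elim(1) n i by auto
      note ge = grid_increment_eq[OF u, folded r_def]
      have "(\<lambda>k. 1 / real k) \<longlonglongrightarrow> 0" by (rule lim_1_over_n)
      then have "(\<lambda>k. r k - ?u) \<longlonglongrightarrow> 0"
        by (rule Lim_null_comparison[rotated]) (use ge(3) in \<open>auto simp: eventually_sequentially intro!: exI[of _ 1]\<close>)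
      then have r: "r \<longlonglongrightarrow> ?u" by (rule LIM_zero_cancel)
      have "(\<lambda>k. X (int n) \<omega> (r k)) \<longlonglongrightarrow> X (int n) \<omega> ?u"
        by (rule continuous_on_tendsto_compose[OF _ r u])
          (use elim(3) n ge(2) in \<open>auto simp: eventually_sequentially intro!: exI[of _ 1]\<close>)
      then have "(\<lambda>k. indicator {t - h N..t + h N} ?u * (X (int n) \<omega> (r k) - X (int n) \<omega> t)\<^sup>2) \<longlonglongrightarrow>
          indicator {t - h N..t + h N} ?u * (X (int n) \<omega> ?u - X (int n) \<omega> t)\<^sup>2"
        by (intro tendsto_intros)
      then show ?thesis
        by (rule Lim_transform_eventually)
          (use ge(1) in \<open>auto simp: eventually_sequentially intro!: exI[of _ 1]\<close>)
    qed
    define L where "L = (\<Sum>n=1..N. \<Sum>i=1..m. indicator {t - h N..t + h N} (T n i \<omega>) *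
      (X (int n) \<omega> (T n i \<omega>) - X (int n) \<omega> t)\<^sup>2)"
    have "(\<lambda>k. D k \<omega>) \<longlonglongrightarrow> L"
      unfolding D_def L_def by (intro tendsto_sum lim1)
    then have "(\<lambda>k. ennreal (D k \<omega>)) \<longlonglongrightarrow> ennreal L" by (intro tendsto_intros)
    then have "liminf (\<lambda>k. ennreal (D k \<omega>)) = ennreal L"
      by (intro lim_imp_Liminf) auto
    moreover have "(bias N \<omega>)\<^sup>2 \<le> L"
      unfolding L_def by (rule bias_square_le[OF h]) (use elim m in auto)
    ultimately show ?case by (simp add: ennreal_leI)
  qed
  have "(\<integral>\<^sup>+\<omega>. ennreal ((bias N \<omega>)\<^sup>2) \<partial>Pr) \<le> (\<integral>\<^sup>+\<omega>. liminf (\<lambda>k. ennreal (D k \<omega>)) \<partial>Pr)"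
    by (rule nn_integral_mono_AE[OF AE])
  also have "\<dots> \<le> liminf (\<lambda>k. \<integral>\<^sup>+\<omega>. ennreal (D k \<omega>) \<partial>Pr)"
    by (rule nn_integral_liminf) (use Dm in auto)
  also have "\<dots> \<le> liminf (\<lambda>k. ennreal b)"
    by (rule Liminf_mono) (use D_int in \<open>auto simp: eventually_sequentially\<close>)
  also have "\<dots> = ennreal b" by (rule Liminf_const) simp
  finally have I: "(\<integral>\<^sup>+\<omega>. ennreal ((bias N \<omega>)\<^sup>2) \<partial>Pr) \<le> ennreal b" .
  show int: "integrable Pr (\<lambda>\<omega>. (bias N \<omega>)\<^sup>2)"
    by (rule integrableI_bounded) (use I bias_measurable[of N] in \<open>auto intro: order.strict_trans1\<close>)
  show "(\<integral>\<omega>. (bias N \<omega>)\<^sup>2 \<partial>Pr) \<le> real N * (real m * (B * q))"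
    using I nn_integral_eq_integral[OF int] b0 by (simp add: ennreal_le_iff b_def)
qed

end

section \<open>Convergence of the characteristic functions\<close>

text \<open>The remainder of the second order expansion is a truncated third moment, which vanishes
  as the argument tends to 0 by dominated convergence with the second moment as majorant.\<close>

lemma (in real_distribution) char_gaussian_approx:
  assumes int: "integrable M (\<lambda>x. x)" "expectation (\<lambda>x. x) = 0"
    "integrable M (\<lambda>x. x\<^sup>2)" "expectation (\<lambda>x. x\<^sup>2) = 1" and \<eta>: "0 < \<eta>"
  obtains \<rho> where "0 < \<rho>" "\<And>x. \<bar>x\<bar> \<le> \<rho> \<Longrightarrow> cmod (char M x - of_real (exp (- (x\<^sup>2 / 2)))) \<le> \<eta> * x\<^sup>2"
proof -
  define \<psi> where "\<psi> s = expectation (\<lambda>x. min (6 * x\<^sup>2) (\<bar>s\<bar> * \<bar>x\<bar> ^ 3))" for s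
  have dom: "integrable M (\<lambda>x. 6 * x\<^sup>2)" using int by simp
  have i\<psi>: "integrable M (\<lambda>x. min (6 * x\<^sup>2) (\<bar>s\<bar> * \<bar>x\<bar> ^ 3))" for s
    by (rule integrable_nonneg_le[OF dom]) auto
  have "(\<lambda>n. \<psi> (1 / real n)) \<longlonglongrightarrow> expectation (\<lambda>x. 0)"
    unfolding \<psi>_def
  proof (rule integral_dominated_convergence[where w = "\<lambda>x. 6 * x\<^sup>2"])
    show "AE x in M. (\<lambda>n. min (6 * x\<^sup>2) (\<bar>1 / real n\<bar> * \<bar>x\<bar> ^ 3)) \<longlonglongrightarrow> 0"
    proof (rule AE_I2)
      fix x :: real
      have "(\<lambda>n. min (6 * x\<^sup>2) (\<bar>1 / real n\<bar> * \<bar>x\<bar> ^ 3)) \<longlonglongrightarrow> min (6 * x\<^sup>2) (\<bar>0\<bar> * \<bar>x\<bar> ^ 3)"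
        by (intro tendsto_intros lim_1_over_n)
      then show "(\<lambda>n. min (6 * x\<^sup>2) (\<bar>1 / real n\<bar> * \<bar>x\<bar> ^ 3)) \<longlonglongrightarrow> 0" by simp
    qed
  qed (use dom in auto)
  then have "(\<lambda>n. \<psi> (1 / real n)) \<longlonglongrightarrow> 0" by simp
  then have "\<forall>\<^sub>F n in sequentially. \<psi> (1 / real n) < \<eta>"
    by (rule order_tendstoD(2)[OF _ \<eta>])
  then have "\<forall>\<^sub>F n in sequentially. 1 \<le> n \<and> \<psi> (1 / real n) < \<eta>"
    by (intro eventually_conj eventually_ge_at_top)
  then obtain n where n: "1 \<le> n" "\<psi> (1 / real n) < \<eta>"
    using eventually_happens'[OF sequentially_bot] by blast
  \<comment> \<open>The first bound makes the truncated moment at most \<eta>, as it increases in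
    |s|. The second gives x^2 <= \<eta>, so that exp (- x^2 / 2) and 1 - x^2 / 2 differ by at most
    x^4 / 4 <= \<eta> x^2 / 4. The total is 1 / 6 + 1 / 4 times \<eta> x^2.\<close>
  define \<rho> where "\<rho> = min (1 / real n) (sqrt \<eta>)"
  show thesis
  proof (rule that)
    show "0 < \<rho>" using n(1) \<eta> by (simp add: \<rho>_def)
    fix x :: real assume x: "\<bar>x\<bar> \<le> \<rho>"
    have var: "variance (\<lambda>x. x) = 1" using int by simp
    have xn: "\<bar>x\<bar> \<le> \<bar>1 / real n\<bar>" using x by (simp add: \<rho>_def)
    have "\<psi> x \<le> \<psi> (1 / real n)"
      unfolding \<psi>_def
      by (rule integral_mono[OF i\<psi> i\<psi>]) (intro min.mono order_refl mult_right_mono xn zero_le_power abs_ge_zero)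
    then have "\<psi> x \<le> \<eta>" using n(2) by simp
    have c3: "cmod (char M x - (1 - x\<^sup>2 / 2)) \<le> x\<^sup>2 / 6 * \<eta>"
    proof -
      have "cmod (char M x - (1 - x\<^sup>2 / 2)) \<le> x\<^sup>2 / 6 * \<psi> x"
        using char_approx3[OF int(1,2,3) var, of x] by (simp add: \<psi>_def)
      also have "\<dots> \<le> x\<^sup>2 / 6 * \<eta>" using \<open>\<psi> x \<le> \<eta>\<close> by (intro mult_left_mono) auto
      finally show ?thesis .
    qed
    define y where "y = x\<^sup>2 / 2"
    have y: "0 \<le> y" by (simp add: y_def)
    have "exp (- y) \<le> 1 / (1 + y)"
      using y exp_ge_add_one_self[of y] by (simp add: exp_minus field_simps)
    also have "\<dots> \<le> 1 - y + y\<^sup>2"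
      using y by (simp add: field_simps power2_eq_square)
    finally have "\<bar>(1 - y) - exp (- y)\<bar> \<le> y\<^sup>2"
      using exp_ge_add_one_self[of "- y"] by linarith
    also have "y\<^sup>2 \<le> \<eta> / 4 * x\<^sup>2"
    proof -
      have "\<bar>x\<bar> \<le> sqrt \<eta>" using x by (simp add: \<rho>_def)
      then have "\<bar>x\<bar>\<^sup>2 \<le> (sqrt \<eta>)\<^sup>2" by (rule power_mono) simp
      then have "x\<^sup>2 \<le> \<eta>" using \<eta> by simp
      then have "x\<^sup>2 * x\<^sup>2 \<le> \<eta> * x\<^sup>2" by (intro mult_right_mono) auto
      then show ?thesis by (simp add: y_def power2_eq_square)
    qed
    finally have le: "\<bar>(1 - y) - exp (- y)\<bar> \<le> \<eta> / 4 * x\<^sup>2" .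
    have "complex_of_real (1 - x\<^sup>2 / 2) - complex_of_real (exp (- (x\<^sup>2 / 2))) = complex_of_real ((1 - y) - exp (- y))"
      by (simp add: y_def)
    then have e: "cmod (complex_of_real (1 - x\<^sup>2 / 2) - of_real (exp (- (x\<^sup>2 / 2)))) \<le> \<eta> / 4 * x\<^sup>2"
      using le by (simp only: norm_of_real)
    have "cmod (char M x - of_real (exp (- (x\<^sup>2 / 2)))) \<le> x\<^sup>2 / 6 * \<eta> + \<eta> / 4 * x\<^sup>2"
      using norm_triangle_ineq[of "char M x - of_real (1 - x\<^sup>2 / 2)" "of_real (1 - x\<^sup>2 / 2) - of_real (exp (- (x\<^sup>2 / 2)))"] c3 e by (simp add: mult.commute[of "x\<^sup>2" \<eta>])
    also have "\<dots> = 5 / 12 * (\<eta> * x\<^sup>2)" by simp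
    also have "\<dots> \<le> \<eta> * x\<^sup>2" using \<eta> by (simp add: mult_left_le_one_le)
    finally show "cmod (char M x - of_real (exp (- (x\<^sup>2 / 2)))) \<le> \<eta> * x\<^sup>2" .
  qed
qed

lemma char_normal:
  assumes s: "0 < s"
  shows "char (density lborel (normal_density 0 s)) u = of_real (exp (- (u\<^sup>2 * s\<^sup>2 / 2)))"
proof -
  let ?std = "std_normal_distribution"
  interpret N: prob_space ?std by (rule prob_space_normal_density) simp
  have "distributed ?std lborel (\<lambda>x. x) (normal_density 0 1)"
    by (simp add: distributed_def distr_id2)
  from N.normal_density_affine[OF this, of s 0]
  have "distributed ?std lborel (\<lambda>x. s * x) (normal_density 0 s)"
    using s by simp
  then have "density lborel (normal_density 0 s) = distr ?std lborel (\<lambda>x. s * x)"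
    by (simp add: distributed_distr_eq_density)
  then have "char (density lborel (normal_density 0 s)) u = (\<integral>x. iexp (u * x) \<partial>distr ?std lborel (\<lambda>x. s * x))"
    by (simp add: char_def)
  also have "\<dots> = (\<integral>x. iexp (u * (s * x)) \<partial>?std)"
    by (rule integral_distr) auto
  also have "\<dots> = char ?std (u * s)" by (simp add: char_def mult.assoc)
  also have "\<dots> = of_real (exp (- (u\<^sup>2 * s\<^sup>2 / 2)))"
    by (simp add: char_std_normal_distribution power_mult_distrib)
  finally show ?thesis .
qed

context local_smoothing
begin

text \<open>The variance of the noise for a frozen design; the noise level is taken at the
  points.\<close>

definition var_noise :: "nat \<Rightarrow> 'a \<Rightarrow> real" where
  "var_noise N \<omega> = (\<Sum>n=1..N. \<Sum>i=1..Mc N n \<omega>. (coef N n i \<omega>)\<^sup>2)"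

text \<open>The quantity whose limit is assumed; it differs from \<open>var_noise\<close> by taking
  the noise level at \<open>t\<close>.\<close>

definition var_plug :: "nat \<Rightarrow> 'a \<Rightarrow> real" where
  "var_plug N \<omega> = (\<sigma> t)\<^sup>2 / PN N \<omega> * (\<Sum>n=1..N. \<pi> N n \<omega> * (\<Sum>i=1..Mc N n \<omega>. (W N n i \<omega>)\<^sup>2))"

lemma var_plug_measurable: "var_plug N \<in> borel_measurable Pr"
  unfolding var_plug_def[abs_def]
  by (intro borel_measurable_times borel_measurable_divide borel_measurable_sum random_sum_measurable borel_measurable_power
      \<pi>_measurable PN_measurable W_measurable Mc_measurable) auto

lemma sigma_lipschitz:
  obtains C where "0 \<le> C" "\<And>u. u \<in> time_domain \<Longrightarrow> \<bar>(\<sigma> u)\<^sup>2 - (\<sigma> t)\<^sup>2\<bar> \<le> C * \<bar>u - t\<bar>"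
proof -
  obtain C where C: "C-lipschitz_on time_domain (\<lambda>u. (\<sigma> u)\<^sup>2)" using variance_lipschitz by blast
  show thesis
  proof (rule that)
    show "0 \<le> C" using C by (rule lipschitz_on_nonneg)
    show "\<bar>(\<sigma> u)\<^sup>2 - (\<sigma> t)\<^sup>2\<bar> \<le> C * \<bar>u - t\<bar>" if "u \<in> time_domain" for u
      using lipschitz_onD[OF C that t_domain] by (simp add: dist_real_def)
  qed
qed

text \<open>The domain has length 1, so the Lipschitz bound on the squared noise level is a bound
  everywhere.\<close>

lemma \<sigma>0_bounded: obtains b where "0 \<le> b" "\<And>u. \<bar>\<sigma>0 u\<bar> \<le> b"
proof -
  obtain C where C: "0 \<le> C" "\<And>u. u \<in> time_domain \<Longrightarrow> \<bar>(\<sigma> u)\<^sup>2 - (\<sigma> t)\<^sup>2\<bar> \<le> C * \<bar>u - t\<bar>"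
    by (rule sigma_lipschitz) (rule that; assumption)
  show thesis
  proof (rule that)
    show "0 \<le> sqrt ((\<sigma> t)\<^sup>2 + C)" using C(1) by simp
    fix u
    show "\<bar>\<sigma>0 u\<bar> \<le> sqrt ((\<sigma> t)\<^sup>2 + C)"
    proof (cases "u \<in> time_domain")
      case True
      have "\<bar>u - t\<bar> \<le> 1" using True t_domain by auto
      then have "C * \<bar>u - t\<bar> \<le> C" using C(1) by (simp add: mult_left_le)
      then have "(\<sigma> u)\<^sup>2 \<le> (\<sigma> t)\<^sup>2 + C" using C(2)[OF True] by linarith
      then show ?thesis using True by (simp add: \<sigma>0_def real_le_rsqrt)
    next
      case False
      then have "\<sigma>0 u = 0" by (auto simp: \<sigma>0_def)
      then show ?thesis using C(1) by simp
    qed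
  qed
qed

text \<open>Uniform smallness of the single weights once many curves are selected; it takes the part
  of a Lindeberg condition for the noise.\<close>

lemma coef_bound:
  assumes "0 < h N" "\<And>u. \<bar>\<sigma>0 u\<bar> \<le> b" "i \<in> {1..Mc N n \<omega>}"
  shows "\<bar>coef N n i \<omega>\<bar> \<le> b / sqrt (PN N \<omega>)"
proof -
  have b: "0 \<le> b" using assms(2)[of 0] by linarith
  have "\<bar>\<pi> N n \<omega>\<bar> * \<bar>W N n i \<omega>\<bar> * \<bar>\<sigma>0 (T n i \<omega>)\<bar> \<le> 1 * 1 * b"
    using W_facts(1)[OF assms(1), of n i \<omega>] W_facts(5)[OF assms(1,3)] \<pi>_values[of N n \<omega>] assms(2) b
    by (intro mult_mono) auto
  then have "(\<bar>\<pi> N n \<omega>\<bar> * \<bar>W N n i \<omega>\<bar> * \<bar>\<sigma>0 (T n i \<omega>)\<bar>) / sqrt (PN N \<omega>) \<le> b / sqrt (PN N \<omega>)"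
    using PN_nonneg[of N \<omega>] by (intro divide_right_mono) auto
  then show ?thesis using PN_nonneg[of N \<omega>] by (simp add: coef_def abs_mult)
qed

text \<open>A nonzero weight puts its point within h of \<open>t\<close>, where the squared noise
  level changes by at most C h. The squared weights of a curve sum to at most 1, and dividing by the
  number of selected curves leaves an average.\<close>

lemma var_noise_approx:
  assumes h: "0 < h N" and C: "0 \<le> C" "\<And>u. u \<in> time_domain \<Longrightarrow> \<bar>(\<sigma> u)\<^sup>2 - (\<sigma> t)\<^sup>2\<bar> \<le> C * \<bar>u - t\<bar>"
    and T: "\<And>n i. 1 \<le> n \<Longrightarrow> 1 \<le> i \<Longrightarrow> T n i \<omega> \<in> time_domain"
  shows "\<bar>var_noise N \<omega> - var_plug N \<omega>\<bar> \<le> C * h N"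
proof (cases "PN N \<omega> = 0")
  case True
  then show ?thesis using C h by (simp add: var_noise_def var_plug_def coef_def)
next
  case False
  let ?P = "PN N \<omega>"
  have P: "0 < ?P" using False PN_nonneg[of N \<omega>] by simp
  have \<pi>2: "(\<pi> N n \<omega>)\<^sup>2 = \<pi> N n \<omega>" for n using \<pi>_values[of N n \<omega>] by auto
  have vn: "var_noise N \<omega> = (\<Sum>n=1..N. \<pi> N n \<omega> * (\<Sum>i=1..Mc N n \<omega>. (W N n i \<omega>)\<^sup>2 * (\<sigma>0 (T n i \<omega>))\<^sup>2)) / ?P"
    using P by (simp add: var_noise_def coef_def power_mult_distrib power_divide \<pi>2 sum_distrib_left sum_divide_distrib mult_ac)
  have vp: "var_plug N \<omega> = (\<Sum>n=1..N. \<pi> N n \<omega> * (\<Sum>i=1..Mc N n \<omega>. (W N n i \<omega>)\<^sup>2 * (\<sigma> t)\<^sup>2)) / ?P"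
    by (simp add: var_plug_def sum_distrib_left sum_divide_distrib mult_ac)
  have "var_noise N \<omega> - var_plug N \<omega>
    = (\<Sum>n=1..N. \<pi> N n \<omega> * (\<Sum>i=1..Mc N n \<omega>. (W N n i \<omega>)\<^sup>2 * ((\<sigma>0 (T n i \<omega>))\<^sup>2 - (\<sigma> t)\<^sup>2))) / ?P"
    unfolding vn vp by (simp add: diff_divide_distrib sum_subtractf right_diff_distrib)
  then have "\<bar>var_noise N \<omega> - var_plug N \<omega>\<bar>
    = \<bar>\<Sum>n=1..N. \<pi> N n \<omega> * (\<Sum>i=1..Mc N n \<omega>. (W N n i \<omega>)\<^sup>2 * ((\<sigma>0 (T n i \<omega>))\<^sup>2 - (\<sigma> t)\<^sup>2))\<bar> / ?P"
    using P by simp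
  also have "\<dots> \<le> (\<Sum>n=1..N. \<pi> N n \<omega> * (C * h N)) / ?P"
  proof (intro divide_right_mono order_trans[OF sum_abs] sum_mono)
    fix n assume n: "n \<in> {1..N}"
    have "\<bar>\<Sum>i=1..Mc N n \<omega>. (W N n i \<omega>)\<^sup>2 * ((\<sigma>0 (T n i \<omega>))\<^sup>2 - (\<sigma> t)\<^sup>2)\<bar>
      \<le> (\<Sum>i=1..Mc N n \<omega>. (W N n i \<omega>)\<^sup>2 * (C * h N))"
    proof (intro order_trans[OF sum_abs] sum_mono)
      fix i assume i: "i \<in> {1..Mc N n \<omega>}"
      show "\<bar>(W N n i \<omega>)\<^sup>2 * ((\<sigma>0 (T n i \<omega>))\<^sup>2 - (\<sigma> t)\<^sup>2)\<bar> \<le> (W N n i \<omega>)\<^sup>2 * (C * h N)"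
      proof (cases "W N n i \<omega> = 0")
        case False
        have u: "T n i \<omega> \<in> time_domain" using T n i by auto
        have "\<bar>T n i \<omega> - t\<bar> \<le> h N" using W_facts(2)[OF h False] by auto
        then have "C * \<bar>T n i \<omega> - t\<bar> \<le> C * h N" using C(1) by (rule mult_left_mono)
        then have "\<bar>(\<sigma>0 (T n i \<omega>))\<^sup>2 - (\<sigma> t)\<^sup>2\<bar> \<le> C * h N"
          using C(2)[OF u] u by (simp add: \<sigma>0_def)
        then show ?thesis by (simp add: abs_mult mult_left_mono)
      qed simp
    qed
    also have "\<dots> = (\<Sum>i=1..Mc N n \<omega>. (W N n i \<omega>)\<^sup>2) * (C * h N)" by (simp add: sum_distrib_right)
    also have "\<dots> \<le> 1 * (C * h N)" using W_square_sum[OF h, of n \<omega>] C h by (intro mult_right_mono) auto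
    finally show "\<bar>\<pi> N n \<omega> * (\<Sum>i=1..Mc N n \<omega>. (W N n i \<omega>)\<^sup>2 * ((\<sigma>0 (T n i \<omega>))\<^sup>2 - (\<sigma> t)\<^sup>2))\<bar> \<le> \<pi> N n \<omega> * (C * h N)"
      using \<pi>_values[of N n \<omega>] by auto
  qed (use P in auto)
  also have "\<dots> = C * h N" using P by (simp add: PN_sum sum_distrib_right[symmetric])
  finally show ?thesis .
qed

text \<open>The difference of two products of numbers in the unit disc is at most the sum of the
  differences of the factors. The errors, each \<eta> times the square of u times a weight, add up
  to \<eta> u^2 times the noise variance, whatever the number of factors.\<close>

lemma noise_char_approx:
  assumes h: "0 < h N" and b: "\<And>u. \<bar>\<sigma>0 u\<bar> \<le> b"
    and \<rho>: "\<And>x. \<bar>x\<bar> \<le> \<rho> \<Longrightarrow> cmod (char noise_law x - of_real (exp (- (x\<^sup>2 / 2)))) \<le> \<eta> * x\<^sup>2"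
    and small: "\<bar>u\<bar> * (b / sqrt (PN N \<omega>)) \<le> \<rho>"
  shows "cmod ((\<Prod>n=1..N. \<Prod>i=1..Mc N n \<omega>. char noise_law (u * coef N n i \<omega>))
      - of_real (exp (- (u\<^sup>2 * var_noise N \<omega> / 2)))) \<le> \<eta> * u\<^sup>2 * var_noise N \<omega>"
proof -
  interpret nl: real_distribution noise_law by (rule noise_law)
  define I where "I = Sigma {1..N} (\<lambda>n. {1..Mc N n \<omega>})"
  define a where "a x = coef N (fst x) (snd x) \<omega>" for x
  have prod_I: "(\<Prod>n=1..N. \<Prod>i=1..Mc N n \<omega>. f (coef N n i \<omega>)) = (\<Prod>x\<in>I. f (a x))" for f :: "real \<Rightarrow> complex"
    unfolding I_def a_def by (subst prod.Sigma) (auto simp: case_prod_beta)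
  have sum_I: "var_noise N \<omega> = (\<Sum>x\<in>I. (a x)\<^sup>2)"
    unfolding var_noise_def I_def a_def by (subst sum.Sigma) (auto simp: case_prod_beta)
  have "exp (- (u\<^sup>2 * var_noise N \<omega> / 2)) = (\<Prod>x\<in>I. exp (- ((u * a x)\<^sup>2 / 2)))"
    unfolding sum_I by (subst exp_sum[symmetric])
      (auto simp: I_def sum_negf power_mult_distrib sum_distrib_left sum_divide_distrib)
  then have e: "of_real (exp (- (u\<^sup>2 * var_noise N \<omega> / 2))) = (\<Prod>x\<in>I. complex_of_real (exp (- ((u * a x)\<^sup>2 / 2))))"
    by (simp only: of_real_prod)
  have "cmod ((\<Prod>x\<in>I. char noise_law (u * a x)) - (\<Prod>x\<in>I. complex_of_real (exp (- ((u * a x)\<^sup>2 / 2)))))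
    \<le> (\<Sum>x\<in>I. cmod (char noise_law (u * a x) - of_real (exp (- ((u * a x)\<^sup>2 / 2)))))"
    by (rule norm_prod_diff) (auto simp: nl.cmod_char_le_1)
  also have "\<dots> \<le> (\<Sum>x\<in>I. \<eta> * (u * a x)\<^sup>2)"
  proof (rule sum_mono, rule \<rho>)
    fix x assume "x \<in> I"
    then have "\<bar>a x\<bar> \<le> b / sqrt (PN N \<omega>)"
      unfolding a_def using coef_bound[OF h b] by (auto simp: I_def)
    then have "\<bar>u * a x\<bar> \<le> \<bar>u\<bar> * (b / sqrt (PN N \<omega>))"
      unfolding abs_mult by (rule mult_left_mono) simp
    then show "\<bar>u * a x\<bar> \<le> \<rho>" using small by linarith
  qed
  also have "\<dots> = \<eta> * u\<^sup>2 * var_noise N \<omega>"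
    by (simp add: sum_I sum_distrib_left power_mult_distrib mult.assoc)
  finally show ?thesis unfolding e prod_I[of "\<lambda>c. char noise_law (u * c)"] .
qed

text \<open>Uniformity over index sets lets the limit theorem act on each frozen design. Off three
  events of small probability (a variance of the signal or of the noise away from its limit, too few
  selected curves) the conditional characteristic function is close to the target. It is bounded by
  1 everywhere, so the expectations converge.\<close>

theorem char_limit:
  assumes clt: "\<And>u v0 \<eta>. 0 < \<eta> \<Longrightarrow> \<exists>P0. \<forall>A V. finite A \<longrightarrow> P0 \<le> card A \<longrightarrow>
      V = (\<integral>\<omega>. (\<Sum>n\<in>A. X n \<omega> t - \<mu>t)\<^sup>2 \<partial>Pr) / real (card A) \<longrightarrow> V \<le> v0 \<longrightarrow>
      cmod ((\<integral>\<omega>. iexp (u * ((\<Sum>n\<in>A. X n \<omega> t - \<mu>t) / sqrt (real (card A)))) \<partial>Pr)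
        - of_real (exp (- (u\<^sup>2 * V / 2)))) \<le> \<eta>"
    and V_meas: "\<And>N. 1 \<le> N \<Longrightarrow> V N \<in> borel_measurable Pr"
    and V_AE: "\<And>N. 1 \<le> N \<Longrightarrow> AE \<omega> in Pr. V N \<omega> = var_sel N \<omega>"
    and V_lim: "tendsto_in_prob Pr V Smu" and S0: "0 \<le> Smu"
    and Q_lim: "tendsto_in_prob Pr var_plug Sig" and Sig0: "0 \<le> Sig"
    and P_lim: "\<And>x. (\<lambda>N. prob {\<omega> \<in> space Pr. PN N \<omega> < x}) \<longlonglongrightarrow> 0"
    and h0: "h \<longlonglongrightarrow> 0" and hpos: "\<forall>\<^sub>F N in sequentially. 0 < h N"
  shows "(\<lambda>N. \<integral>\<omega>. iexp (u * (signal N \<omega> + noise N \<omega>)) \<partial>Pr) \<longlonglongrightarrow> of_real (exp (- (u\<^sup>2 * (Smu + Sig) / 2)))"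
proof (rule metric_LIMSEQ_I)
  fix e :: real assume e: "0 < e"
  interpret nl: real_distribution noise_law by (rule noise_law)
  define target where "target = complex_of_real (exp (- (u\<^sup>2 * (Smu + Sig) / 2)))"
  \<comment> \<open>Dominates the sum of the factors of \<eta> in the four comparisons
    \<open>p1\<close> to \<open>p4\<close> below.\<close>
  define k where "k = 2 + 3 * u\<^sup>2 + u\<^sup>2 * (Sig + 2)"
  have k: "0 < k"
    unfolding k_def using Sig0 by (intro add_pos_nonneg mult_nonneg_nonneg) auto
  define \<eta> where "\<eta> = e / (4 * k)"
  have \<eta>: "0 < \<eta>" using e k by (simp add: \<eta>_def)
  \<comment> \<open>The cap 1 keeps the two variances below \<open>Smu + 1\<close> and
    \<open>Sig + 2\<close>, up to which the comparisons are uniform.\<close>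
  define \<delta> where "\<delta> = min \<eta> 1"
  have \<delta>: "0 < \<delta>" "\<delta> \<le> 1" "\<delta> \<le> \<eta>" using \<eta> by (auto simp: \<delta>_def)
  obtain C where C: "0 \<le> C" "\<And>u. u \<in> time_domain \<Longrightarrow> \<bar>(\<sigma> u)\<^sup>2 - (\<sigma> t)\<^sup>2\<bar> \<le> C * \<bar>u - t\<bar>"
    by (rule sigma_lipschitz) (rule that; assumption)
  obtain b where b: "0 \<le> b" "\<And>u. \<bar>\<sigma>0 u\<bar> \<le> b"
    by (rule \<sigma>0_bounded) (rule that; assumption)
  obtain \<rho> where \<rho>: "0 < \<rho>" "\<And>x. \<bar>x\<bar> \<le> \<rho> \<Longrightarrow> cmod (char noise_law x - of_real (exp (- (x\<^sup>2 / 2)))) \<le> \<eta> * x\<^sup>2"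
    by (rule nl.char_gaussian_approx[OF noise_centered noise_unit_variance \<eta>]) (rule that; assumption)
  obtain P0 where P0: "\<And>A V. finite A \<Longrightarrow> P0 \<le> card A \<Longrightarrow>
      V = (\<integral>\<omega>. (\<Sum>n\<in>A. X n \<omega> t - \<mu>t)\<^sup>2 \<partial>Pr) / real (card A) \<Longrightarrow> V \<le> Smu + 1 \<Longrightarrow>
      cmod ((\<integral>\<omega>. iexp (u * ((\<Sum>n\<in>A. X n \<omega> t - \<mu>t) / sqrt (real (card A)))) \<partial>Pr)
        - of_real (exp (- (u\<^sup>2 * V / 2)))) \<le> \<eta>"
    using clt[OF \<eta>, of "Smu + 1" u] by blast
  \<comment> \<open>This many selected curves suffice for the uniform limit theorem and make |u| b /
    sqrt PN at most \<rho>; the added 1 keeps PN positive.\<close>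
  define x0 where "x0 = max (real P0) ((\<bar>u\<bar> * b / \<rho>)\<^sup>2 + 1)"
  define B1 where "B1 N = {\<omega> \<in> space Pr. \<bar>V N \<omega> - Smu\<bar> > \<delta>}" for N
  define B2 where "B2 N = {\<omega> \<in> space Pr. \<bar>var_plug N \<omega> - Sig\<bar> > \<delta>}" for N
  define B3 where "B3 N = {\<omega> \<in> space Pr. PN N \<omega> < x0}" for N
  have lims: "(\<lambda>N. prob (B1 N)) \<longlonglongrightarrow> 0" "(\<lambda>N. prob (B2 N)) \<longlonglongrightarrow> 0" "(\<lambda>N. prob (B3 N)) \<longlonglongrightarrow> 0"
    using V_lim Q_lim P_lim \<delta>(1) unfolding tendsto_in_prob_def B1_def B2_def B3_def by auto
  have Ch: "(\<lambda>N. C * h N) \<longlonglongrightarrow> 0" using tendsto_mult[OF tendsto_const h0, of C] by simp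
  \<comment> \<open>Each of the three events costs at most 2 times e / 12. Together with e / 4 off
    them this stays below e.\<close>
  have e12: "0 < e / 12" using e by simp
  have ev: "\<forall>\<^sub>F N in sequentially. dist (\<integral>\<omega>. iexp (u * (signal N \<omega> + noise N \<omega>)) \<partial>Pr) target < e"
    using order_tendstoD(2)[OF lims(1) e12] order_tendstoD(2)[OF lims(2) e12]
      order_tendstoD(2)[OF lims(3) e12] order_tendstoD(2)[OF Ch \<delta>(1)] hpos eventually_ge_at_top[of 1]
  proof eventually_elim
    case (elim N)
    have N: "1 \<le> N" and h: "0 < h N" using elim by auto
    have Bm: "B1 N \<in> sets Pr" "B2 N \<in> sets Pr" "B3 N \<in> sets Pr"
      unfolding B1_def B2_def B3_def using V_meas[OF N] var_plug_measurable[of N] PN_measurable[of N] by measurable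
    have good: "AE \<omega> in Pr. \<omega> \<notin> B1 N \<union> B2 N \<union> B3 N \<longrightarrow> cmod (cond_char N u \<omega> - target) \<le> e / 4"
      using V_AE[OF N] T_AE AE_space
    proof eventually_elim
      case (elim \<omega>)
      show ?case
      proof
        assume nb: "\<omega> \<notin> B1 N \<union> B2 N \<union> B3 N"
        let ?\<phi> = "\<integral>\<omega>'. iexp (u * ((\<Sum>n\<in>selected N \<omega>. X n \<omega>' t - \<mu>t) / sqrt (real (card (selected N \<omega>))))) \<partial>Pr"
        let ?\<chi> = "\<Prod>n=1..N. \<Prod>i=1..Mc N n \<omega>. char noise_law (u * coef N n i \<omega>)"
        have Vd: "\<bar>var_sel N \<omega> - Smu\<bar> \<le> \<delta>" using nb elim by (auto simp: B1_def not_less)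
        have Qd: "\<bar>var_plug N \<omega> - Sig\<bar> \<le> \<delta>" using nb elim(3) by (auto simp: B2_def not_less)
        have Px: "x0 \<le> PN N \<omega>" using nb elim(3) by (auto simp: B3_def not_less)
        have v0: "0 \<le> var_sel N \<omega>" by (simp add: var_sel_def)
        have n0: "0 \<le> var_noise N \<omega>" by (auto simp: var_noise_def intro!: sum_nonneg)
        have "\<bar>var_noise N \<omega> - var_plug N \<omega>\<bar> \<le> C * h N"
          by (rule var_noise_approx[OF h C]) (use elim(2) in auto)
        then have nd: "\<bar>var_noise N \<omega> - Sig\<bar> \<le> 2 * \<delta>" using Qd \<open>C * h N < \<delta>\<close> by linarith
        have card: "P0 \<le> card (selected N \<omega>)" using Px by (simp add: x0_def PN_card)
        have p1: "cmod (?\<phi> - of_real (exp (- (u\<^sup>2 * var_sel N \<omega> / 2)))) \<le> \<eta>"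
          by (rule P0[OF finite_selected card]) (use Vd \<delta> in \<open>auto simp: var_sel_def\<close>)
        have p2: "cmod (of_real (exp (- (u\<^sup>2 * var_sel N \<omega> / 2))) - of_real (exp (- (u\<^sup>2 * Smu / 2)))) \<le> u\<^sup>2 * \<eta>"
        proof -
          have "cmod (of_real (exp (- (u\<^sup>2 * var_sel N \<omega> / 2))) - of_real (exp (- (u\<^sup>2 * Smu / 2))))
            \<le> \<bar>u\<^sup>2 * var_sel N \<omega> / 2 - u\<^sup>2 * Smu / 2\<bar>"
            by (rule exp_neg_lipschitz) (use v0 S0 in auto)
          also have "\<dots> = u\<^sup>2 * (\<bar>var_sel N \<omega> - Smu\<bar> / 2)"
            by (simp add: abs_mult flip: right_diff_distrib diff_divide_distrib)
          also have "\<dots> \<le> u\<^sup>2 * \<eta>" by (rule mult_left_mono) (use Vd \<delta> in auto)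
          finally show ?thesis .
        qed
        have PNpos: "0 < PN N \<omega>" using Px by (smt (verit) x0_def zero_le_power2)
        have small: "\<bar>u\<bar> * (b / sqrt (PN N \<omega>)) \<le> \<rho>"
        proof -
          have "(\<bar>u\<bar> * b / \<rho>)\<^sup>2 \<le> PN N \<omega>" using Px by (simp add: x0_def)
          then have "\<bar>u\<bar> * b / \<rho> \<le> sqrt (PN N \<omega>)" by (rule real_le_rsqrt)
          then show ?thesis using \<rho>(1) PNpos by (simp add: field_simps)
        qed
        have p3: "cmod (?\<chi> - of_real (exp (- (u\<^sup>2 * var_noise N \<omega> / 2)))) \<le> u\<^sup>2 * (Sig + 2) * \<eta>"
        proof -
          have "cmod (?\<chi> - of_real (exp (- (u\<^sup>2 * var_noise N \<omega> / 2)))) \<le> \<eta> * u\<^sup>2 * var_noise N \<omega>"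
            by (rule noise_char_approx[OF h b(2) \<rho>(2) small])
          also have "\<dots> \<le> \<eta> * u\<^sup>2 * (Sig + 2)"
            using nd \<delta> \<eta> by (intro mult_left_mono) auto
          finally show ?thesis by (simp add: mult_ac)
        qed
        have p4: "cmod (of_real (exp (- (u\<^sup>2 * var_noise N \<omega> / 2))) - of_real (exp (- (u\<^sup>2 * Sig / 2)))) \<le> u\<^sup>2 * \<eta>"
        proof -
          have "cmod (of_real (exp (- (u\<^sup>2 * var_noise N \<omega> / 2))) - of_real (exp (- (u\<^sup>2 * Sig / 2))))
            \<le> \<bar>u\<^sup>2 * var_noise N \<omega> / 2 - u\<^sup>2 * Sig / 2\<bar>"
            by (rule exp_neg_lipschitz) (use n0 Sig0 in auto)
          also have "\<dots> = u\<^sup>2 * (\<bar>var_noise N \<omega> - Sig\<bar> / 2)"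
            by (simp add: abs_mult flip: right_diff_distrib diff_divide_distrib)
          also have "\<dots> \<le> u\<^sup>2 * \<eta>" by (rule mult_left_mono) (use nd \<delta> in auto)
          finally show ?thesis .
        qed
        have q1: "cmod (?\<phi> - of_real (exp (- (u\<^sup>2 * Smu / 2)))) \<le> \<eta> + u\<^sup>2 * \<eta>"
          by (rule norm_diff_triangle_le[OF p1 p2])
        have q2: "cmod (?\<chi> - of_real (exp (- (u\<^sup>2 * Sig / 2)))) \<le> u\<^sup>2 * (Sig + 2) * \<eta> + u\<^sup>2 * \<eta>"
          by (rule norm_diff_triangle_le[OF p3 p4])
        have chi1: "cmod ?\<chi> \<le> 1"
          unfolding prod_norm[symmetric] by (intro prod_le_1 conjI norm_ge_zero prod_nonneg nl.cmod_char_le_1 ballI)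
        have "target = of_real (exp (- (u\<^sup>2 * Smu / 2))) * of_real (exp (- (u\<^sup>2 * Sig / 2)))"
          by (simp add: target_def distrib_left add_divide_distrib flip: of_real_mult exp_add)
        then have "cond_char N u \<omega> - target
          = (?\<phi> - of_real (exp (- (u\<^sup>2 * Smu / 2)))) * ?\<chi>
            + of_real (exp (- (u\<^sup>2 * Smu / 2))) * (?\<chi> - of_real (exp (- (u\<^sup>2 * Sig / 2))))"
          by (simp add: cond_char_def algebra_simps)
        also have "cmod \<dots> \<le> (\<eta> + u\<^sup>2 * \<eta>) * 1 + 1 * (u\<^sup>2 * (Sig + 2) * \<eta> + u\<^sup>2 * \<eta>)"
        proof (intro norm_triangle_le add_mono)
          show "cmod ((?\<phi> - of_real (exp (- (u\<^sup>2 * Smu / 2)))) * ?\<chi>) \<le> (\<eta> + u\<^sup>2 * \<eta>) * 1"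
            unfolding norm_mult by (rule mult_mono[OF q1 chi1]) (use \<eta> in auto)
          show "cmod (of_real (exp (- (u\<^sup>2 * Smu / 2))) * (?\<chi> - of_real (exp (- (u\<^sup>2 * Sig / 2)))))
              \<le> 1 * (u\<^sup>2 * (Sig + 2) * \<eta> + u\<^sup>2 * \<eta>)"
            unfolding norm_mult by (rule mult_mono[OF _ q2]) (use S0 in auto)
        qed
        also have "\<dots> \<le> k * \<eta>"
          using \<eta> by (simp add: k_def algebra_simps)
        also have "\<dots> = e / 4" using k by (simp add: \<eta>_def)
        finally show "cmod (cond_char N u \<omega> - target) \<le> e / 4" .
      qed
    qed
    have cc: "cmod (cond_char N u \<omega>) \<le> 1" for \<omega>
    proof -
      have "cmod (\<integral>\<omega>'. iexp (u * ((\<Sum>n\<in>selected N \<omega>. X n \<omega>' t - \<mu>t) / sqrt (real (card (selected N \<omega>))))) \<partial>Pr)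
        \<le> (\<integral>\<omega>'. 1 \<partial>Pr)"
        by (rule norm_integral_le_integral) auto
      moreover have "cmod (\<Prod>n=1..N. \<Prod>i=1..Mc N n \<omega>. char noise_law (u * coef N n i \<omega>)) \<le> 1"
        unfolding prod_norm[symmetric] by (intro prod_le_1 conjI norm_ge_zero prod_nonneg nl.cmod_char_le_1 ballI)
      ultimately show ?thesis
        unfolding cond_char_def norm_mult by (simp add: prob_space mult_le_one)
    qed
    have tt: "cmod target \<le> 1" using S0 Sig0 by (simp add: target_def)
    have icc: "integrable Pr (cond_char N u)"
      by (rule integrable_const_bound[of _ 1]) (use cc cond_char(2)[OF N] in auto)
    let ?g = "\<lambda>\<omega>. e / 4 + 2 * (indicator (B1 N) \<omega> + indicator (B2 N) \<omega> + indicator (B3 N) \<omega> :: real)"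
    have ig: "integrable Pr ?g" using Bm by (simp add: emeasure_eq_measure)
    have "cmod ((\<integral>\<omega>. cond_char N u \<omega> \<partial>Pr) - target) = cmod (\<integral>\<omega>. cond_char N u \<omega> - target \<partial>Pr)"
      using icc by (simp add: prob_space)
    also have "\<dots> \<le> (\<integral>\<omega>. cmod (cond_char N u \<omega> - target) \<partial>Pr)"
      by (rule integral_norm_bound)
    also have "\<dots> \<le> (\<integral>\<omega>. ?g \<omega> \<partial>Pr)"
    proof (rule integral_mono_AE[OF _ ig])
      show "integrable Pr (\<lambda>\<omega>. cmod (cond_char N u \<omega> - target))" using icc by simp
      show "AE \<omega> in Pr. cmod (cond_char N u \<omega> - target) \<le> ?g \<omega>"
        using good
      proof eventually_elim
        case (elim \<omega>)
        have "cmod (cond_char N u \<omega> - target) \<le> 2"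
          using norm_triangle_ineq4[of "cond_char N u \<omega>" target] cc[of \<omega>] tt by linarith
        then show ?case using elim e by (auto simp: indicator_def)
      qed
    qed
    also have "\<dots> = e / 4 + 2 * (prob (B1 N) + prob (B2 N) + prob (B3 N))"
      using Bm by (simp add: prob_space emeasure_eq_measure)
    also have "\<dots> < e" using elim(1,2,3) e by argo
    finally show ?case unfolding cond_char(1)[OF N] dist_norm .
  qed
  show "\<exists>no. \<forall>n\<ge>no. dist (\<integral>\<omega>. iexp (u * (signal n \<omega> + noise n \<omega>)) \<partial>Pr) (of_real (exp (- (u\<^sup>2 * (Smu + Sig) / 2)))) < e"
    using ev unfolding target_def eventually_sequentially .
qed

end

section \<open>Asymptotic normality\<close>

context local_smoothing
begin

text \<open>The squared increment is a measurable function of two coordinates of the path family,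
  whose law is invariant under shifts.\<close>

lemma increment_stationary:
  assumes u: "u \<in> time_domain"
  shows "integrable Pr (\<lambda>\<omega>. (X n \<omega> u - X n \<omega> t)\<^sup>2) \<longleftrightarrow> integrable Pr (\<lambda>\<omega>. (X 0 \<omega> u - X 0 \<omega> t)\<^sup>2)"
    "(\<integral>\<omega>. (X n \<omega> u - X n \<omega> t)\<^sup>2 \<partial>Pr) = (\<integral>\<omega>. (X 0 \<omega> u - X 0 \<omega> t)\<^sup>2 \<partial>Pr)"
proof -
  define \<Phi> where "\<Phi> x = (x (0, u) - x (0, t))\<^sup>2" for x :: "int \<times> real \<Rightarrow> real"
  have \<Phi>: "\<Phi> \<in> borel_measurable path_family_space"
    unfolding \<Phi>_def[abs_def]
    by (intro borel_measurable_power borel_measurable_diff measurable_component_singleton) (use u t_domain in auto)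
  have path: "path_family (\<lambda>k. X (k + n)) \<in> measurable Pr path_family_space" for n
    unfolding path_family_def[abs_def]
    by (intro measurable_restrict) (auto intro!: X_measurable)
  have eq: "\<Phi> (path_family (\<lambda>k. X (k + n)) \<omega>) = (X n \<omega> u - X n \<omega> t)\<^sup>2" for n \<omega>
    using u t_domain by (simp add: \<Phi>_def path_family_def)
  have distr: "distr Pr path_family_space (path_family (\<lambda>k. X (k + n))) = distr Pr path_family_space (path_family (\<lambda>k. X (k + 0)))" for n
    using stationary by (simp add: strictly_stationary_def)
  show "integrable Pr (\<lambda>\<omega>. (X n \<omega> u - X n \<omega> t)\<^sup>2) \<longleftrightarrow> integrable Pr (\<lambda>\<omega>. (X 0 \<omega> u - X 0 \<omega> t)\<^sup>2)"
    using integrable_distr_eq[OF path[of n] \<Phi>] integrable_distr_eq[OF path[of 0] \<Phi>]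
    unfolding distr[of n] eq by blast
  show "(\<integral>\<omega>. (X n \<omega> u - X n \<omega> t)\<^sup>2 \<partial>Pr) = (\<integral>\<omega>. (X 0 \<omega> u - X 0 \<omega> t)\<^sup>2 \<partial>Pr)"
    using integral_distr[OF path[of n] \<Phi>] integral_distr[OF path[of 0] \<Phi>]
    unfolding distr[of n] eq by (rule trans[OF sym])
qed

text \<open>Placing the base point of the regularity condition at \<open>t\<close>, as one end of
  the interval, yields the exponent belonging to \<open>t\<close>. The correction has a larger
  exponent and is absorbed at distances up to 1.\<close>

lemma increment_bound:
  assumes reg: "local_regularity Pr X J H L" and t: "t \<in> J"
  obtains r C where "0 < r" "0 \<le> C" "{t - r..t + r} \<subseteq> J"
    "\<And>n u. \<bar>u - t\<bar> \<le> r \<Longrightarrow> integrable Pr (\<lambda>\<omega>. (X n \<omega> u - X n \<omega> t)\<^sup>2)"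
    "\<And>n u. \<bar>u - t\<bar> \<le> r \<Longrightarrow> (\<integral>\<omega>. (X n \<omega> u - X n \<omega> t)\<^sup>2 \<partial>Pr) \<le> C * \<bar>u - t\<bar> powr (2 * H t)"
proof -
  have J: "open J" "J \<subseteq> time_domain"
    and int: "\<And>u. u \<in> J \<Longrightarrow> integrable Pr (\<lambda>\<omega>. (X 0 \<omega> u)\<^sup>2)"
    using reg by (auto simp: local_regularity_def)
  have "\<exists>\<beta>\<^sub>0 S\<^sub>0 \<Delta>\<^sub>0. 0 < \<beta>\<^sub>0 \<and> 0 < S\<^sub>0 \<and> 0 < \<Delta>\<^sub>0 \<and>
       (\<forall>t\<in>J. \<forall>u\<in>J. \<forall>v\<in>J. t - \<Delta>\<^sub>0 / 2 \<le> u \<and> u \<le> t \<and> t \<le> v \<and> v \<le> t + \<Delta>\<^sub>0 / 2 \<longrightarrow>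
         \<bar>(\<integral>\<omega>. (X 0 \<omega> u - X 0 \<omega> v)\<^sup>2 \<partial>Pr) - (L t)\<^sup>2 * \<bar>u - v\<bar> powr (2 * H t)\<bar>
           \<le> S\<^sub>0\<^sup>2 * \<bar>u - v\<bar> powr (2 * H t + 2 * \<beta>\<^sub>0))"
    using reg unfolding local_regularity_def by (elim conjE)
  then obtain \<beta> S0 \<Delta> where \<beta>: "0 < \<beta>" "0 < \<Delta>"
    and inc_all: "\<forall>t\<in>J. \<forall>u\<in>J. \<forall>v\<in>J. t - \<Delta> / 2 \<le> u \<and> u \<le> t \<and> t \<le> v \<and> v \<le> t + \<Delta> / 2 \<longrightarrow>
         \<bar>(\<integral>\<omega>. (X 0 \<omega> u - X 0 \<omega> v)\<^sup>2 \<partial>Pr) - (L t)\<^sup>2 * \<bar>u - v\<bar> powr (2 * H t)\<bar>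
           \<le> S0\<^sup>2 * \<bar>u - v\<bar> powr (2 * H t + 2 * \<beta>)"
    by (elim exE conjE)
  note inc = inc_all[rule_format, OF t]
  obtain d where d: "0 < d" "\<And>u. dist u t < d \<Longrightarrow> u \<in> J"
    using J(1) t unfolding open_dist by blast
  define r where "r = min (min (\<Delta> / 2) (d / 2)) 1"
  have r: "0 < r" "r \<le> \<Delta> / 2" "r < d" "r \<le> 1" using \<beta> d(1) by (auto simp: r_def)
  have inJ: "u \<in> J" if "\<bar>u - t\<bar> \<le> r" for u
    using d(2)[of u] that r(3) by (simp add: dist_real_def)
  show thesis
  proof (rule that)
    show "0 < r" by (rule r)
    show "0 \<le> (L t)\<^sup>2 + S0\<^sup>2" by simp
    show "{t - r..t + r} \<subseteq> J" using inJ by (auto simp: abs_le_iff)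
    fix n u assume u: "\<bar>u - t\<bar> \<le> r"
    have uJ: "u \<in> J" by (rule inJ[OF u])
    then have ud: "u \<in> time_domain" using J(2) by blast
    have [measurable]: "(\<lambda>\<omega>. X 0 \<omega> u) \<in> borel_measurable Pr" "(\<lambda>\<omega>. X 0 \<omega> t) \<in> borel_measurable Pr"
      by (rule X_measurable[OF ud], rule X_measurable[OF t_domain])
    have "integrable Pr (\<lambda>\<omega>. (X 0 \<omega> u - X 0 \<omega> t)\<^sup>2)"
    proof (rule integrable_nonneg_le)
      show "integrable Pr (\<lambda>\<omega>. 2 * (X 0 \<omega> u)\<^sup>2 + 2 * (X 0 \<omega> t)\<^sup>2)"
        using int[OF uJ] int[OF t] by simp
      show "(X 0 \<omega> u - X 0 \<omega> t)\<^sup>2 \<le> 2 * (X 0 \<omega> u)\<^sup>2 + 2 * (X 0 \<omega> t)\<^sup>2" for \<omega>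
        using zero_le_power2[of "X 0 \<omega> u + X 0 \<omega> t"] by (simp add: power2_eq_square algebra_simps)
    qed auto
    then show "integrable Pr (\<lambda>\<omega>. (X n \<omega> u - X n \<omega> t)\<^sup>2)"
      using increment_stationary(1)[OF ud] by blast
    have "\<bar>(\<integral>\<omega>. (X 0 \<omega> u - X 0 \<omega> t)\<^sup>2 \<partial>Pr) - (L t)\<^sup>2 * \<bar>u - t\<bar> powr (2 * H t)\<bar>
        \<le> S0\<^sup>2 * \<bar>u - t\<bar> powr (2 * H t + 2 * \<beta>)"
    \<comment> \<open>The condition orders its two arguments around the base point, so
      \<open>t\<close> is the right end in one case and the left end in the other.\<close>
    proof (cases "u \<le> t")
      case True
      then show ?thesis using inc[OF uJ t] u r(2) by simp
    next
      case False
      then show ?thesis using inc[OF t uJ] u r(2) by (simp add: power2_commute abs_minus_commute)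
    qed
    also have "\<dots> \<le> S0\<^sup>2 * \<bar>u - t\<bar> powr (2 * H t)"
      using u r(4) \<beta>(1) by (intro mult_left_mono powr_mono') auto
    finally have "(\<integral>\<omega>. (X 0 \<omega> u - X 0 \<omega> t)\<^sup>2 \<partial>Pr) \<le> (L t)\<^sup>2 * \<bar>u - t\<bar> powr (2 * H t) + S0\<^sup>2 * \<bar>u - t\<bar> powr (2 * H t)"
      by linarith
    then show "(\<integral>\<omega>. (X n \<omega> u - X n \<omega> t)\<^sup>2 \<partial>Pr) \<le> ((L t)\<^sup>2 + S0\<^sup>2) * \<bar>u - t\<bar> powr (2 * H t)"
      unfolding increment_stationary(2)[OF ud, of n] by (simp add: distrib_right)
  qed
qed

text \<open>The grid condition gives N \<lambda> h >= Z log (N \<lambda>) eventually for every Z >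
  0, and the logarithm is at least 1 for large N because \<lambda> is bounded away from 0.
  Positivity of the bandwidths is derived from N \<lambda> h >= 1.\<close>

lemma grid_limits:
  assumes grid: "bandwidth_grid lam \<H>" and h: "\<And>N. 1 \<le> N \<Longrightarrow> h N \<in> \<H> N"
  shows "\<forall>\<^sub>F N in sequentially. 0 < h N" "h \<longlonglongrightarrow> 0"
    "filterlim (\<lambda>N. real N * lam N * h N) at_top sequentially"
proof -
  obtain C where C: "0 < C" "\<And>N. 1 \<le> N \<Longrightarrow> 0 < lam N" "\<And>N. 1 \<le> N \<Longrightarrow> 2 / C \<le> lam N"
    by (rule lam_bounds) (rule that; assumption)
  have fin: "\<And>N. 1 \<le> N \<Longrightarrow> finite (\<H> N)" and Max: "(\<lambda>N. Max (\<H> N)) \<longlonglongrightarrow> 0"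
    and Min: "filterlim (\<lambda>N. real N * lam N * Min (\<H> N) / ln (real N * lam N)) at_top sequentially"
    using grid by (auto simp: bandwidth_grid_def)
  have hb: "Min (\<H> N) \<le> h N" "h N \<le> Max (\<H> N)" if "1 \<le> N" for N
    using fin[OF that] h[OF that] by auto
  have "filterlim (\<lambda>N. 2 / C * real N) at_top sequentially"
    by (rule filterlim_tendsto_pos_mult_at_top[OF tendsto_const _ filterlim_real_sequentially]) (use C(1) in simp)
  then have big: "\<forall>\<^sub>F N in sequentially. exp 1 \<le> 2 / C * real N"
    unfolding filterlim_at_top by blast
  show top: "filterlim (\<lambda>N. real N * lam N * h N) at_top sequentially"
    unfolding filterlim_at_top_gt[where c = 0]
  proof (intro allI impI)
    fix Z :: real assume Z: "0 < Z"
    have "\<forall>\<^sub>F N in sequentially. Z \<le> real N * lam N * Min (\<H> N) / ln (real N * lam N)"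
      using Min unfolding filterlim_at_top by blast
    then show "\<forall>\<^sub>F N in sequentially. Z \<le> real N * lam N * h N"
      using big eventually_ge_at_top[of 1]
    proof eventually_elim
      case (elim N)
      have "2 / C * real N \<le> lam N * real N" using C(3)[OF elim(3)] by (rule mult_right_mono) simp
      then have e: "exp 1 \<le> real N * lam N" using elim(2) by (simp add: mult.commute)
      then have "ln (exp 1) \<le> ln (real N * lam N)" by (intro ln_mono) auto
      then have l: "1 \<le> ln (real N * lam N)" by simp
      have "Z * 1 \<le> Z * ln (real N * lam N)" using l Z by (intro mult_left_mono) auto
      also have "\<dots> \<le> real N * lam N * Min (\<H> N)"
        using elim(1) l by (simp add: pos_le_divide_eq)
      also have "\<dots> \<le> real N * lam N * h N"
        using hb(1)[OF elim(3)] C(2)[OF elim(3)] by (intro mult_left_mono) auto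
      finally show ?case by simp
    qed
  qed
  show pos: "\<forall>\<^sub>F N in sequentially. 0 < h N"
  proof -
    have "\<forall>\<^sub>F N in sequentially. 1 \<le> real N * lam N * h N"
      using top unfolding filterlim_at_top by blast
    then show ?thesis using eventually_ge_at_top[of 1]
    proof eventually_elim
      case (elim N)
      have "0 < (real N * lam N) * h N" using elim(1) by linarith
      moreover have "0 < real N * lam N" using elim(2) C(2)[OF elim(2)] by simp
      ultimately show ?case by (simp only: zero_less_mult_pos)
    qed
  qed
  show "h \<longlonglongrightarrow> 0"
  proof (rule tendsto_sandwich[OF _ _ tendsto_const Max])
    show "\<forall>\<^sub>F N in sequentially. 0 \<le> h N" using pos by eventually_elim simp
    show "\<forall>\<^sub>F N in sequentially. h N \<le> Max (\<H> N)"
      using eventually_ge_at_top[of 1] by eventually_elim (rule hb(2))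
  qed
qed

text \<open>The four factors of the second moment bound are N, a multiple of \<lambda> for the
  counts, a multiple of h^(2 H) for the increments and a multiple of h for the window. Their product
  is a constant times the power 2 H + 1 of (N \<lambda>)^(1 / (2 H + 1)) h.\<close>

lemma bias_vanishes:
  assumes reg: "local_regularity Pr X J H L" and tJ: "t \<in> J"
    and hpos: "\<forall>\<^sub>F N in sequentially. 0 < h N" and h0: "h \<longlonglongrightarrow> 0"
    and small: "(\<lambda>N. (real N * lam N) powr (1 / (2 * H t + 1)) * h N) \<longlonglongrightarrow> 0"
  obtains \<beta> where "\<beta> \<longlonglongrightarrow> 0" "\<And>N. 0 \<le> \<beta> N"
    "\<forall>\<^sub>F N in sequentially. integrable Pr (\<lambda>\<omega>. (bias N \<omega>)\<^sup>2) \<and> (\<integral>\<omega>. (bias N \<omega>)\<^sup>2 \<partial>Pr) \<le> \<beta> N"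
proof -
  obtain r C0 where r: "0 < r" "0 \<le> C0"
    and inc: "\<And>n u. \<bar>u - t\<bar> \<le> r \<Longrightarrow> integrable Pr (\<lambda>\<omega>. (X n \<omega> u - X n \<omega> t)\<^sup>2)"
      "\<And>n u. \<bar>u - t\<bar> \<le> r \<Longrightarrow> (\<integral>\<omega>. (X n \<omega> u - X n \<omega> t)\<^sup>2 \<partial>Pr) \<le> C0 * \<bar>u - t\<bar> powr (2 * H t)"
    by (rule increment_bound[OF reg tJ]) (rule that; assumption)
  obtain c C where C: "0 < C" "\<And>N. 1 \<le> N \<Longrightarrow> 0 < lam N"
    "\<And>N m. 1 \<le> N \<Longrightarrow> m \<in> set_pmf (Mlaw N) \<Longrightarrow> c * lam N \<le> real m \<and> real m \<le> C * lam N"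
    by (rule lam_bounds) (rule that; assumption)
  obtain Cg where Cg: "0 < Cg"
    "\<And>n i a b. 1 \<le> n \<Longrightarrow> 1 \<le> i \<Longrightarrow> a \<le> b \<Longrightarrow> prob (T n i -` {a..b} \<inter> space Pr) \<le> Cg * (b - a)"
    by (rule T_prob_bounds) (rule that; assumption)
  have H0: "0 < H t" using reg tJ by (simp add: local_regularity_def)
  define s where "s = 2 * H t + 1"
  have s: "0 < s" using H0 by (simp add: s_def)
  define k where "k = C * C0 * 2 powr (2 * H t) * (2 * Cg)"
  have k: "0 \<le> k" using C(1) r(2) Cg(1) by (simp add: k_def)
  define y where "y N = (real N * lam N) powr (1 / s) * h N" for N
  define \<beta> where "\<beta> N = k * \<bar>y N\<bar> powr s" for N
  have y0: "y \<longlonglongrightarrow> 0" using small by (simp add: y_def[abs_def] s_def)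
  have ev: "\<forall>\<^sub>F N in sequentially. h N < r / 2" using h0 by (rule order_tendstoD(2)) (use r in simp)
  show thesis
  proof (rule that)
    have "(\<lambda>N. \<bar>y N\<bar> powr s) \<longlonglongrightarrow> 0"
      by (rule tendsto_zero_powrI[OF tendsto_rabs_zero[OF y0] tendsto_const _ s]) simp
    then show "\<beta> \<longlonglongrightarrow> 0"
      unfolding \<beta>_def[abs_def] by (rule tendsto_mult_right_zero)
    show "0 \<le> \<beta> N" for N using k by (simp add: \<beta>_def)
    show "\<forall>\<^sub>F N in sequentially. integrable Pr (\<lambda>\<omega>. (bias N \<omega>)\<^sup>2) \<and> (\<integral>\<omega>. (bias N \<omega>)\<^sup>2 \<partial>Pr) \<le> \<beta> N"
      using hpos ev eventually_ge_at_top[of 1]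
    proof eventually_elim
      case (elim N)
      note hN = elim(1) and N = elim(3)
      define m where "m = nat \<lfloor>C * lam N\<rfloor>"
      define B where "B = C0 * (2 * h N) powr (2 * H t)"
      define q where "q = Cg * (2 * h N)"
      have m: "k \<le> m" if "k \<in> set_pmf (Mlaw N)" for k
        using C(3)[OF N that] unfolding m_def by linarith
      have mC: "real m \<le> C * lam N"
        using C(1) C(2)[OF N] unfolding m_def by (simp add: of_nat_nat)
      have B: "0 \<le> B" using r(2) by (simp add: B_def)
      have i: "integrable Pr (\<lambda>\<omega>. (X n \<omega> u - X n \<omega> t)\<^sup>2)" if "\<bar>u - t\<bar> \<le> 2 * h N" for n u
        by (rule inc(1)) (use that elim(2) in linarith)
      have b: "(\<integral>\<omega>. (X n \<omega> u - X n \<omega> t)\<^sup>2 \<partial>Pr) \<le> B" if "\<bar>u - t\<bar> \<le> 2 * h N" for n u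
      proof -
        have "(\<integral>\<omega>. (X n \<omega> u - X n \<omega> t)\<^sup>2 \<partial>Pr) \<le> C0 * \<bar>u - t\<bar> powr (2 * H t)"
          by (rule inc(2)) (use that elim(2) in linarith)
        also have "\<dots> \<le> B"
          unfolding B_def using that r(2) H0 by (intro mult_left_mono powr_mono2) auto
        finally show ?thesis .
      qed
      have q: "prob (T n i -` {t - h N..t + h N} \<inter> space Pr) \<le> q" if "1 \<le> n" "1 \<le> i" for n i
        using Cg(2)[OF that, of "t - h N" "t + h N"] hN by (simp add: q_def)
      have q0: "0 \<le> q" using Cg(1) hN by (simp add: q_def)
      have "integrable Pr (\<lambda>\<omega>. (bias N \<omega>)\<^sup>2)"
        by (rule bias_second_moment(1)[OF N hN m i b B q])
      moreover have "(\<integral>\<omega>. (bias N \<omega>)\<^sup>2 \<partial>Pr) \<le> real N * (real m * (B * q))"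
        by (rule bias_second_moment(2)[OF N hN m i b B q])
      moreover have "real N * (real m * (B * q)) \<le> real N * ((C * lam N) * (B * q))"
        using mC B q0 by (intro mult_left_mono mult_right_mono) auto
      moreover have "real N * ((C * lam N) * (B * q)) = \<beta> N"
      proof -
        have p: "0 < real N * lam N" using N C(2)[OF N] by simp
        have "\<bar>y N\<bar> powr s = ((real N * lam N) powr (1 / s)) powr s * h N powr s"
          using hN p by (simp add: y_def abs_mult powr_mult)
        also have "((real N * lam N) powr (1 / s)) powr s = real N * lam N"
          using s p by (simp add: powr_powr)
        also have "h N powr s = h N powr (2 * H t) * h N"
          using hN by (simp add: s_def powr_add)
        finally have "\<beta> N = k * ((real N * lam N) * (h N powr (2 * H t) * h N))" by (simp add: \<beta>_def)
        then show ?thesis using hN by (simp add: k_def B_def q_def powr_mult)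
      qed
      ultimately show ?case by linarith
    qed
  qed
qed

text \<open>The exponential is Lipschitz, so only the first absolute moment of the bias enters, and
  this is at most the root of the second moment.\<close>

lemma char_bias:
  assumes int: "integrable Pr (\<lambda>\<omega>. (bias N \<omega>)\<^sup>2)" "(\<integral>\<omega>. (bias N \<omega>)\<^sup>2 \<partial>Pr) \<le> b" and b: "0 \<le> b"
  shows "cmod ((\<integral>\<omega>. iexp (u * (sqrt (PN N \<omega>) * (muhat N \<omega> - \<mu>t))) \<partial>Pr)
    - (\<integral>\<omega>. iexp (u * (signal N \<omega> + noise N \<omega>)) \<partial>Pr)) \<le> \<bar>u\<bar> * sqrt b"
proof -
  let ?A = "\<lambda>\<omega>. sqrt (PN N \<omega>) * (muhat N \<omega> - \<mu>t)" and ?B = "\<lambda>\<omega>. signal N \<omega> + noise N \<omega>"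
  have AB: "?A \<omega> - ?B \<omega> = bias N \<omega>" for \<omega> by (simp add: bias_def)
  have [measurable]: "PN N \<in> borel_measurable Pr" "muhat N \<in> borel_measurable Pr"
    "signal N \<in> borel_measurable Pr" "noise N \<in> borel_measurable Pr" "bias N \<in> borel_measurable Pr"
    by (rule PN_measurable muhat_measurable signal_measurable noise_term_measurable bias_measurable)+
  have i: "integrable Pr (\<lambda>\<omega>. iexp (u * ?A \<omega>))" "integrable Pr (\<lambda>\<omega>. iexp (u * ?B \<omega>))"
    by (rule integrable_iexp; simp)+
  have ib: "integrable Pr (bias N)" "(\<integral>\<omega>. \<bar>bias N \<omega>\<bar> \<partial>Pr) \<le> sqrt b"
    using expectation_abs_mult_le[of "bias N" "\<lambda>_. 1" "sqrt b" 1] int b by (auto simp: prob_space)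
  have "cmod (\<integral>\<omega>. iexp (u * ?A \<omega>) - iexp (u * ?B \<omega>) \<partial>Pr) \<le> (\<integral>\<omega>. \<bar>u\<bar> * \<bar>bias N \<omega>\<bar> \<partial>Pr)"
  proof (rule norm_integral_le_integral)
    show "integrable Pr (\<lambda>\<omega>. \<bar>u\<bar> * \<bar>bias N \<omega>\<bar>)" using ib by simp
    fix \<omega>
    have "u * ?A \<omega> - u * ?B \<omega> = u * bias N \<omega>"
      unfolding AB[symmetric] by (rule right_diff_distrib[symmetric])
    then have "\<bar>u * ?A \<omega> - u * ?B \<omega>\<bar> = \<bar>u\<bar> * \<bar>bias N \<omega>\<bar>"
      by (rule ssubst) (rule abs_mult)
    then show "cmod (iexp (u * ?A \<omega>) - iexp (u * ?B \<omega>)) \<le> \<bar>u\<bar> * \<bar>bias N \<omega>\<bar>"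
      by (rule order_trans[OF cmod_iexp_diff_le eq_refl])
  qed
  also have "\<dots> = \<bar>u\<bar> * (\<integral>\<omega>. \<bar>bias N \<omega>\<bar> \<partial>Pr)" by (rule integral_mult_right_zero)
  also have "\<dots> \<le> \<bar>u\<bar> * sqrt b" by (rule mult_left_mono[OF ib(2)]) simp
  finally show ?thesis unfolding Bochner_Integration.integral_diff[OF i] .
qed

end

theorem theorem4:
  fixes Pr :: "'a measure"
    and X :: "int \<Rightarrow> 'a \<Rightarrow> real \<Rightarrow> real"
    and lam :: "nat \<Rightarrow> real"
    and Mlaw :: "nat \<Rightarrow> nat pmf"
    and Mc :: "nat \<Rightarrow> nat \<Rightarrow> 'a \<Rightarrow> nat"
    and g :: "real \<Rightarrow> real"
    and T :: "nat \<Rightarrow> nat \<Rightarrow> 'a \<Rightarrow> real"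
    and \<sigma> :: "real \<Rightarrow> real"
    and noise_law :: "real measure"
    and \<epsilon> :: "nat \<Rightarrow> nat \<Rightarrow> 'a \<Rightarrow> real"
    and J :: "real set" and H L :: "real \<Rightarrow> real"
    and p :: real and S :: "'s measure" and f :: "(nat \<Rightarrow> 's) \<Rightarrow> real \<Rightarrow> real"
    and \<xi> :: "int \<Rightarrow> 'a \<Rightarrow> 's" and \<xi>' :: "int \<Rightarrow> int \<Rightarrow> 'a \<Rightarrow> 's"
    and K :: "real \<Rightarrow> real"
    and \<H> :: "nat \<Rightarrow> real set"
    and Hhat L2hat :: "nat \<Rightarrow> 'a \<Rightarrow> real"
    and t :: real and h :: "nat \<Rightarrow> real"
    and Sigma_t S_mu_t :: real
  defines "PN \<equiv> \<lambda>N \<omega>. sel_count N (\<lambda>n. Mc N n \<omega>) (\<lambda>n i. T n i \<omega>) t (h N)"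
    and "\<pi> \<equiv> \<lambda>N n \<omega>. sel (Mc N n \<omega>) (\<lambda>i. T n i \<omega>) t (h N)"
    and "W \<equiv> \<lambda>N n i \<omega>. nw_weight K (Mc N n \<omega>) (\<lambda>i. T n i \<omega>) t (h N) i"
    and "muhat \<equiv> \<lambda>N \<omega>. mean_hat K N (\<lambda>n. Mc N n \<omega>) (\<lambda>n i. T n i \<omega>) (\<lambda>n i. obs X T \<sigma> \<epsilon> n i \<omega>) t (h N)"
    and "\<mu> \<equiv> mean_fun Pr X"
  assumes model: "sampling_model Pr X lam Mlaw Mc g T \<sigma> noise_law \<epsilon>"
    and regularity: "local_regularity Pr X J H L"
    and dependence: "weakly_dependent Pr X p S f \<xi> \<xi>'"
    and noise_moment: "integrable noise_law (\<lambda>x. \<bar>x\<bar> powr p)"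
    and kernel: "smoothing_kernel K"
    and grid: "bandwidth_grid lam \<H>"
    and estimators: "regularity_estimators Pr (\<lambda>N. data_algebra Pr N (Mc N) T (obs X T \<sigma> \<epsilon>)) lam
                       (H t) (L t) Hhat L2hat"
    and t_in_J: "t \<in> J"
    and h_in_grid: "\<And>N. N \<ge> 1 \<Longrightarrow> h N \<in> \<H> N"
    and h_small: "(\<lambda>N. (real N * lam N) powr (1 / (2 * H t + 1)) * h N) \<longlonglongrightarrow> 0"
    and Sigma_nonneg: "0 \<le> Sigma_t"
    and Sigma_limit:
      "tendsto_in_prob Pr
         (\<lambda>N \<omega>. (\<sigma> t)\<^sup>2 / PN N \<omega> * (\<Sum>n=1..N. \<pi> N n \<omega> * (\<Sum>i=1..Mc N n \<omega>. (W N n i \<omega>)\<^sup>2)))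
         Sigma_t"
    and S_mu_pos: "0 < S_mu_t"
    and S_mu_limit:
      "tendsto_in_prob Pr
         (\<lambda>N. cond_var Pr (design_algebra Pr N (Mc N) T)
                (\<lambda>\<omega>. 1 / sqrt (PN N \<omega>) * (\<Sum>n=1..N. \<pi> N n \<omega> * (X (int n) \<omega> t - \<mu> t))))
         S_mu_t"
  shows "weak_conv_m
           (\<lambda>N. distr Pr borel (\<lambda>\<omega>. sqrt (PN N \<omega>) * (muhat N \<omega> - \<mu> t)))
           (density lborel (normal_density 0 (sqrt (S_mu_t + Sigma_t))))"
proof -
  have tD: "t \<in> time_domain" using regularity t_in_J by (auto simp: local_regularity_def)
  interpret L: local_smoothing Pr X lam Mlaw Mc g T \<sigma> noise_law \<epsilon> K t h
    by (rule local_smoothing.intro[OF model]) (unfold_locales, rule tD, rule kernel)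
  have PN: "PN = L.PN" and muhat: "muhat = L.muhat" and \<mu>: "\<mu> t = L.\<mu>t"
    by (simp_all add: PN_def muhat_def \<mu>_def L.PN_def[abs_def] L.muhat_def[abs_def] L.\<mu>t_def)
  note Xm = L.X_measurable[OF tD]
  note mom = weakly_dependent_moments[OF L.prob_space_axioms dependence Xm tD, folded L.\<mu>t_def]
  have clt: "\<exists>P0. \<forall>A V. finite A \<longrightarrow> P0 \<le> card A \<longrightarrow>
      V = (\<integral>\<omega>. (\<Sum>n\<in>A. X n \<omega> t - L.\<mu>t)\<^sup>2 \<partial>Pr) / real (card A) \<longrightarrow> V \<le> v0 \<longrightarrow>
      cmod ((\<integral>\<omega>. iexp (u * ((\<Sum>n\<in>A. X n \<omega> t - L.\<mu>t) / sqrt (real (card A)))) \<partial>Pr)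
        - of_real (exp (- (u\<^sup>2 * V / 2)))) \<le> \<eta>" if "0 < \<eta>" for u v0 \<eta>
    unfolding L.\<mu>t_def by (rule weakly_dependent_uniform_clt[OF L.prob_space_axioms dependence Xm tD that])
  define V where "V N = cond_var Pr (design_algebra Pr N (Mc N) T) (L.signal N)" for N
  have V_meas: "V N \<in> borel_measurable Pr" for N
    unfolding V_def cond_var_def[abs_def] by (rule borel_measurable_cond_exp2)
  have V_AE: "AE \<omega> in Pr. V N \<omega> = L.var_sel N \<omega>" if "1 \<le> N" for N
    unfolding V_def by (rule L.cond_var_signal[OF that mom])
  have V_lim: "tendsto_in_prob Pr V S_mu_t"
    using S_mu_limit unfolding V_def[abs_def] L.signal_def[abs_def] PN[symmetric] \<mu>[symmetric]
    by (simp add: \<pi>_def L.\<pi>_def)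
  have Q_lim: "tendsto_in_prob Pr L.var_plug Sigma_t"
    using Sigma_limit unfolding L.var_plug_def[abs_def] PN[symmetric]
    by (simp add: \<pi>_def W_def L.\<pi>_def L.W_def)
  have grid_lim: "\<forall>\<^sub>F N in sequentially. 0 < h N" "h \<longlonglongrightarrow> 0"
    "filterlim (\<lambda>N. real N * lam N * h N) at_top sequentially"
    by (rule L.grid_limits[OF grid]; use h_in_grid in blast)+
  \<comment> \<open>A neighbourhood of \<open>t\<close> inside the domain. It eventually contains
    the window, as the lower bound on the window probability requires.\<close>
  obtain r where r: "0 < r" "{t - r..t + r} \<subseteq> J"
    by (rule L.increment_bound[OF regularity t_in_J]) (rule that; assumption)
  have rD: "{t - r..t + r} \<subseteq> time_domain"
    using r(2) regularity by (auto simp: local_regularity_def)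
  note P_lim = L.PN_at_top[OF r(1) rD grid_lim(2,3)]
  have lim: "(\<lambda>N. \<integral>\<omega>. iexp (u * (L.signal N \<omega> + L.noise N \<omega>)) \<partial>Pr) \<longlonglongrightarrow>
      of_real (exp (- (u\<^sup>2 * (S_mu_t + Sigma_t) / 2)))" for u
    by (rule L.char_limit[OF _ V_meas _ V_lim less_imp_le[OF S_mu_pos] Q_lim Sigma_nonneg P_lim grid_lim(2,1)])
      (rule clt V_AE; assumption)+
  obtain \<beta> where \<beta>: "\<beta> \<longlonglongrightarrow> 0" "\<And>N. 0 \<le> \<beta> N"
    "\<forall>\<^sub>F N in sequentially. integrable Pr (\<lambda>\<omega>. (L.bias N \<omega>)\<^sup>2) \<and> (\<integral>\<omega>. (L.bias N \<omega>)\<^sup>2 \<partial>Pr) \<le> \<beta> N"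
    by (rule L.bias_vanishes[OF regularity t_in_J grid_lim(1,2) h_small]) (rule that; assumption)
  define s where "s = sqrt (S_mu_t + Sigma_t)"
  have s: "0 < s" "s\<^sup>2 = S_mu_t + Sigma_t" using S_mu_pos Sigma_nonneg by (auto simp: s_def)
  have Am: "(\<lambda>\<omega>. sqrt (L.PN N \<omega>) * (L.muhat N \<omega> - L.\<mu>t)) \<in> borel_measurable Pr" for N
    using L.PN_measurable[of N] L.muhat_measurable[of N] by measurable
  have "weak_conv_m (\<lambda>N. distr Pr borel (\<lambda>\<omega>. sqrt (L.PN N \<omega>) * (L.muhat N \<omega> - L.\<mu>t)))
      (density lborel (normal_density 0 s))"
  \<comment> \<open>The bias is discarded at the level of characteristic functions, in place of
    Slutsky's lemma. Since \<open>s\<close> is positive, the limit law has a density.\<close>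
  proof (rule levy_continuity)
    show "real_distribution (distr Pr borel (\<lambda>\<omega>. sqrt (L.PN N \<omega>) * (L.muhat N \<omega> - L.\<mu>t)))" for N
      by (rule L.real_distribution_distr[OF Am])
    show "real_distribution (density lborel (normal_density 0 s))"
      unfolding real_distribution_def real_distribution_axioms_def
      using prob_space_normal_density[OF s(1), of 0] by simp
    fix u
    let ?A = "\<lambda>N. \<integral>\<omega>. iexp (u * (sqrt (L.PN N \<omega>) * (L.muhat N \<omega> - L.\<mu>t))) \<partial>Pr"
    let ?B = "\<lambda>N. \<integral>\<omega>. iexp (u * (L.signal N \<omega> + L.noise N \<omega>)) \<partial>Pr"
    have "(\<lambda>N. \<bar>u\<bar> * sqrt (\<beta> N)) \<longlonglongrightarrow> 0"
      using tendsto_mult[OF tendsto_const tendsto_real_sqrt[OF \<beta>(1)], of "\<bar>u\<bar>"] by simp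
    moreover have "\<forall>\<^sub>F N in sequentially. norm (?A N - ?B N) \<le> \<bar>u\<bar> * sqrt (\<beta> N)"
      using \<beta>(3) by eventually_elim (intro L.char_bias \<beta>(2); simp)
    ultimately have "(\<lambda>N. ?A N - ?B N) \<longlonglongrightarrow> 0" by (rule Lim_null_comparison[rotated])
    from tendsto_add[OF this lim[of u]]
    have "?A \<longlonglongrightarrow> of_real (exp (- (u\<^sup>2 * (S_mu_t + Sigma_t) / 2)))" by simp
    moreover have "char (distr Pr borel (\<lambda>\<omega>. sqrt (L.PN N \<omega>) * (L.muhat N \<omega> - L.\<mu>t))) u = ?A N" for N
      unfolding char_def by (rule integral_distr[OF Am]) simp
    ultimately show "(\<lambda>N. char (distr Pr borel (\<lambda>\<omega>. sqrt (L.PN N \<omega>) * (L.muhat N \<omega> - L.\<mu>t))) u)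
        \<longlonglongrightarrow> char (density lborel (normal_density 0 s)) u"
      by (simp add: char_normal[OF s(1)] s(2))
  qed
  then show ?thesis unfolding s_def PN muhat \<mu> .
qed

end
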